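(* For each $n$, let $\boldsymbol{d}=(d_i)_{i\in[n]}$ be a degree sequence with $d_i\geq1$ for all $i$ and $\ell_n=\sum_{i\in[n]}d_i$ even, and consider the configuration model $\mathrm{CM}_n(\boldsymbol{d})$. Let $D_n=d_{o}$, where $o$ is uniform on $[n]$. Suppose that there is a random variable $D$ with $\mathbb{P}(D\geq1)=1$ such that, as $n\to\infty$, (a) $D_n\to D$ in distribution, and (b) $\mathbb{E}[D_n]\to\mathbb{E}[D]<\infty$. Assume that $\mathbb{P}(D=2)<1$. Let $\nu=\mathbb{E}[D(D-1)]/\mathbb{E}[D]\in[0,\infty]$. (a) If $\nu>1$, then there exist $\xi\in[0,1)$ and $\zeta\in(0,1]$ such that, as $n\to\infty$, in probability, $$\frac{|\mathscr{C}_{\rm max}|}{n}\to\zeta,\qquad \frac{v_k(\mathscr{C}_{\rm max})}{n}\to\mathbb{P}(D=k)(1-\xi^k)\ \text{ for every }k\geq0,\qquad \frac{|E(\mathscr{C}_{\rm max})|}{n}\to\tfrac12\mathbb{E}[D](1-\xi^2),$$ while $|\mathscr{C}_{(2)}|/n\to0$ and $|E(\mathscr{C}_{(2)})|/n\to0$ in probability. (b) If $\nu\leq1$, then $|\mathscr{C}_{\rm max}|/n\to0$ and $|E(\mathscr{C}_{\rm max})|/n\to0$ in probability.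
   Context: Configuration model $\mathrm{CM}_n(\boldsymbol{d})$: attach $d_j$ half-edges to each vertex $j\in[n]=\{1,\dots,n\}$ and pair all $\ell_n$ half-edges uniformly at random (i.e. according to a uniform perfect matching of the half-edges); each pair of half-edges forms an edge. The result is a random multigraph (self-loops and multiple edges allowed) in which vertex $j$ has degree $d_j$ (a self-loop contributes 2 to the degree). $\mathscr{C}_{\rm max}$ and $\mathscr{C}_{(2)}$ are the largest and second largest connected components of $\mathrm{CM}_n(\boldsymbol{d})$, by number of vertices (ties broken arbitrarily); for a component $\mathscr{C}$, $|\mathscr{C}|$ is its number of vertices, $|E(\mathscr{C})|$ its number of edges, and $v_k(\mathscr{C})$ its number of vertices of degree $k$. *)

theory Defs
  imports "HOL-Probability.Probability" "HOL-Library.Disjoint_Sets"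
begin

text \<open>The half-edges attached to vertex \<open>j\<close> are the pairs \<open>(j, i)\<close> with \<open>i < d j\<close>.\<close>

type_synonym half_edge = "nat \<times> nat"

definition half_edges :: "nat \<Rightarrow> (nat \<Rightarrow> nat) \<Rightarrow> half_edge set" where
  "half_edges n d = (SIGMA j:{1..n}. {..<d j})"

definition perfect_matchings :: "'a set \<Rightarrow> 'a set set set" where
  "perfect_matchings H = {G. partition_on H G \<and> (\<forall>e\<in>G. card e = 2)}"

text \<open>
  A matching \<open>G\<close> of the half-edges is itself taken as the multigraph on \<open>{1..n}\<close>: the members
  of \<open>G\<close> are its edges, and an edge \<open>{(u, a), (v, b)}\<close> joins \<open>u = v\<close> (a self-loop) or \<open>u \<noteq> v\<close>.
  Parallel edges are distinct members of \<open>G\<close>.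
\<close>

definition configuration_model :: "nat \<Rightarrow> (nat \<Rightarrow> nat) \<Rightarrow> half_edge set set pmf" where
  "configuration_model n d = pmf_of_set (perfect_matchings (half_edges n d))"

definition endpoints :: "half_edge set \<Rightarrow> nat set" where
  "endpoints e = fst ` e"

definition adjacency :: "half_edge set set \<Rightarrow> (nat \<times> nat) set" where
  "adjacency G = {(u, v). \<exists>e\<in>G. endpoints e = {u, v}}"

definition components :: "nat \<Rightarrow> half_edge set set \<Rightarrow> nat set set" where
  "components n G = {1..n} // (adjacency G)\<^sup>*"

definition edges_in :: "half_edge set set \<Rightarrow> nat set \<Rightarrow> half_edge set set" where
  "edges_in G C = {e \<in> G. endpoints e \<subseteq> C}"

definition vertices_of_degree :: "(nat \<Rightarrow> nat) \<Rightarrow> nat \<Rightarrow> nat set \<Rightarrow> nat set" where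
  "vertices_of_degree d k C = {j \<in> C. d j = k}"

definition largest_component :: "nat \<Rightarrow> half_edge set set \<Rightarrow> nat set \<Rightarrow> bool" where
  "largest_component n G C \<longleftrightarrow>
     C \<in> components n G \<and> (\<forall>C'\<in>components n G. card C' \<le> card C)"

text \<open>The second largest component of a connected multigraph is empty by convention.\<close>

definition second_largest_component ::
    "nat \<Rightarrow> half_edge set set \<Rightarrow> nat set \<Rightarrow> nat set \<Rightarrow> bool" where
  "second_largest_component n G Cmax C \<longleftrightarrow>
     (if components n G = {Cmax} then C = {}
      else C \<in> components n G - {Cmax} \<and>
           (\<forall>C'\<in>components n G - {Cmax}. card C' \<le> card C))"

text \<open>Convergence in probability to a constant; the probability space may vary with \<open>n\<close>.\<close>

definition tendsto_in_prob :: "(nat \<Rightarrow> 'a pmf) \<Rightarrow> (nat \<Rightarrow> 'a \<Rightarrow> real) \<Rightarrow> real \<Rightarrow> bool" where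
  "tendsto_in_prob P X c \<longleftrightarrow>
     (\<forall>\<epsilon>>0. (\<lambda>n. \<P>(\<omega> in P n. \<bar>X n \<omega> - c\<bar> > \<epsilon>)) \<longlonglongrightarrow> 0)"

text \<open>
  Extended-valued, so that an infinite second moment gives \<open>\<infinity>\<close>. It is used only when
  \<open>D \<ge> 1\<close> almost surely, hence the truncation of negative values by \<^const>\<open>ennreal\<close> is immaterial.
\<close>

definition nu :: "'a measure \<Rightarrow> ('a \<Rightarrow> real) \<Rightarrow> ennreal" where
  "nu M D = (\<integral>\<^sup>+ \<omega>. ennreal (D \<omega> * (D \<omega> - 1)) \<partial>M) / (\<integral>\<^sup>+ \<omega>. ennreal (D \<omega>) \<partial>M)"

text \<open>\<^const>\<open>pmf_of_set\<close> is unspecified on empty or infinite sets; the following excludes this.\<close>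

lemma finite_perfect_matchings: "finite H \<Longrightarrow> finite (perfect_matchings H)"
  unfolding perfect_matchings_def
  by (rule finite_subset[of _ "Pow (Pow H)"]) (auto simp: partition_on_def)

lemma perfect_matchings_nonempty:
  assumes "finite H" "even (card H)"
  shows "perfect_matchings H \<noteq> {}"
  using assms
proof (induction "card H" arbitrary: H rule: less_induct)
  case less
  show ?case
  proof (cases "H = {}")
    case True
    then have "{} \<in> perfect_matchings H" by (simp add: perfect_matchings_def partition_on_def)
    then show ?thesis by blast
  next
    case False
    then obtain a where a: "a \<in> H" by blast
    have "H - {a} \<noteq> {}"
    proof
      assume "H - {a} = {}"
      with a have "H = {a}" by blast
      with less.prems show False by simp
    qed
    then obtain b where b: "b \<in> H" "b \<noteq> a" by blast
    define K where "K = H - {a, b}"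
    have cK: "card K = card H - 2"
      unfolding K_def using a b less.prems(1) by (subst card_Diff_subset) auto
    have "card H > 0" using False less.prems(1) by (simp add: card_gt_0_iff)
    then have "perfect_matchings K \<noteq> {}"
      using less cK by (intro less.hyps) (auto simp: K_def)
    then obtain G where G: "partition_on K G" "\<forall>e\<in>G. card e = 2"
      by (auto simp: perfect_matchings_def)
    have "disjnt {a, b} (\<Union>G)"
      using G(1) by (auto simp: partition_on_def disjnt_def K_def)
    then have "partition_on H (insert {a, b} G)"
      using partition_on_insert[of "{a, b}" G H] G(1) a b(1) by (simp add: K_def)
    then have "insert {a, b} G \<in> perfect_matchings H"
      using G(2) b by (auto simp: perfect_matchings_def)
    then show ?thesis by blast
  qed
qed

lemma set_pmf_configuration_model:
  assumes "even (\<Sum>i\<in>{1..n}. d i)"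
  shows "set_pmf (configuration_model n d) = perfect_matchings (half_edges n d)"
proof -
  have "finite (half_edges n d)" "card (half_edges n d) = (\<Sum>i\<in>{1..n}. d i)"
    by (auto simp: half_edges_def)
  with assms show ?thesis unfolding configuration_model_def
    by (intro set_pmf_of_set perfect_matchings_nonempty finite_perfect_matchings) auto
qed

end

theory Submission
  imports Defs
begin

text \<open>
The matching is revealed one edge at a time. In the state \<open>(H, W)\<close> the half-edges in \<open>H\<close> are still
unmatched and \<open>W\<close> contains the vertices met so far. One takes an active half-edge, that is, a
member of \<open>H\<close> at a vertex of \<open>W\<close>; its partner is uniform on the rest of \<open>H\<close>, and the matching of
what remains is again uniform (\<open>matching_prob_peel\<close>). The component of \<open>v\<close> has at most \<open>m\<close> edges
exactly if this exploration, started from \<open>{v}\<close>, runs out of active half-edges within \<open>m\<close> steps.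

As long as few half-edges have been seen, the partner lies at a fresh vertex of degree \<open>k\<close> with
probability close to \<open>r k = k * P(D = k) / E D\<close>. The number of active half-edges then changes by
\<open>k - 2\<close>, and such a walk started from \<open>j\<close> dies out with probability \<open>xi ^ j\<close>, where \<open>xi\<close> is the
least fixed point in \<open>[0, 1]\<close> of \<open>gen x = (\<Sum>k. r k * x ^ (k - 1))\<close>. One has \<open>xi < 1\<close> if \<open>\<nu> > 1\<close>,
and \<open>xi = 1\<close> if \<open>\<nu> \<le> 1\<close> and \<open>D\<close> is not almost surely \<open>2\<close>.

Dying within a fixed number of steps involves only boundedly many vertices, which gives
the lower bound \<open>xi ^ k - e\<close> for the probability that a vertex of degree \<open>k\<close> has a small component
(\<open>small_component_lower_xi\<close>). For the upper bounds take \<open>x\<close> slightly above \<open>xi\<close> with \<open>gen x < x\<close>.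
Because the degrees are uniformly integrable, any \<open>\<epsilon> * n\<close> vertices carry only a small proportion
of the half-edges; hence \<open>x\<close> to the number of active half-edges decreases in conditional mean by a
factor \<open>\<rho> < 1\<close> in each of the first \<open>\<epsilon> * n\<close> steps (\<open>drift_step\<close>). Three facts follow.
\<^item> The exploration from a vertex of degree \<open>k\<close> dies within \<open>\<epsilon> * n - 1\<close> steps with probability at most
  \<open>x ^ k\<close>.
\<^item> Two vertices of degree \<open>k\<close> lie in two different small components with probability at most
  \<open>x ^ (2 * k)\<close>. The second moment method therefore shows that the number of vertices of degree
  \<open>k\<close> in small components is concentrated around \<open>n * P(D = k) * xi ^ k\<close>.
\<^item> An exploration that survives \<open>\<epsilon> * n\<close> steps has \<open>\<kappa> * n\<close> active half-edges at some time, except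
  with exponentially small probability. An exploration from another vertex hits one of these in
  each of its steps with probability bounded below, so a second component with more than \<open>m\<close>
  edges is unlikely when \<open>m\<close> is large (\<open>disconnected_pair_bound\<close>).

So all but a small proportion of the pairs of vertices in components with more than \<open>m\<close> edges are
connected, and one component must contain almost all such vertices (\<open>giant\<close>). Its number of
vertices of each degree follows, its number of edges is half the sum of its degrees, and nothing of linear
size is left for the second component. If \<open>xi = 1\<close>, almost all vertices lie in small components.
\<close>

section \<open>Uniform perfect matchings\<close>

lemma perfect_matchings_insert:
  assumes "x \<in> H" "y \<in> H" "x \<noteq> y" "G \<in> perfect_matchings (H - {x, y})"
  shows "insert {x, y} G \<in> perfect_matchings H"
proof -
  have G: "\<Union>G = H - {x, y}" "disjoint G" "{} \<notin> G" "\<forall>e\<in>G. card e = 2"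
    using assms(4) by (auto simp: perfect_matchings_def partition_on_def)
  have "disjoint (insert {x, y} G)"
    unfolding pairwise_insert using G(1,2) by (auto simp: disjnt_def)
  then show ?thesis
    using G assms by (auto simp: perfect_matchings_def partition_on_def)
qed

lemma perfect_matchings_remove:
  assumes "G \<in> perfect_matchings H" "{x, y} \<in> G"
  shows "G - {{x, y}} \<in> perfect_matchings (H - {x, y})" "x \<in> H" "y \<in> H" "x \<noteq> y"
proof -
  have G: "\<Union>G = H" "disjoint G" "{} \<notin> G" "\<forall>e\<in>G. card e = 2"
    using assms(1) by (auto simp: perfect_matchings_def partition_on_def)
  show "x \<in> H" "y \<in> H" using G(1) assms(2) by auto
  show "x \<noteq> y"
  proof
    assume "x = y"
    then have "card {x, y} = 1" by simp
    then show False using G(4) assms(2) by fastforce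
  qed
  have "\<Union>(G - {{x, y}}) = H - {x, y}"
  proof (intro set_eqI iffI)
    fix z assume "z \<in> \<Union>(G - {{x, y}})"
    then obtain e where e: "e \<in> G" "e \<noteq> {x, y}" "z \<in> e" by blast
    then have "e \<inter> {x, y} = {}"
      using G(2) assms(2) by (metis disjnt_def pairwiseD)
    then show "z \<in> H - {x, y}" using e G(1) by blast
  next
    fix z assume "z \<in> H - {x, y}"
    then show "z \<in> \<Union>(G - {{x, y}})" using G(1) by blast
  qed
  moreover have "disjoint (G - {{x, y}})" using G(2) by (rule pairwise_subset) auto
  ultimately show "G - {{x, y}} \<in> perfect_matchings (H - {x, y})"
    using G by (auto simp: perfect_matchings_def partition_on_def)
qed

lemma perfect_matchings_partner:
  assumes "G \<in> perfect_matchings H" "x \<in> H"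
  obtains y where "{x, y} \<in> G"
proof -
  obtain e where e: "e \<in> G" "x \<in> e"
    using assms by (auto simp: perfect_matchings_def partition_on_def)
  moreover have "card e = 2" using assms(1) e(1) by (auto simp: perfect_matchings_def)
  ultimately have "\<exists>y. e = {x, y}" by (auto simp: card_2_iff)
  then show ?thesis using that e by blast
qed

lemma perfect_matchings_edge:
  assumes "G \<in> perfect_matchings H" "e \<in> G"
  obtains x y where "e = {x, y}" "x \<noteq> y" "x \<in> H" "y \<in> H" "endpoints e = {fst x, fst y}"
proof -
  have "card e = 2" "e \<subseteq> H"
    using assms by (auto simp: perfect_matchings_def partition_on_def)
  then obtain x y where "e = {x, y}" "x \<noteq> y" by (auto simp: card_2_iff)
  with \<open>e \<subseteq> H\<close> show ?thesis by (intro that[of x y]) (auto simp: endpoints_def)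
qed

lemma disjoint_edges_unique_partner:
  assumes "G \<in> perfect_matchings H" "{x, y} \<in> G" "{x, z} \<in> G"
  shows "y = z"
proof -
  have "disjoint G" using assms(1) by (auto simp: perfect_matchings_def partition_on_def)
  moreover have "\<not> disjnt {x, y} {x, z}" by (simp add: disjnt_def)
  ultimately have "{x, y} = {x, z}" using assms(2,3) by (meson pairwiseD)
  then show ?thesis by (auto simp: doubleton_eq_iff)
qed

text \<open>
Sorting the matchings by the partner \<open>y\<close> of a fixed half-edge \<open>x\<close> is the combinatorial form of
revealing one edge.
\<close>

lemma perfect_matchings_peel:
  assumes "x \<in> H"
  shows "{G \<in> perfect_matchings H. P G} =
    (\<Union>y\<in>H - {x}. insert {x, y} ` {G \<in> perfect_matchings (H - {x, y}). P (insert {x, y} G)})"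
    (is "?L = ?R")
proof
  show "?R \<subseteq> ?L"
  proof
    fix G assume "G \<in> ?R"
    then obtain y G' where "y \<in> H" "x \<noteq> y" "G' \<in> perfect_matchings (H - {x, y})"
      "P (insert {x, y} G')" "G = insert {x, y} G'" by auto
    then show "G \<in> ?L" using perfect_matchings_insert[OF assms, of y G'] by simp
  qed
  show "?L \<subseteq> ?R"
  proof
    fix G assume G: "G \<in> ?L"
    then have pm: "G \<in> perfect_matchings H" by simp
    from perfect_matchings_partner[OF pm assms] obtain y where y: "{x, y} \<in> G" .
    then have eq: "insert {x, y} (G - {{x, y}}) = G" by (simp add: insert_absorb)
    have "G - {{x, y}} \<in> perfect_matchings (H - {x, y})" "y \<in> H - {x}"
      using perfect_matchings_remove[OF pm y] by simp_all
    moreover have "P (insert {x, y} (G - {{x, y}}))" using G eq by (simp del: insert_Diff_single)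
    ultimately have "G \<in> insert {x, y} ` {G \<in> perfect_matchings (H - {x, y}). P (insert {x, y} G)}"
      by (intro image_eqI[where x = "G - {{x, y}}"]) (simp_all only: eq mem_Collect_eq simp_thms)
    then show "G \<in> ?R" using \<open>y \<in> H - {x}\<close> by (rule UN_I[rotated])
  qed
qed

lemma card_perfect_matchings_peel:
  assumes "finite H" "x \<in> H"
  shows "card {G \<in> perfect_matchings H. P G} =
    (\<Sum>y\<in>H - {x}. card {G \<in> perfect_matchings (H - {x, y}). P (insert {x, y} G)})"
proof -
  have notin: "{x, y} \<notin> G" if "G \<in> perfect_matchings (H - {x, y})" for y G
    using that by (auto simp: perfect_matchings_def partition_on_def)
  have inj: "inj_on (insert {x, y}) {G \<in> perfect_matchings (H - {x, y}). P (insert {x, y} G)}" for y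
    by (rule inj_onI) (use notin in \<open>auto simp: insert_ident\<close>)
  have "card {G \<in> perfect_matchings H. P G} =
    (\<Sum>y\<in>H - {x}. card (insert {x, y} ` {G \<in> perfect_matchings (H - {x, y}). P (insert {x, y} G)}))"
    unfolding perfect_matchings_peel[OF assms(2)]
  proof (rule card_UN_disjoint)
    show "\<forall>y\<in>H - {x}. finite (insert {x, y} `
        {G \<in> perfect_matchings (H - {x, y}). P (insert {x, y} G)})"
      using assms by (intro ballI finite_imageI finite_subset[OF Collect_restrict]
          finite_perfect_matchings) auto
    show "\<forall>y\<in>H - {x}. \<forall>z\<in>H - {x}. y \<noteq> z \<longrightarrow>
       insert {x, y} ` {G \<in> perfect_matchings (H - {x, y}). P (insert {x, y} G)} \<inter>
       insert {x, z} ` {G \<in> perfect_matchings (H - {x, z}). P (insert {x, z} G)} = {}"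
    proof (intro ballI impI equals0I)
      fix y z G assume yz: "y \<in> H - {x}" "z \<in> H - {x}" "y \<noteq> z" and
        G: "G \<in> insert {x, y} ` {G \<in> perfect_matchings (H - {x, y}). P (insert {x, y} G)} \<inter>
             insert {x, z} ` {G \<in> perfect_matchings (H - {x, z}). P (insert {x, z} G)}"
      from IntD1[OF G] obtain G' where
        G': "G = insert {x, y} G'" "G' \<in> perfect_matchings (H - {x, y})" by auto
      from IntD2[OF G] have "{x, z} \<in> G" by (elim imageE) simp
      moreover have "{x, y} \<in> G" using G'(1) by simp
      moreover have "G \<in> perfect_matchings H"
        unfolding G'(1) using yz(1) by (intro perfect_matchings_insert[OF assms(2) _ _ G'(2)]) auto
      ultimately show False using disjoint_edges_unique_partner[of G H x y z] yz(3) by blast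
    qed
  qed (use assms in auto)
  also have "\<dots> = (\<Sum>y\<in>H - {x}. card {G \<in> perfect_matchings (H - {x, y}). P (insert {x, y} G)})"
    using inj by (simp add: card_image)
  finally show ?thesis .
qed

text \<open>
The double factorial \<open>(c - 1)!!\<close> for even \<open>c\<close>. That the number of perfect matchings is determined by
the number of half-edges makes the partner of a half-edge uniform.
\<close>

fun num_matchings :: "nat \<Rightarrow> nat" where
  "num_matchings 0 = 1"
| "num_matchings (Suc 0) = 0"
| "num_matchings (Suc (Suc c)) = Suc c * num_matchings c"

lemma card_perfect_matchings:
  "finite H \<Longrightarrow> card (perfect_matchings H) = num_matchings (card H)"
proof (induction "card H" arbitrary: H rule: num_matchings.induct)
  case 1
  then have "perfect_matchings H = {{}}"
    by (auto simp: perfect_matchings_def partition_on_def)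
  with 1 show ?case by simp
next
  case 2
  then obtain a where a: "H = {a}" by (metis One_nat_def card_1_singletonE)
  have "G \<notin> perfect_matchings H" for G
  proof
    assume G: "G \<in> perfect_matchings H"
    have "a \<in> H" using a by simp
    from perfect_matchings_partner[OF G this] obtain y where "{a, y} \<in> G" .
    from perfect_matchings_remove[OF G this] a show False by simp
  qed
  then have "perfect_matchings H = {}" by auto
  then have "card (perfect_matchings H) = 0" by simp
  then show ?case by (simp flip: 2(1))
next
  case (3 c)
  then obtain x where x: "x \<in> H" by fastforce
  have c: "card (H - {x, y}) = c" if "y \<in> H - {x}" for y
    using that x 3 by (subst card_Diff_subset) auto
  have "card (perfect_matchings H) = (\<Sum>y\<in>H - {x}. card (perfect_matchings (H - {x, y})))"
    using card_perfect_matchings_peel[OF \<open>finite H\<close> x, of "\<lambda>_. True"] by simp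
  also have "\<dots> = (\<Sum>y\<in>H - {x}. num_matchings c)"
    using 3 c by (intro sum.cong) auto
  also have "\<dots> = num_matchings (card H)"
    using 3(2) 3(3) x by (simp flip: 3(2))
  finally show ?case .
qed

lemma card_perfect_matchings_pos:
  "finite H \<Longrightarrow> even (card H) \<Longrightarrow> card (perfect_matchings H) > 0"
  by (simp add: card_gt_0_iff finite_perfect_matchings perfect_matchings_nonempty)

lemma finite_matching: "finite H \<Longrightarrow> G \<in> perfect_matchings H \<Longrightarrow> finite G"
  by (auto simp: perfect_matchings_def partition_on_def intro: finite_UnionD)

lemma card_Diff_pair:
  assumes "finite H" "x \<in> H" "y \<in> H - {x}"
  shows "card H = card (H - {x, y}) + 2"
proof -
  have "card {x, y} \<le> card H" using assms by (intro card_mono) auto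
  then show ?thesis using assms by (subst card_Diff_subset) auto
qed

lemma card_even_ge_2:
  assumes "finite H" "even (card H)" "x \<in> H"
  shows "2 \<le> card H"
proof -
  have "card H \<noteq> 0" using assms by auto
  moreover have "card H \<noteq> 1" using assms(2) by auto
  ultimately show ?thesis by linarith
qed

text \<open>
Probabilities under the uniform perfect matching are kept as quotients of cardinalities, because
the arguments condition on a partner by splitting the finite set of matchings.
\<close>

definition matching_prob :: "'a set \<Rightarrow> ('a set set \<Rightarrow> bool) \<Rightarrow> real" where
  "matching_prob H P = real (card {G \<in> perfect_matchings H. P G}) / real (card (perfect_matchings H))"

text \<open>
The partner \<open>y\<close> of \<open>x\<close> is uniform, and given \<open>y\<close> the rest is a uniform matching of \<open>H - {x, y}\<close>. Since
\<open>x\<close> is arbitrary, an exploration may use any rule to choose the half-edge that it reveals next.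
\<close>

lemma matching_prob_peel:
  assumes "finite H" "even (card H)" "x \<in> H"
  shows "matching_prob H P =
    (\<Sum>y\<in>H - {x}. matching_prob (H - {x, y}) (\<lambda>G. P (insert {x, y} G))) / (real (card H) - 1)"
proof -
  obtain c where c: "card H = Suc (Suc c)"
    using assms by (metis card_gt_0_iff emptyE even_Suc not0_implies_Suc not_less_zero odd_one One_nat_def)
  have card: "card (H - {x, y}) = c" if "y \<in> H - {x}" for y
    using that assms c by (subst card_Diff_subset) auto
  have "(\<Sum>y\<in>H - {x}. matching_prob (H - {x, y}) (\<lambda>G. P (insert {x, y} G))) =
     (\<Sum>y\<in>H - {x}. real (card {G \<in> perfect_matchings (H - {x, y}). P (insert {x, y} G)})
         / real (num_matchings c))"
    unfolding matching_prob_def using assms card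
    by (intro sum.cong) (auto simp: card_perfect_matchings)
  also have "\<dots> = real (card {G \<in> perfect_matchings H. P G}) / real (num_matchings c)"
    unfolding card_perfect_matchings_peel[OF assms(1,3)]
    by (simp add: sum_divide_distrib)
  finally show ?thesis
    unfolding matching_prob_def using assms c
    by (simp add: card_perfect_matchings algebra_simps flip: divide_divide_eq_left)
      (simp add: algebra_simps)
qed

lemma matching_prob_mono:
  assumes "finite H" "\<And>G. G \<in> perfect_matchings H \<Longrightarrow> P G \<Longrightarrow> Q G"
  shows "matching_prob H P \<le> matching_prob H Q"
  unfolding matching_prob_def using assms
  by (intro divide_right_mono of_nat_mono card_mono) (auto simp: finite_perfect_matchings)

lemma matching_prob_cong:
  assumes "\<And>G. G \<in> perfect_matchings H \<Longrightarrow> P G \<longleftrightarrow> Q G"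
  shows "matching_prob H P = matching_prob H Q"
  unfolding matching_prob_def using assms by (metis (mono_tags, lifting) Collect_cong)

lemma matching_prob_nonneg [simp]: "0 \<le> matching_prob H P"
  by (simp add: matching_prob_def)

lemma matching_prob_le_1: "finite H \<Longrightarrow> matching_prob H P \<le> 1"
  unfolding matching_prob_def
  by (intro divide_le_eq_1[THEN iffD2]) (auto intro!: card_mono simp: finite_perfect_matchings card_gt_0_iff)

lemma matching_prob_eq_0:
  assumes "\<And>G. G \<in> perfect_matchings H \<Longrightarrow> \<not> P G"
  shows "matching_prob H P = 0"
proof -
  have empty: "{G \<in> perfect_matchings H. P G} = {}" using assms by blast
  show ?thesis unfolding matching_prob_def empty by simp
qed

lemma matching_prob_eq_1:
  assumes "finite H" "even (card H)" "\<And>G. G \<in> perfect_matchings H \<Longrightarrow> P G"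
  shows "matching_prob H P = 1"
proof -
  have all: "{G \<in> perfect_matchings H. P G} = perfect_matchings H" using assms by blast
  show ?thesis unfolding matching_prob_def all using card_perfect_matchings_pos[OF assms(1,2)] by simp
qed

lemma matching_prob_or:
  assumes "finite H"
  shows "matching_prob H (\<lambda>G. P G \<or> Q G) \<le> matching_prob H P + matching_prob H Q"
proof -
  have "card {G \<in> perfect_matchings H. P G \<or> Q G}
      \<le> card ({G \<in> perfect_matchings H. P G} \<union> {G \<in> perfect_matchings H. Q G})"
    using assms by (intro card_mono) (auto simp: finite_perfect_matchings)
  also have "\<dots> \<le> card {G \<in> perfect_matchings H. P G} + card {G \<in> perfect_matchings H. Q G}"
    by (rule card_Un_le)
  finally have "real (card {G \<in> perfect_matchings H. P G \<or> Q G})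
    \<le> real (card {G \<in> perfect_matchings H. P G}) + real (card {G \<in> perfect_matchings H. Q G})" by simp
  then show ?thesis
    unfolding matching_prob_def add_divide_distrib[symmetric] by (rule divide_right_mono) simp
qed

lemma matching_prob_disjoint_or:
  assumes "finite H" "\<And>G. \<not> (P G \<and> Q G)"
  shows "matching_prob H (\<lambda>G. P G \<or> Q G) = matching_prob H P + matching_prob H Q"
proof -
  have "{G \<in> perfect_matchings H. P G \<or> Q G}
      = {G \<in> perfect_matchings H. P G} \<union> {G \<in> perfect_matchings H. Q G}" by auto
  moreover have "card ({G \<in> perfect_matchings H. P G} \<union> {G \<in> perfect_matchings H. Q G})
     = card {G \<in> perfect_matchings H. P G} + card {G \<in> perfect_matchings H. Q G}"
    using assms by (intro card_Un_disjoint) (auto simp: finite_perfect_matchings)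
  ultimately show ?thesis unfolding matching_prob_def by (simp add: add_divide_distrib)
qed

definition matching_mean :: "'a set \<Rightarrow> ('a set set \<Rightarrow> real) \<Rightarrow> real" where
  "matching_mean H f = (\<Sum>G\<in>perfect_matchings H. f G) / real (card (perfect_matchings H))"

lemma matching_mean_card:
  assumes "finite H" "finite S"
  shows "matching_mean H (\<lambda>G. real (card {a \<in> S. P a G})) = (\<Sum>a\<in>S. matching_prob H (P a))"
proof -
  have "(\<Sum>G\<in>perfect_matchings H. real (card {a \<in> S. P a G}))
      = (\<Sum>G\<in>perfect_matchings H. \<Sum>a\<in>S. of_bool (P a G))"
    using assms by (intro sum.cong) (auto simp: of_bool_def sum.If_cases Int_def)
  also have "\<dots> = (\<Sum>a\<in>S. \<Sum>G\<in>perfect_matchings H. of_bool (P a G))" by (rule sum.swap)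
  also have "\<dots> = (\<Sum>a\<in>S. real (card {G \<in> perfect_matchings H. P a G}))"
    using assms by (intro sum.cong) (auto simp: of_bool_def sum.If_cases Int_def finite_perfect_matchings)
  finally show ?thesis
    by (simp add: matching_mean_def matching_prob_def sum_divide_distrib)
qed

lemma matching_mean_mono:
  assumes "\<And>G. G \<in> perfect_matchings H \<Longrightarrow> f G \<le> g G"
  shows "matching_mean H f \<le> matching_mean H g"
  unfolding matching_mean_def using assms by (intro divide_right_mono sum_mono) auto

lemma matching_mean_add: "matching_mean H (\<lambda>G. f G + g G) = matching_mean H f + matching_mean H g"
  by (simp add: matching_mean_def sum.distrib add_divide_distrib)

lemma matching_mean_cmult: "matching_mean H (\<lambda>G. c * f G) = c * matching_mean H f"
  by (simp add: matching_mean_def sum_distrib_left)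

lemma matching_mean_const:
  assumes "finite H" "even (card H)"
  shows "matching_mean H (\<lambda>_. c) = c"
  using card_perfect_matchings_pos[OF assms] by (simp add: matching_mean_def)

lemma matching_markov:
  assumes "finite H" "0 < t" "\<And>G. G \<in> perfect_matchings H \<Longrightarrow> 0 \<le> f G"
    "\<And>G. G \<in> perfect_matchings H \<Longrightarrow> P G \<Longrightarrow> t \<le> f G"
  shows "matching_prob H P \<le> matching_mean H f / t"
proof -
  have "t * real (card {G \<in> perfect_matchings H. P G}) = (\<Sum>G | G \<in> perfect_matchings H \<and> P G. t)"
    by simp
  also have "\<dots> \<le> (\<Sum>G | G \<in> perfect_matchings H \<and> P G. f G)"
    using assms by (intro sum_mono) auto
  also have "\<dots> \<le> (\<Sum>G\<in>perfect_matchings H. f G)"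
    using assms by (intro sum_mono2) (auto simp: finite_perfect_matchings)
  finally have "real (card {G \<in> perfect_matchings H. P G}) \<le> (\<Sum>G\<in>perfect_matchings H. f G) / t"
    using assms(2) by (simp add: pos_le_divide_eq mult.commute)
  then have "real (card {G \<in> perfect_matchings H. P G}) / real (card (perfect_matchings H))
      \<le> (\<Sum>G\<in>perfect_matchings H. f G) / t / real (card (perfect_matchings H))"
    by (rule divide_right_mono) simp
  also have "\<dots> = (\<Sum>G\<in>perfect_matchings H. f G) / real (card (perfect_matchings H)) / t"
    by (simp only: divide_divide_eq_left mult.commute)
  finally show ?thesis unfolding matching_prob_def matching_mean_def .
qed

section \<open>Reachable vertices and components\<close>

definition reach :: "half_edge set set \<Rightarrow> nat set \<Rightarrow> nat set" where
  "reach G W = (adjacency G)\<^sup>* `` W"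

definition edge_count :: "half_edge set set \<Rightarrow> nat set \<Rightarrow> nat" where
  "edge_count G W = card (edges_in G (reach G W))"

lemma reach_superset: "W \<subseteq> reach G W"
  by (auto simp: reach_def)

lemma reach_mono: "G \<subseteq> G' \<Longrightarrow> W \<subseteq> W' \<Longrightarrow> reach G W \<subseteq> reach G' W'"
proof -
  assume "G \<subseteq> G'" "W \<subseteq> W'"
  then have "adjacency G \<subseteq> adjacency G'" by (auto simp: adjacency_def)
  then have "(adjacency G)\<^sup>* \<subseteq> (adjacency G')\<^sup>*" by (rule rtrancl_mono)
  with \<open>W \<subseteq> W'\<close> show ?thesis unfolding reach_def by blast
qed

lemma adjacencyI: "{x, y} \<in> G \<Longrightarrow> (fst x, fst y) \<in> adjacency G"
  unfolding adjacency_def endpoints_def by (simp, rule bexI[of _ "{x, y}"]) auto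

lemma reach_step: "u \<in> reach G W \<Longrightarrow> (u, v) \<in> adjacency G \<Longrightarrow> v \<in> reach G W"
  unfolding reach_def by (blast intro: rtrancl_into_rtrancl)

lemma reach_least:
  assumes "W \<subseteq> R" "\<And>u v. (u, v) \<in> adjacency G \<Longrightarrow> u \<in> R \<Longrightarrow> v \<in> R"
  shows "reach G W \<subseteq> R"
proof
  fix v assume "v \<in> reach G W"
  then obtain w where "w \<in> W" "(w, v) \<in> (adjacency G)\<^sup>*" by (auto simp: reach_def)
  from this(2) show "v \<in> R"
  proof induction
    case base
    then show ?case using \<open>w \<in> W\<close> assms(1) by blast
  next
    case (step y z)
    then show ?case using assms(2) by simp
  qed
qed

lemma sym_adjacency: "sym (adjacency G)"
  by (auto simp: adjacency_def sym_def insert_commute)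

lemma reach_sym: "u \<in> reach G {v} \<longleftrightarrow> v \<in> reach G {u}"
  unfolding reach_def using sym_rtrancl[OF sym_adjacency, of G] by (auto dest: symD)

text \<open>
Connection is symmetric. This lets a statement about the set explored from \<open>W\<close> be read as a
statement about an exploration started from \<open>v\<close>.
\<close>

lemma reach_disjoint_iff: "v \<notin> reach G W \<longleftrightarrow> reach G {v} \<inter> W = {}"
proof -
  have "v \<in> reach G W \<longleftrightarrow> (\<exists>w\<in>W. v \<in> reach G {w})" by (auto simp: reach_def)
  also have "\<dots> \<longleftrightarrow> (\<exists>w\<in>W. w \<in> reach G {v})" using reach_sym by metis
  finally show ?thesis by blast
qed

lemma reach_idem: "reach G (reach G W) = reach G W"
  by (auto simp: reach_def intro: rtrancl_trans)

lemma reach_subset_vertices: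
  assumes "G \<in> perfect_matchings (half_edges n d)" "W \<subseteq> {1..n}"
  shows "reach G W \<subseteq> {1..n}"
proof (rule reach_least[OF assms(2)])
  fix u v assume "(u, v) \<in> adjacency G"
  then obtain e where e: "e \<in> G" "endpoints e = {u, v}" by (auto simp: adjacency_def)
  obtain x y where xy: "x \<in> half_edges n d" "y \<in> half_edges n d" "endpoints e = {fst x, fst y}"
    by (rule perfect_matchings_edge[OF assms(1) e(1)])
  then have "fst x \<in> {1..n}" "fst y \<in> {1..n}" by (auto simp: half_edges_def)
  moreover have "{u, v} = {fst x, fst y}" using e(2) xy(3) by simp
  ultimately have "{u, v} \<subseteq> {1..n}" by simp
  then show "v \<in> {1..n}" by simp
qed

lemma component_reach:
  assumes "C \<in> components n G" "u \<in> C"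
  shows "reach G {u} = C"
proof -
  have eq: "equiv UNIV ((adjacency G)\<^sup>*)"
    by (intro equivI refl_rtrancl sym_rtrancl sym_adjacency trans_rtrancl) simp
  obtain v where C: "C = (adjacency G)\<^sup>* `` {v}" using assms(1) by (auto simp: components_def quotient_def)
  with assms(2) have "(v, u) \<in> (adjacency G)\<^sup>*" by simp
  then show ?thesis using equiv_class_eq[OF eq] unfolding reach_def C by metis
qed

lemma reach_component: "v \<in> {1..n} \<Longrightarrow> reach G {v} \<in> components n G"
  unfolding components_def reach_def by (rule quotientI)

lemma component_vertex:
  assumes "G \<in> perfect_matchings (half_edges n d)" "C \<in> components n G"
  obtains v where "v \<in> {1..n}" "C = reach G {v}"
  using assms(2) unfolding components_def reach_def by (elim quotientE) blast

lemma component_subset: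
  assumes "G \<in> perfect_matchings (half_edges n d)" "C \<in> components n G"
  shows "C \<subseteq> {1..n}"
proof -
  obtain v where "v \<in> {1..n}" "C = reach G {v}" by (rule component_vertex[OF assms])
  then show ?thesis using reach_subset_vertices[OF assms(1), of "{v}"] by simp
qed

lemma components_disjoint:
  assumes "C \<in> components n G" "C' \<in> components n G" "C \<noteq> C'"
  shows "C \<inter> C' = {}"
proof (rule ccontr)
  assume "C \<inter> C' \<noteq> {}"
  then obtain u where "u \<in> C" "u \<in> C'" by blast
  then have "C = C'" using component_reach[OF assms(1)] component_reach[OF assms(2)] by metis
  then show False using assms(3) by simp
qed

text \<open>
A set closed under adjacency contains both endpoints of an edge or none, so its half-edges are
exactly the members of its edges.
\<close>

lemma edges_in_closed:
  assumes G: "G \<in> perfect_matchings (half_edges n d)" and C: "C \<subseteq> {1..n}"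
    and closed: "\<And>u v. (u, v) \<in> adjacency G \<Longrightarrow> u \<in> C \<Longrightarrow> v \<in> C"
  shows "2 * card (edges_in G C) = (\<Sum>v\<in>C. d v)"
proof -
  have pm: "\<Union>G = half_edges n d" "disjoint G" "\<forall>e\<in>G. card e = 2"
    using G by (auto simp: perfect_matchings_def partition_on_def)
  have "\<Union>(edges_in G C) = (SIGMA v:C. {..<d v})"
  proof (intro set_eqI iffI)
    fix h assume "h \<in> \<Union>(edges_in G C)"
    then obtain e where "e \<in> G" "fst ` e \<subseteq> C" "h \<in> e" by (auto simp: edges_in_def endpoints_def)
    then have "h \<in> half_edges n d" "fst h \<in> C" using pm(1) by auto
    then show "h \<in> (SIGMA v:C. {..<d v})" by (auto simp: half_edges_def)
  next
    fix h assume h: "h \<in> (SIGMA v:C. {..<d v})"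
    then have h': "h \<in> half_edges n d" "fst h \<in> C" using C by (auto simp: half_edges_def)
    from perfect_matchings_partner[OF G h'(1)] obtain y where y: "{h, y} \<in> G" .
    have "fst y \<in> C" using closed[OF adjacencyI[OF y] h'(2)] .
    then have "{h, y} \<in> edges_in G C" using y h' by (simp add: edges_in_def endpoints_def)
    then show "h \<in> \<Union>(edges_in G C)" by blast
  qed
  moreover have "card (\<Union>(edges_in G C)) = sum card (edges_in G C)"
  proof (rule card_Union_disjoint)
    show "pairwise disjnt (edges_in G C)"
      using pm(2) by (rule pairwise_subset) (auto simp: edges_in_def)
    show "finite e" if "e \<in> edges_in G C" for e
      using that pm(3) by (auto simp: edges_in_def intro: card_ge_0_finite)
  qed
  moreover have "sum card (edges_in G C) = (\<Sum>e\<in>edges_in G C. 2)"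
    using pm(3) by (intro sum.cong) (auto simp: edges_in_def)
  moreover have "finite C" using C by (rule finite_subset) simp
  ultimately show ?thesis by simp
qed

lemma component_edges:
  assumes "G \<in> perfect_matchings (half_edges n d)" "C \<in> components n G"
  shows "2 * card (edges_in G C) = (\<Sum>v\<in>C. d v)"
proof -
  obtain v where "C = reach G {v}" by (rule component_vertex[OF assms])
  then show ?thesis
    using reach_step by (intro edges_in_closed[OF assms(1) component_subset[OF assms]]) blast
qed

text \<open>
With all degrees positive a component has at most as many vertices as half-edges. Hence few edges
mean few vertices.
\<close>

lemma card_reach_le:
  assumes G: "G \<in> perfect_matchings (half_edges n d)" and v: "v \<in> {1..n}"
    and pos: "\<And>i. i \<in> {1..n} \<Longrightarrow> 1 \<le> d i"
  shows "card (reach G {v}) \<le> 2 * edge_count G {v}"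
proof -
  have sub: "reach G {v} \<subseteq> {1..n}" using reach_subset_vertices[OF G] v by simp
  have "card (reach G {v}) = (\<Sum>u\<in>reach G {v}. 1)" by simp
  also have "\<dots> \<le> (\<Sum>u\<in>reach G {v}. d u)" using pos sub by (intro sum_mono) auto
  also have "\<dots> = 2 * edge_count G {v}"
    unfolding edge_count_def using edges_in_closed[OF G sub] reach_step by metis
  finally show ?thesis .
qed

section \<open>Peeling an edge off the explored component\<close>

definition active :: "half_edge set \<Rightarrow> nat set \<Rightarrow> half_edge set" where
  "active H W = {h \<in> H. fst h \<in> W}"

lemma adjacency_insert:
  "adjacency (insert {x, y} G) = adjacency G \<union> {(fst x, fst y), (fst y, fst x)}"
  by (auto simp: adjacency_def endpoints_def doubleton_eq_iff)

text \<open>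
An edge at a vertex of \<open>W\<close> may be traded for its other endpoint. This is the step of the exploration.
\<close>

lemma reach_peel:
  assumes "fst x \<in> W"
  shows "reach (insert {x, y} G) W = reach G (insert (fst y) W)"
proof
  let ?R = "reach G (insert (fst y) W)"
  have xy: "fst x \<in> ?R" "fst y \<in> ?R" using reach_superset[of "insert (fst y) W" G] assms by auto
  show "reach (insert {x, y} G) W \<subseteq> ?R"
  proof (rule reach_least)
    show "W \<subseteq> ?R" using reach_superset[of "insert (fst y) W" G] by auto
    fix u v assume "(u, v) \<in> adjacency (insert {x, y} G)" "u \<in> ?R"
    then show "v \<in> ?R" using xy reach_step by (auto simp: adjacency_insert)
  qed
  let ?L = "reach (insert {x, y} G) W"
  have "W \<subseteq> ?L" by (rule reach_superset)
  moreover have "fst y \<in> ?L"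
    by (rule reach_step[of "fst x"]) (use assms \<open>W \<subseteq> ?L\<close> in \<open>auto simp: adjacency_insert\<close>)
  moreover have "(u, v) \<in> adjacency (insert {x, y} G)" if "(u, v) \<in> adjacency G" for u v
    using that by (auto simp: adjacency_insert)
  ultimately show "?R \<subseteq> ?L" using reach_step[of _ "insert {x, y} G" W]
    by (intro reach_least) (simp, blast)
qed

text \<open>
Both endpoints of the peeled edge lie in the set explored from \<open>W\<close>, which \<open>v\<close> cannot reach; so
the component of \<open>v\<close> does not see this edge.
\<close>

lemma reach_insert_avoid:
  assumes "fst x \<in> W" "v \<notin> reach (insert {x, y} G) W"
  shows "reach (insert {x, y} G) {v} = reach G {v}"
proof
  let ?G = "insert {x, y} G"
  show "reach G {v} \<subseteq> reach ?G {v}" by (rule reach_mono) auto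
  have "fst x \<in> reach ?G W" using reach_superset assms(1) by blast
  moreover have "fst y \<in> reach ?G W"
    using \<open>fst x \<in> reach ?G W\<close> by (rule reach_step) (rule adjacencyI, simp)
  moreover have "reach ?G {v} \<inter> reach ?G W = {}"
    using assms(2) reach_disjoint_iff[of v ?G "reach ?G W"] by (simp add: reach_idem)
  ultimately have "fst x \<notin> reach G {v}" "fst y \<notin> reach G {v}"
    using \<open>reach G {v} \<subseteq> reach ?G {v}\<close> by blast+
  then show "reach ?G {v} \<subseteq> reach G {v}"
    using reach_superset[of "{v}" G]
    by (intro reach_least) (auto simp: adjacency_insert dest: reach_step)
qed

lemma edge_count_peel:
  assumes "finite H" "G \<in> perfect_matchings (H - {x, y})" "fst x \<in> W"
  shows "edge_count (insert {x, y} G) W = Suc (edge_count G (insert (fst y) W))"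
proof -
  let ?R = "reach G (insert (fst y) W)"
  have fin: "finite G" using assms by (intro finite_matching) auto
  have notin: "{x, y} \<notin> G" using assms(2) by (auto simp: perfect_matchings_def partition_on_def)
  have "endpoints {x, y} \<subseteq> ?R"
    using reach_superset[of "insert (fst y) W" G] assms(3) by (auto simp: endpoints_def)
  then have "edges_in (insert {x, y} G) ?R = insert {x, y} (edges_in G ?R)"
    by (auto simp: edges_in_def)
  moreover have "finite (edges_in G ?R)" "{x, y} \<notin> edges_in G ?R"
    using fin notin by (auto simp: edges_in_def)
  ultimately show ?thesis unfolding edge_count_def reach_peel[OF assms(3)] by simp
qed

lemma edge_count_insert_avoid:
  assumes "fst x \<in> W" "v \<notin> reach (insert {x, y} G) W"
  shows "edge_count (insert {x, y} G) {v} = edge_count G {v}"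
proof -
  have "fst x \<notin> reach G {v}"
    using assms reach_insert_avoid[OF assms] reach_disjoint_iff[of v "insert {x, y} G" W] by auto
  then have "edges_in (insert {x, y} G) (reach G {v}) = edges_in G (reach G {v})"
    by (auto simp: edges_in_def endpoints_def)
  then show ?thesis unfolding edge_count_def reach_insert_avoid[OF assms] by simp
qed

lemma no_active_edge:
  assumes "G \<in> perfect_matchings H" "active H W = {}" "e \<in> G"
  shows "endpoints e \<inter> W = {}"
proof -
  obtain x y where "x \<in> H" "y \<in> H" "endpoints e = {fst x, fst y}"
    by (rule perfect_matchings_edge[OF assms(1,3)])
  moreover have "h \<in> H \<Longrightarrow> fst h \<notin> W" for h using assms(2) unfolding active_def by blast
  ultimately show ?thesis by simp
qed

lemma reach_no_active:
  assumes "G \<in> perfect_matchings H" "active H W = {}"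
  shows "reach G W = W"
proof
  show "reach G W \<subseteq> W"
    using no_active_edge[OF assms] by (intro reach_least) (auto simp: adjacency_def)
qed (rule reach_superset)

lemma edge_count_no_active:
  assumes "G \<in> perfect_matchings H" "active H W = {}"
  shows "edge_count G W = 0"
proof -
  have "endpoints e \<noteq> {}" if "e \<in> G" for e
    by (rule perfect_matchings_edge[OF assms(1) that]) simp
  then have "edges_in G W = {}" using no_active_edge[OF assms] by (auto simp: edges_in_def)
  then show ?thesis by (simp add: edge_count_def reach_no_active[OF assms])
qed

text \<open>
Once \<open>W\<close> has no active half-edges left it is a union of complete components, and a fresh
exploration may start without forgetting \<open>W\<close>.
\<close>

lemma edge_count_insert_no_active:
  assumes "G \<in> perfect_matchings H" "active H W = {}"
  shows "edge_count G (insert v W) = edge_count G {v}"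
proof -
  have "reach G (insert v W) = reach G {v} \<union> reach G W"
    by (auto simp: reach_def)
  then have "edges_in G (reach G (insert v W)) = edges_in G (reach G {v})"
    using no_active_edge[OF assms] by (auto simp: edges_in_def reach_no_active[OF assms])
  then show ?thesis by (simp add: edge_count_def)
qed

section \<open>Exploration states\<close>

lemma finite_half_edges [simp]: "finite (half_edges n d)"
  by (simp add: half_edges_def)

lemma card_half_edges: "card (half_edges n d) = (\<Sum>i\<in>{1..n}. d i)"
  by (simp add: half_edges_def)

lemma card_half_edges_at:
  assumes "h \<in> half_edges n d"
  shows "card {h' \<in> half_edges n d. fst h' = fst h} = d (fst h)"
proof -
  have "{h' \<in> half_edges n d. fst h' = fst h} = Pair (fst h) ` {..<d (fst h)}"
    using assms by (auto simp: half_edges_def)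
  then show ?thesis by (simp add: card_image inj_on_def)
qed

text \<open>
All half-edges at vertices outside \<open>W\<close> are still unmatched. Therefore an exploration that has met few
vertices has removed few half-edges, whatever the number of its steps.
\<close>

definition exploration_state :: "nat \<Rightarrow> (nat \<Rightarrow> nat) \<Rightarrow> half_edge set \<Rightarrow> nat set \<Rightarrow> bool" where
  "exploration_state n d H W \<longleftrightarrow> finite W \<and> even (card H) \<and> H \<subseteq> half_edges n d \<and>
     {h \<in> half_edges n d. fst h \<notin> W} \<subseteq> H"

lemma exploration_state_finite: "exploration_state n d H W \<Longrightarrow> finite H"
  unfolding exploration_state_def by (meson finite_half_edges finite_subset)

lemma exploration_state_step:
  assumes "exploration_state n d H W" "x \<in> active H W" "y \<in> H - {x}"
  shows "exploration_state n d (H - {x, y}) (insert (fst y) W)"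
proof -
  have "card H = card (H - {x, y}) + 2"
    using assms exploration_state_finite[OF assms(1)] by (intro card_Diff_pair) (auto simp: active_def)
  then show ?thesis
    using assms by (auto simp: exploration_state_def active_def)
qed

lemma exploration_state_init:
  assumes "even (\<Sum>i\<in>{1..n}. d i)"
  shows "exploration_state n d (half_edges n d) {v}"
  using assms by (auto simp: exploration_state_def card_half_edges)

lemma card_insert_le_Suc: "card (insert v W) \<le> Suc (card W)"
  by (metis card_insert_le_m1 card.infinite card_insert_if finite_insert le_SucI order_refl)

lemma card_active_step_active:
  assumes "finite H" "x \<in> active H W" "y \<in> active H W" "x \<noteq> y"
  shows "card (active (H - {x, y}) (insert (fst y) W)) + 2 = card (active H W)"
proof -
  have "insert (fst y) W = W" using assms(3) by (auto simp: active_def)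
  then have "active (H - {x, y}) (insert (fst y) W) = active H W - {x, y}"
    by (auto simp: active_def)
  moreover have "finite (active H W)" using assms(1) by (simp add: active_def)
  ultimately show ?thesis using card_Diff_pair[of "active H W" x y] assms by simp
qed

text \<open>
A fresh vertex of degree \<open>k\<close> contributes all its half-edges except \<open>y\<close>, and \<open>x\<close> is used up: the number
of active half-edges changes by \<open>k - 2\<close>.
\<close>

lemma card_active_step_new:
  assumes "exploration_state n d H W" "x \<in> active H W" "y \<in> H" "fst y \<notin> W"
  shows "card (active (H - {x, y}) (insert (fst y) W)) + 2 = card (active H W) + d (fst y)"
proof -
  let ?g = "{h \<in> half_edges n d. fst h = fst y}"
  have fin: "finite (active H W)" "finite ?g"
    using exploration_state_finite[OF assms(1)] by (simp_all add: active_def)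
  have sub: "H \<subseteq> half_edges n d" "{h \<in> half_edges n d. fst h \<notin> W} \<subseteq> H"
    using assms(1) by (simp_all add: exploration_state_def)
  then have y: "y \<in> ?g" using assms(3) by auto
  have "?g \<subseteq> H" using assms(4) sub(2) by auto
  have eq: "active (H - {x, y}) (insert (fst y) W) = (active H W - {x}) \<union> (?g - {y})"
  proof (intro set_eqI iffI)
    fix h assume "h \<in> active (H - {x, y}) (insert (fst y) W)"
    then show "h \<in> (active H W - {x}) \<union> (?g - {y})" using sub(1) by (auto simp: active_def)
  next
    fix h assume "h \<in> (active H W - {x}) \<union> (?g - {y})"
    then show "h \<in> active (H - {x, y}) (insert (fst y) W)"
      using \<open>?g \<subseteq> H\<close> assms(2,4) by (auto simp: active_def)
  qed
  have "(active H W - {x}) \<inter> (?g - {y}) = {}" using assms(4) by (auto simp: active_def)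
  then have "card (active (H - {x, y}) (insert (fst y) W)) = card (active H W - {x}) + card (?g - {y})"
    unfolding eq using fin by (intro card_Un_disjoint) auto
  moreover have "card (active H W) = Suc (card (active H W - {x}))"
    using fin assms(2) by (simp only: card.remove)
  moreover have "card ?g = Suc (card (?g - {y}))"
    using fin y by (simp only: card.remove)
  moreover have "card ?g = d (fst y)" using card_half_edges_at[of y n d] y by simp
  ultimately show ?thesis by linarith
qed

lemma card_half_edges_le_active:
  assumes "exploration_state n d H W"
  shows "card (half_edges n d) \<le> card H + card (active (half_edges n d) W)"
proof -
  have "card (half_edges n d) \<le> card (H \<union> active (half_edges n d) W)"
    using assms exploration_state_finite[OF assms]
    by (intro card_mono) (auto simp: exploration_state_def active_def)
  also have "\<dots> \<le> card H + card (active (half_edges n d) W)" by (rule card_Un_le)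
  finally show ?thesis .
qed

lemma card_active_single:
  assumes "v \<in> {1..n}" "v \<notin> W" "exploration_state n d H W" "active H W = {}"
  shows "card (active H (insert v W)) = d v"
proof -
  have "active H (insert v W) = Pair v ` {..<d v}"
    using assms by (force simp: exploration_state_def active_def half_edges_def)
  then show ?thesis by (simp add: card_image inj_on_def)
qed

lemma card_active_init:
  assumes "v \<in> {1..n}"
  shows "card (active (half_edges n d) {v}) = d v"
proof -
  have "active (half_edges n d) {v} = Pair v ` {..<d v}"
    using assms by (force simp: active_def half_edges_def)
  then show ?thesis by (simp add: card_image inj_on_def)
qed

section \<open>Explorations with a drift\<close>

text \<open>
The supermartingale condition. While at most \<open>T\<close> vertices have been met, at most \<open>a\<close> half-edges are active
or used up. If the partner is active, \<open>x\<close> to the number of active half-edges gains the factor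
\<open>x powi (-2)\<close>, which happens for at most \<open>a\<close> partners; for a partner at a fresh vertex of degree \<open>k\<close>
the factor is \<open>x powi (k - 2)\<close>. The inequality \<open>drift\<close> says that, averaged over the partner, the factor
is at most \<open>\<rho>\<close>.
\<close>

locale exploration_drift =
  fixes n :: nat and d :: "nat \<Rightarrow> nat" and T a :: nat and x \<rho> :: real
  assumes x: "0 < x" "x \<le> 1" and \<rho>: "0 \<le> \<rho>" "\<rho> \<le> 1"
    and few_active: "\<And>W. finite W \<Longrightarrow> card W \<le> T \<Longrightarrow> card (active (half_edges n d) W) \<le> a"
    and many_half_edges: "a + 1 < card (half_edges n d)"
    and drift: "real a + (\<Sum>h\<in>half_edges n d. x ^ d (fst h)) \<le>
                  \<rho> * x\<^sup>2 * (real (card (half_edges n d)) - real a - 1)"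
begin

lemma drift_step:
  assumes st: "exploration_state n d H W" and T: "card W \<le> T" and x0: "x0 \<in> active H W"
  shows "(\<Sum>y\<in>H - {x0}. x ^ card (active (H - {x0, y}) (insert (fst y) W))) / (real (card H) - 1)
           \<le> \<rho> * x ^ card (active H W)"
proof -
  let ?H0 = "half_edges n d"
  have fin: "finite W" "finite H" "H \<subseteq> ?H0"
    using st exploration_state_finite[OF st] by (auto simp: exploration_state_def)
  have a: "card (active ?H0 W) \<le> a" using few_active fin T by auto
  have aH: "card (active H W) \<le> a"
  proof -
    have "active H W \<subseteq> active ?H0 W" "finite (active ?H0 W)" using fin by (auto simp: active_def)
    then show ?thesis using a card_mono le_trans by blast
  qed
  have cH: "real (card ?H0) - real a - 1 \<le> real (card H) - 1" "0 < real (card ?H0) - real a - 1"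
    using card_half_edges_le_active[OF st] a many_half_edges by linarith+
  \<comment> \<open>Multiplying by \<open>x\<^sup>2\<close> avoids the exponents \<open>k - 2\<close> and \<open>- 2\<close> of the increments.\<close>
  let ?f = "\<lambda>y. x ^ card (active (H - {x0, y}) (insert (fst y) W))"
  have "x\<^sup>2 * (\<Sum>y\<in>H - {x0}. ?f y) = (\<Sum>y\<in>H - {x0}. x\<^sup>2 * ?f y)"
    by (simp add: sum_distrib_left)
  also have "\<dots> \<le> (\<Sum>y\<in>H - {x0}. x ^ card (active H W) *
                  (if y \<in> active H W then 1 else x ^ d (fst y)))"
  proof (rule sum_mono)
    fix y assume y: "y \<in> H - {x0}"
    show "x\<^sup>2 * ?f y \<le> x ^ card (active H W) * (if y \<in> active H W then 1 else x ^ d (fst y))"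
    proof (cases "y \<in> active H W")
      case True
      then have "card (active H W) = card (active (H - {x0, y}) (insert (fst y) W)) + 2"
        using card_active_step_active[of H x0 W y] fin x0 y by auto
      then show ?thesis using True by (simp add: power_add power2_eq_square)
    next
      case False
      then have "card (active (H - {x0, y}) (insert (fst y) W)) + 2 = card (active H W) + d (fst y)"
        using card_active_step_new[OF st x0, of y] y by (auto simp: active_def)
      then have "x ^ card (active (H - {x0, y}) (insert (fst y) W)) * x\<^sup>2
          = x ^ card (active H W) * x ^ d (fst y)"
        by (simp only: power_add[symmetric])
      then show ?thesis using False by (simp add: mult.commute)
    qed
  qed
  also have "\<dots> = x ^ card (active H W) * (\<Sum>y\<in>H - {x0}. if y \<in> active H W then 1 else x ^ d (fst y))"
    by (simp add: sum_distrib_left)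
  also have "\<dots> \<le> x ^ card (active H W) * (\<rho> * x\<^sup>2 * (real (card H) - 1))"
  proof (rule mult_left_mono)
    have "(\<Sum>y\<in>H - {x0}. if y \<in> active H W then 1 else x ^ d (fst y))
        \<le> (\<Sum>y\<in>H - {x0}. (if y \<in> active H W then 1 else 0) + x ^ d (fst y))"
      using x by (intro sum_mono) auto
    also have "\<dots> \<le> (\<Sum>y\<in>H. if y \<in> active H W then 1 else 0) + (\<Sum>y\<in>?H0. x ^ d (fst y))"
      unfolding sum.distrib using fin x by (intro add_mono sum_mono2) auto
    also have "(\<Sum>y\<in>H. if y \<in> active H W then 1 else 0) = real (card (active H W))"
      using fin by (simp add: active_def sum.If_cases Int_def conj_ac)
    also have "real (card (active H W)) + (\<Sum>y\<in>?H0. x ^ d (fst y))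
        \<le> \<rho> * x\<^sup>2 * (real (card ?H0) - real a - 1)"
      using drift aH by linarith
    also have "\<dots> \<le> \<rho> * x\<^sup>2 * (real (card H) - 1)"
      using cH \<rho> by (intro mult_left_mono) auto
    finally show "(\<Sum>y\<in>H - {x0}. if y \<in> active H W then 1 else x ^ d (fst y))
        \<le> \<rho> * x\<^sup>2 * (real (card H) - 1)" .
  qed (use x in auto)
  finally have "x\<^sup>2 * (\<Sum>y\<in>H - {x0}. ?f y) \<le> x\<^sup>2 * (\<rho> * x ^ card (active H W) * (real (card H) - 1))"
    by (simp add: mult_ac)
  then have "(\<Sum>y\<in>H - {x0}. ?f y) \<le> \<rho> * x ^ card (active H W) * (real (card H) - 1)"
    using x by (simp add: mult_le_cancel_left)
  then show ?thesis using cH by (simp add: divide_le_eq)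
qed

text \<open>
Dying means that the number of active half-edges reaches \<open>0\<close>, where \<open>x\<close> to that number is \<open>1\<close>; so the
supermartingale bounds the probability of dying by its initial value. The event \<open>E\<close> concerns the
part of the matching that is untouched at that moment, and enters through its worst conditional
probability \<open>c\<close>. Induction on the number of steps replaces optional stopping.
\<close>

lemma exploration_dies_bound:
  fixes E :: "half_edge set set \<Rightarrow> nat set \<Rightarrow> bool"
  assumes peel: "\<And>x y G W. fst x \<in> W \<Longrightarrow> E (insert {x, y} G) W \<Longrightarrow> E G (insert (fst y) W)"
    and c: "0 \<le> c" and b: "b \<le> T"
    and terminal: "\<And>H W. exploration_state n d H W \<Longrightarrow> card W \<le> b \<Longrightarrow> active H W = {} \<Longrightarrow>
                      matching_prob H (\<lambda>G. E G W) \<le> c"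
    and "exploration_state n d H W" "card W + i \<le> b"
  shows "matching_prob H (\<lambda>G. edge_count G W \<le> i \<and> E G W) \<le> c * x ^ card (active H W)"
  using assms(5,6)
proof (induction i arbitrary: H W)
  case 0
  show ?case
  proof (cases "active H W = {}")
    case True
    have "matching_prob H (\<lambda>G. edge_count G W \<le> 0 \<and> E G W) \<le> matching_prob H (\<lambda>G. E G W)"
      using exploration_state_finite[OF 0(1)] by (intro matching_prob_mono) auto
    also have "\<dots> \<le> c" using 0 by (intro terminal True) auto
    finally show ?thesis using True by simp
  next
    case False
    then obtain x0 where x0: "x0 \<in> active H W" by blast
    have "\<not> (edge_count G W \<le> 0 \<and> E G W)" if G: "G \<in> perfect_matchings H" for G
    proof -
      have "x0 \<in> H" "fst x0 \<in> W" using x0 by (auto simp: active_def)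
      from perfect_matchings_partner[OF G this(1)] obtain y where y: "{x0, y} \<in> G" .
      have "edge_count (insert {x0, y} (G - {{x0, y}})) W =
          Suc (edge_count (G - {{x0, y}}) (insert (fst y) W))"
        using perfect_matchings_remove[OF G y] exploration_state_finite[OF 0(1)] \<open>fst x0 \<in> W\<close>
        by (intro edge_count_peel) auto
      with y show ?thesis by (simp add: insert_absorb)
    qed
    then have "matching_prob H (\<lambda>G. edge_count G W \<le> 0 \<and> E G W) = 0" by (rule matching_prob_eq_0)
    then show ?thesis using c x by simp
  qed
next
  case (Suc i)
  have fin: "finite H" "even (card H)"
    using Suc.prems exploration_state_finite by (auto simp: exploration_state_def)
  show ?case
  proof (cases "active H W = {}")
    case True
    have "matching_prob H (\<lambda>G. edge_count G W \<le> Suc i \<and> E G W) \<le> matching_prob H (\<lambda>G. E G W)"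
      using fin by (intro matching_prob_mono) auto
    also have "\<dots> \<le> c" using Suc.prems by (intro terminal True) auto
    finally show ?thesis using True by simp
  next
    case False
    then obtain x0 where x0: "x0 \<in> active H W" by blast
    then have x0': "x0 \<in> H" "fst x0 \<in> W" by (auto simp: active_def)
    have pos: "0 \<le> real (card H) - 1"
      using card_even_ge_2[OF fin x0'(1)] by simp
    have "matching_prob H (\<lambda>G. edge_count G W \<le> Suc i \<and> E G W) =
      (\<Sum>y\<in>H - {x0}. matching_prob (H - {x0, y})
         (\<lambda>G. edge_count (insert {x0, y} G) W \<le> Suc i \<and> E (insert {x0, y} G) W)) / (real (card H) - 1)"
      by (rule matching_prob_peel[OF fin x0'(1)])
    also have "\<dots> \<le> (\<Sum>y\<in>H - {x0}. c * x ^ card (active (H - {x0, y}) (insert (fst y) W)))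
                       / (real (card H) - 1)"
    proof (intro divide_right_mono sum_mono pos)
      fix y assume y: "y \<in> H - {x0}"
      have "matching_prob (H - {x0, y})
         (\<lambda>G. edge_count (insert {x0, y} G) W \<le> Suc i \<and> E (insert {x0, y} G) W)
        \<le> matching_prob (H - {x0, y})
         (\<lambda>G. edge_count G (insert (fst y) W) \<le> i \<and> E G (insert (fst y) W))"
        using fin x0' edge_count_peel[OF fin(1)] peel by (intro matching_prob_mono) auto
      also have "\<dots> \<le> c * x ^ card (active (H - {x0, y}) (insert (fst y) W))"
        using Suc.prems card_insert_le_Suc[of "fst y" W]
        by (intro Suc.IH exploration_state_step x0 y) auto
      finally show "matching_prob (H - {x0, y})
         (\<lambda>G. edge_count (insert {x0, y} G) W \<le> Suc i \<and> E (insert {x0, y} G) W) \<le> \<dots>" .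
    qed
    also have "\<dots> = c * ((\<Sum>y\<in>H - {x0}. x ^ card (active (H - {x0, y}) (insert (fst y) W)))
                       / (real (card H) - 1))"
      by (simp add: sum_distrib_left)
    also have "\<dots> \<le> c * (\<rho> * x ^ card (active H W))"
      using Suc.prems b by (intro mult_left_mono c drift_step x0) auto
    also have "\<dots> \<le> c * x ^ card (active H W)"
      using x \<rho> by (intro mult_left_mono c) (auto intro: mult_left_le_one_le)
    finally show ?thesis .
  qed
qed

text \<open>
Either \<open>m\<close> half-edges are active after \<open>t\<close> steps, and then \<open>E\<close> has conditional probability at most \<open>c\<close>;
or fewer are, so that the supermartingale is at least \<open>x ^ m\<close> although its mean has been multiplied by
\<open>\<rho> ^ t\<close>.
\<close>

lemma exploration_grows_bound:
  fixes E :: "half_edge set set \<Rightarrow> nat set \<Rightarrow> bool"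
  assumes peel: "\<And>x y G W. fst x \<in> W \<Longrightarrow> E (insert {x, y} G) W \<Longrightarrow> E G (insert (fst y) W)"
    and c: "0 \<le> c" and b: "b \<le> T"
    and large: "\<And>H W. exploration_state n d H W \<Longrightarrow> card W \<le> b \<Longrightarrow> m \<le> card (active H W) \<Longrightarrow>
                      matching_prob H (\<lambda>G. E G W) \<le> c"
    and "exploration_state n d H W" "card W + t \<le> b"
  shows "matching_prob H (\<lambda>G. t \<le> edge_count G W \<and> E G W)
           \<le> c + \<rho> ^ t * (x ^ card (active H W) / x ^ m)"
  using assms(5,6)
proof (induction t arbitrary: H W)
  case 0
  have fin: "finite H" using exploration_state_finite[OF 0(1)] .
  show ?case
  proof (cases "m \<le> card (active H W)")
    case True
    have "matching_prob H (\<lambda>G. 0 \<le> edge_count G W \<and> E G W) \<le> c"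
      using large[OF 0(1) _ True] 0 by simp
    then show ?thesis using x by (simp add: add_increasing2)
  next
    case False
    \<comment> \<open>The second summand is at least \<open>1\<close>.\<close>
    then have "x ^ m \<le> x ^ card (active H W)" using x by (intro power_decreasing) auto
    then have "1 \<le> x ^ card (active H W) / x ^ m" using x by simp
    then show ?thesis using matching_prob_le_1[OF fin, of "\<lambda>G. 0 \<le> edge_count G W \<and> E G W"] c
      by simp
  qed
next
  case (Suc t)
  have fin: "finite H" "even (card H)"
    using Suc.prems exploration_state_finite by (auto simp: exploration_state_def)
  show ?case
  proof (cases "active H W = {}")
    case True
    have "matching_prob H (\<lambda>G. Suc t \<le> edge_count G W \<and> E G W) = 0"
      using edge_count_no_active[OF _ True] by (intro matching_prob_eq_0) auto
    then show ?thesis using c x \<rho> by simp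
  next
    case False
    then obtain x0 where x0: "x0 \<in> active H W" by blast
    then have x0': "x0 \<in> H" "fst x0 \<in> W" by (auto simp: active_def)
    have "2 \<le> card H" using card_even_ge_2[OF fin x0'(1)] .
    then have pos: "0 < real (card H) - 1" by simp
    have "matching_prob H (\<lambda>G. Suc t \<le> edge_count G W \<and> E G W) =
      (\<Sum>y\<in>H - {x0}. matching_prob (H - {x0, y})
         (\<lambda>G. Suc t \<le> edge_count (insert {x0, y} G) W \<and> E (insert {x0, y} G) W)) / (real (card H) - 1)"
      by (rule matching_prob_peel[OF fin x0'(1)])
    also have "\<dots> \<le> (\<Sum>y\<in>H - {x0}. c + \<rho> ^ t * (x ^ card (active (H - {x0, y}) (insert (fst y) W)) / x ^ m))
                       / (real (card H) - 1)"
    proof (intro divide_right_mono sum_mono)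
      fix y assume y: "y \<in> H - {x0}"
      have "matching_prob (H - {x0, y})
         (\<lambda>G. Suc t \<le> edge_count (insert {x0, y} G) W \<and> E (insert {x0, y} G) W)
        \<le> matching_prob (H - {x0, y})
         (\<lambda>G. t \<le> edge_count G (insert (fst y) W) \<and> E G (insert (fst y) W))"
        using fin x0' edge_count_peel[OF fin(1)] peel by (intro matching_prob_mono) auto
      also have "\<dots> \<le> c + \<rho> ^ t * (x ^ card (active (H - {x0, y}) (insert (fst y) W)) / x ^ m)"
        using Suc.prems card_insert_le_Suc[of "fst y" W]
        by (intro Suc.IH exploration_state_step x0 y) auto
      finally show "matching_prob (H - {x0, y})
         (\<lambda>G. Suc t \<le> edge_count (insert {x0, y} G) W \<and> E (insert {x0, y} G) W) \<le> \<dots>" .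
    qed (use pos in auto)
    also have "\<dots> = c + \<rho> ^ t * ((\<Sum>y\<in>H - {x0}. x ^ card (active (H - {x0, y}) (insert (fst y) W)))
                       / (real (card H) - 1)) / x ^ m"
    proof -
      have card: "real (card (H - {x0})) = real (card H) - 1"
        using fin x0' pos by (simp add: card_Diff_singleton of_nat_diff)
      show ?thesis using pos
        by (simp add: sum.distrib card add_divide_distrib sum_distrib_left sum_divide_distrib mult_ac)
    qed
    also have "\<dots> \<le> c + \<rho> ^ t * (\<rho> * x ^ card (active H W)) / x ^ m"
      using Suc.prems b x \<rho>
      by (intro add_left_mono divide_right_mono mult_left_mono drift_step x0) auto
    finally show ?thesis by (simp add: mult_ac)
  qed
qed

end

text \<open>
As long as the exploration from \<open>V\<close> avoids \<open>W\<close>, the half-edges at \<open>W\<close> stay unmatched, and in each step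
the partner is one of them with probability at least \<open>a / L\<close>.
\<close>

lemma avoid_prob_bound:
  fixes a L :: nat
  assumes "finite H" "even (card H)" "card H \<le> L" "a \<le> card (active H W)"
  shows "matching_prob H (\<lambda>G. m \<le> edge_count G V \<and> reach G V \<inter> W = {}) \<le> (1 - real a / real L) ^ m"
  using assms
proof (induction m arbitrary: H V)
  case 0
  then show ?case by (simp add: matching_prob_le_1)
next
  case (Suc m)
  have aH: "a \<le> card H"
    using Suc.prems card_mono[of H "active H W"] by (auto simp: active_def)
  then have r0: "0 \<le> 1 - real a / real L" using Suc.prems by (auto simp: divide_le_eq_1)
  consider "V \<inter> W \<noteq> {}" | "active H V = {}" | "V \<inter> W = {}" "active H V \<noteq> {}" by blast
  then show ?case
  proof cases
    case 1
    then have "matching_prob H (\<lambda>G. Suc m \<le> edge_count G V \<and> reach G V \<inter> W = {}) = 0"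
      using reach_superset by (intro matching_prob_eq_0) blast
    then show ?thesis using r0 by simp
  next
    case 2
    have "matching_prob H (\<lambda>G. Suc m \<le> edge_count G V \<and> reach G V \<inter> W = {}) = 0"
      using edge_count_no_active[OF _ 2] by (intro matching_prob_eq_0) auto
    then show ?thesis using r0 by simp
  next
    case 3
    then obtain x where x: "x \<in> active H V" by blast
    then have x': "x \<in> H" "fst x \<in> V" "x \<notin> active H W" using 3(1) by (auto simp: active_def)
    have "2 \<le> card H" using card_even_ge_2[OF Suc.prems(1,2) x'(1)] .
    then have pos: "0 < real (card H) - 1" by simp
    let ?r = "1 - real a / real L"
    have sub: "active H W \<subseteq> H - {x}" using x' by (auto simp: active_def)
    have finA: "finite (active H W)" using Suc.prems by (simp add: active_def)
    have "matching_prob H (\<lambda>G. Suc m \<le> edge_count G V \<and> reach G V \<inter> W = {}) =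
      (\<Sum>y\<in>H - {x}. matching_prob (H - {x, y}) (\<lambda>G. Suc m \<le> edge_count (insert {x, y} G) V
          \<and> reach (insert {x, y} G) V \<inter> W = {})) / (real (card H) - 1)"
      by (rule matching_prob_peel[OF Suc.prems(1,2) x'(1)])
    also have "\<dots> \<le> (\<Sum>y\<in>H - {x}. if y \<in> active H W then 0 else ?r ^ m) / (real (card H) - 1)"
    proof (intro divide_right_mono sum_mono)
      fix y assume y: "y \<in> H - {x}"
      have le: "matching_prob (H - {x, y}) (\<lambda>G. Suc m \<le> edge_count (insert {x, y} G) V
          \<and> reach (insert {x, y} G) V \<inter> W = {})
        \<le> matching_prob (H - {x, y}) (\<lambda>G. m \<le> edge_count G (insert (fst y) V)
          \<and> reach G (insert (fst y) V) \<inter> W = {})"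
        using Suc.prems x' edge_count_peel[OF Suc.prems(1)]
        by (intro matching_prob_mono) (auto simp: reach_peel)
      show "matching_prob (H - {x, y}) (\<lambda>G. Suc m \<le> edge_count (insert {x, y} G) V
          \<and> reach (insert {x, y} G) V \<inter> W = {}) \<le> (if y \<in> active H W then 0 else ?r ^ m)"
      proof (cases "y \<in> active H W")
        case True
        then have "fst y \<in> W" by (simp add: active_def)
        then have "matching_prob (H - {x, y}) (\<lambda>G. m \<le> edge_count G (insert (fst y) V)
          \<and> reach G (insert (fst y) V) \<inter> W = {}) = 0"
          using reach_superset[of "insert (fst y) V"] by (intro matching_prob_eq_0) blast
        then show ?thesis using le True by simp
      next
        case False
        have "active (H - {x, y}) W = active H W" using False x' by (auto simp: active_def)
        moreover have "card H = card (H - {x, y}) + 2"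
          using Suc.prems x' y by (intro card_Diff_pair) auto
        ultimately have "matching_prob (H - {x, y}) (\<lambda>G. m \<le> edge_count G (insert (fst y) V)
          \<and> reach G (insert (fst y) V) \<inter> W = {}) \<le> ?r ^ m"
          using Suc.prems by (intro Suc.IH) auto
        then show ?thesis using le False by simp
      qed
    qed (use pos in auto)
    also have "(\<Sum>y\<in>H - {x}. if y \<in> active H W then 0 else ?r ^ m) =
        (real (card H) - 1 - real (card (active H W))) * ?r ^ m"
    proof -
      have "(\<Sum>y\<in>H - {x}. if y \<in> active H W then 0 else ?r ^ m) = (\<Sum>y\<in>(H - {x}) - active H W. ?r ^ m)"
        using Suc.prems by (intro sum.mono_neutral_cong_right) auto
      moreover have "card ((H - {x}) - active H W) = card H - 1 - card (active H W)"
        using Suc.prems sub finA x' by (simp add: card_Diff_subset)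
      moreover have "card (active H W) \<le> card H - 1"
        using card_mono[OF _ sub] Suc.prems x' by simp
      ultimately show ?thesis using \<open>2 \<le> card H\<close> by (simp add: of_nat_diff)
    qed
    also have "\<dots> / (real (card H) - 1) \<le> ?r * ?r ^ m"
    proof -
      have "real a / real L \<le> real (card (active H W)) / (real (card H) - 1)"
        using Suc.prems pos by (intro frac_le) auto
      then have "(real (card H) - 1 - real (card (active H W))) / (real (card H) - 1) \<le> ?r"
        using pos by (simp add: diff_divide_distrib)
      then have "(real (card H) - 1 - real (card (active H W))) / (real (card H) - 1) * ?r ^ m \<le> ?r * ?r ^ m"
        using r0 by (intro mult_right_mono) auto
      then show ?thesis by simp
    qed
    finally show ?thesis by simp
  qed
qed

context exploration_drift
begin

lemma small_component_prob:
  assumes "even (\<Sum>i\<in>{1..n}. d i)" "v \<in> {1..n}" "i < T"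
  shows "matching_prob (half_edges n d) (\<lambda>G. edge_count G {v} \<le> i) \<le> x ^ d v"
proof -
  have "matching_prob (half_edges n d) (\<lambda>G. edge_count G {v} \<le> i \<and> True)
      \<le> 1 * x ^ card (active (half_edges n d) {v})"
    using assms exploration_state_finite
    by (intro exploration_dies_bound[where E = "\<lambda>_ _. True" and b = T] exploration_state_init)
      (auto intro!: matching_prob_le_1)
  then show ?thesis using card_active_init[OF assms(2)] by simp
qed

text \<open>
The component of \<open>v\<close> is explored first. When it is finished, no half-edge of another
vertex \<open>v'\<close> has been used, and the exploration continues from \<open>v'\<close> with all its \<open>d v'\<close> half-edges active.
\<close>

lemma two_small_components_prob:
  assumes "even (\<Sum>i\<in>{1..n}. d i)" "v \<in> {1..n}" "v' \<in> {1..n}" "2 * i + 2 \<le> T"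
  shows "matching_prob (half_edges n d)
      (\<lambda>G. edge_count G {v} \<le> i \<and> v' \<notin> reach G {v} \<and> edge_count G {v'} \<le> i) \<le> x ^ d v * x ^ d v'"
proof -
  let ?E = "\<lambda>G W. v' \<notin> reach G W \<and> edge_count G {v'} \<le> i"
  have "matching_prob (half_edges n d) (\<lambda>G. edge_count G {v} \<le> i \<and> ?E G {v})
      \<le> x ^ d v' * x ^ card (active (half_edges n d) {v})"
  proof (rule exploration_dies_bound[where b = "i + 1"])
    show "?E G (insert (fst y) W)" if "fst x \<in> W" "?E (insert {x, y} G) W" for x y G W
      using that edge_count_insert_avoid[OF that(1), of v' y G] by (simp add: reach_peel)
    show "matching_prob H (\<lambda>G. ?E G W) \<le> x ^ d v'"
      if st: "exploration_state n d H W" and W: "card W \<le> i + 1" "active H W = {}" for H W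
    proof (cases "v' \<in> W")
      case True
      then have "matching_prob H (\<lambda>G. ?E G W) = 0"
        using reach_superset by (intro matching_prob_eq_0) blast
      then show ?thesis using x by simp
    next
      case False
      have fin: "finite H" by (rule exploration_state_finite[OF st])
      \<comment> \<open>Since \<open>W\<close> is finished, the active half-edges of \<open>insert v' W\<close> are those of \<open>v'\<close>.\<close>
      have st': "exploration_state n d H (insert v' W)" using st by (auto simp: exploration_state_def)
      have "matching_prob H (\<lambda>G. ?E G W) \<le> matching_prob H (\<lambda>G. edge_count G (insert v' W) \<le> i \<and> True)"
        using fin edge_count_insert_no_active[OF _ W(2)] by (intro matching_prob_mono) auto
      also have "\<dots> \<le> 1 * x ^ card (active H (insert v' W))"
        using W(1) assms(4) card_insert_le_Suc[of v' W]
        by (intro exploration_dies_bound[where E = "\<lambda>_ _. True" and b = T] st')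
          (auto intro!: matching_prob_le_1 dest: exploration_state_finite)
      finally show ?thesis using card_active_single[OF assms(3) False st W(2)] by simp
    qed
  qed (use assms x in \<open>auto intro: exploration_state_init\<close>)
  then show ?thesis using card_active_init[OF assms(2)] by (simp add: mult.commute)
qed

text \<open>
The exploration from \<open>v\<close> is stopped after \<open>t\<close> steps, when \<open>m\<close> half-edges are active unless an
exponentially unlikely event occurs. The exploration from \<open>v'\<close> has to avoid all of them in \<open>i\<close> steps.
\<close>

lemma disconnected_large_components_prob:
  assumes "even (\<Sum>i\<in>{1..n}. d i)" "v \<in> {1..n}" "v' \<in> {1..n}" "t < T"
    and m: "m \<le> card (half_edges n d)"
  shows "matching_prob (half_edges n d)
      (\<lambda>G. t \<le> edge_count G {v} \<and> v' \<notin> reach G {v} \<and> i \<le> edge_count G {v'})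
     \<le> (1 - real m / real (card (half_edges n d))) ^ i + \<rho> ^ t * (x ^ d v / x ^ m)"
proof -
  let ?E = "\<lambda>G W. v' \<notin> reach G W \<and> i \<le> edge_count G {v'}"
  let ?c = "(1 - real m / real (card (half_edges n d))) ^ i"
  have "matching_prob (half_edges n d) (\<lambda>G. t \<le> edge_count G {v} \<and> ?E G {v})
      \<le> ?c + \<rho> ^ t * (x ^ card (active (half_edges n d) {v}) / x ^ m)"
  proof (rule exploration_grows_bound[where b = T])
    show "?E G (insert (fst y) W)" if "fst x \<in> W" "?E (insert {x, y} G) W" for x y G W
      using that edge_count_insert_avoid[OF that(1), of v' y G] by (simp add: reach_peel)
    show "0 \<le> ?c" using m by (intro zero_le_power) (auto simp: divide_le_eq_1)
    show "matching_prob H (\<lambda>G. ?E G W) \<le> ?c"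
      if st: "exploration_state n d H W" and W: "m \<le> card (active H W)" for H W
    proof -
      have fin: "finite H" "even (card H)" "card H \<le> card (half_edges n d)"
        using st exploration_state_finite[OF st] by (auto simp: exploration_state_def intro: card_mono)
      have "matching_prob H (\<lambda>G. ?E G W) =
          matching_prob H (\<lambda>G. i \<le> edge_count G {v'} \<and> reach G {v'} \<inter> W = {})"
        by (intro matching_prob_cong) (auto simp: reach_disjoint_iff)
      also have "\<dots> \<le> ?c" by (rule avoid_prob_bound[OF fin W])
      finally show ?thesis .
    qed
  qed (use assms in \<open>auto intro: exploration_state_init\<close>)
  then show ?thesis using card_active_init[OF assms(2)] by simp
qed

end

section \<open>Extinction of the limiting random walk\<close>

text \<open>
The probability that the walk with steps \<open>k - 2\<close>, taken with weight \<open>r k\<close>, started from \<open>j\<close>, reaches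
\<open>0\<close> within \<open>m\<close> steps without a step from a degree \<open>k \<ge> K\<close>. The truncation keeps the recursion a finite
sum, so that limits in the weights can be taken term by term; \<open>K\<close> and \<open>m\<close> tend to infinity together.
\<close>

fun extinction_prob :: "(nat \<Rightarrow> real) \<Rightarrow> nat \<Rightarrow> nat \<Rightarrow> nat \<Rightarrow> real" where
  "extinction_prob r K 0 j = (if j = 0 then 1 else 0)"
| "extinction_prob r K (Suc m) j = (if j = 0 then 1 else (\<Sum>k<K. r k * extinction_prob r K m (j + k - 2)))"

lemma extinction_prob_0 [simp]: "extinction_prob r K m 0 = 1"
  by (cases m) auto

locale offspring =
  fixes r :: "nat \<Rightarrow> real"
  assumes r_nonneg: "\<And>k. 0 \<le> r k" and r_sums: "r sums 1" and r_0: "r 0 = 0"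
begin

text \<open>
The generating function of the number of half-edges that become active at a fresh vertex.
\<close>

definition gen :: "real \<Rightarrow> real" where
  "gen x = (\<Sum>k. r k * x ^ (k - 1))"

lemma gen_summable:
  assumes "0 \<le> x" "x \<le> 1"
  shows "summable (\<lambda>k. r k * x ^ (k - 1))"
proof (rule summable_comparison_test')
  show "summable r" using r_sums by (rule sums_summable)
  show "norm (r k * x ^ (k - 1)) \<le> r k" for k
    using assms r_nonneg[of k] by (simp add: abs_mult mult_left_le power_le_one)
qed

lemma gen_partial:
  assumes "0 \<le> x" "x \<le> 1"
  shows "(\<Sum>k<K. r k * x ^ (k - 1)) \<le> gen x"
  unfolding gen_def using assms r_nonneg
  by (intro sum_le_suminf gen_summable) auto

lemma gen_le_1: "0 \<le> x \<Longrightarrow> x \<le> 1 \<Longrightarrow> gen x \<le> 1"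
  unfolding gen_def using r_nonneg
  by (subst sums_unique[OF r_sums], intro suminf_le gen_summable sums_summable[OF r_sums])
    (auto simp: mult_left_le power_le_one)

lemma gen_nonneg: "0 \<le> x \<Longrightarrow> x \<le> 1 \<Longrightarrow> 0 \<le> gen x"
  unfolding gen_def using r_nonneg by (intro suminf_nonneg gen_summable) auto

lemma gen_mono: "0 \<le> x \<Longrightarrow> x \<le> y \<Longrightarrow> y \<le> 1 \<Longrightarrow> gen x \<le> gen y"
  unfolding gen_def using r_nonneg
  by (intro suminf_le gen_summable) (auto intro!: mult_left_mono power_mono)

lemma extinction_prob_nonneg: "0 \<le> extinction_prob r K m j"
  by (induction m arbitrary: j) (auto intro!: sum_nonneg mult_nonneg_nonneg r_nonneg)

text \<open>
If \<open>gen x \<le> x\<close>, then \<open>x\<close> to the position of the walk is a supermartingale.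
\<close>

lemma extinction_prob_le_power:
  assumes x: "0 \<le> x" "x \<le> 1" and g: "gen x \<le> x"
  shows "extinction_prob r K m j \<le> x ^ j"
proof (induction m arbitrary: j)
  case 0
  then show ?case using x by simp
next
  case (Suc m)
  show ?case
  proof (cases "j = 0")
    case False
    have "extinction_prob r K (Suc m) j = (\<Sum>k<K. r k * extinction_prob r K m (j + k - 2))" using False by simp
    also have "\<dots> \<le> (\<Sum>k<K. x ^ (j - 1) * (r k * x ^ (k - 1)))"
    proof (rule sum_mono)
      fix k
      show "r k * extinction_prob r K m (j + k - 2) \<le> x ^ (j - 1) * (r k * x ^ (k - 1))"
      proof (cases "k = 0")
        case True
        then show ?thesis by (simp add: r_0)
      next
        case k: False
        have "j + k - 2 = (j - 1) + (k - 1)" using False k by simp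
        then have "x ^ (j + k - 2) = x ^ (j - 1) * x ^ (k - 1)" by (simp only: power_add)
        then show ?thesis using mult_left_mono[OF Suc.IH[of "j + k - 2"] r_nonneg[of k]]
          by (simp add: mult_ac)
      qed
    qed
    also have "\<dots> = x ^ (j - 1) * (\<Sum>k<K. r k * x ^ (k - 1))" by (simp add: sum_distrib_left)
    also have "\<dots> \<le> x ^ (j - 1) * x"
      using gen_partial[OF x, of K] g x by (intro mult_left_mono) auto
    also have "\<dots> = x ^ j" using False by (cases j) auto
    finally show ?thesis .
  qed simp
qed

lemma extinction_prob_le_1: "extinction_prob r K m j \<le> 1"
  using extinction_prob_le_power[of 1 K m j] gen_le_1[of 1] by simp

lemma extinction_prob_Suc_mono: "extinction_prob r K m j \<le> extinction_prob r K (Suc m) j"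
proof (induction m arbitrary: j)
  case 0
  then show ?case using extinction_prob_nonneg[of K "Suc 0" j] by (cases "j = 0") auto
next
  case (Suc m)
  have "(\<Sum>k<K. r k * extinction_prob r K m (j + k - 2)) \<le> (\<Sum>k<K. r k * extinction_prob r K (Suc m) (j + k - 2))"
    by (intro sum_mono mult_left_mono r_nonneg Suc.IH)
  then show ?case by (simp only: extinction_prob.simps(2)) simp
qed

lemma extinction_prob_mono_cutoff: "K \<le> K' \<Longrightarrow> extinction_prob r K m j \<le> extinction_prob r K' m j"
proof (induction m arbitrary: j)
  case (Suc m)
  have "(\<Sum>k<K. r k * extinction_prob r K m (j + k - 2)) \<le> (\<Sum>k<K. r k * extinction_prob r K' m (j + k - 2))"
    using Suc by (intro sum_mono mult_left_mono r_nonneg) auto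
  also have "\<dots> \<le> (\<Sum>k<K'. r k * extinction_prob r K' m (j + k - 2))"
    using Suc.prems by (intro sum_mono2) (auto intro!: mult_nonneg_nonneg r_nonneg extinction_prob_nonneg)
  finally show ?case by simp
qed auto

lemma extinction_prob_mono: "K \<le> K' \<Longrightarrow> m \<le> m' \<Longrightarrow> extinction_prob r K m j \<le> extinction_prob r K' m' j"
  using lift_Suc_mono_le[of "\<lambda>m. extinction_prob r K m j" m m', OF extinction_prob_Suc_mono] extinction_prob_mono_cutoff[of K K' m' j]
  by linarith

text \<open>
The walk moves down by at most one, so to reach \<open>0\<close> from \<open>i + j\<close> it suffices to descend by \<open>i\<close> first
and then by \<open>j\<close>.
\<close>

lemma extinction_prob_supermultiplicative: "extinction_prob r K m i * extinction_prob r K m' j \<le> extinction_prob r K (m + m') (i + j)"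
proof (induction m arbitrary: i)
  case 0
  then show ?case using extinction_prob_nonneg by simp
next
  case (Suc m)
  show ?case
  proof (cases "i = 0")
    case True
    then show ?thesis using extinction_prob_mono[of K K m' "Suc m + m'" j] by simp
  next
    case False
    have "extinction_prob r K (Suc m) i * extinction_prob r K m' j = (\<Sum>k<K. r k * (extinction_prob r K m (i + k - 2) * extinction_prob r K m' j))"
      using False by (simp add: sum_distrib_right mult.assoc)
    also have "\<dots> \<le> (\<Sum>k<K. r k * extinction_prob r K (m + m') (i + j + k - 2))"
    proof (rule sum_mono)
      fix k
      show "r k * (extinction_prob r K m (i + k - 2) * extinction_prob r K m' j) \<le> r k * extinction_prob r K (m + m') (i + j + k - 2)"
      proof (cases "k = 0")
        case k: False
        have "i + k - 2 + j = i + j + k - 2" using False k by simp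
        then show ?thesis using Suc.IH[of "i + k - 2"] by (intro mult_left_mono r_nonneg) simp
      qed (simp add: r_0)
    qed
    also have "\<dots> = extinction_prob r K (Suc m + m') (i + j)" using False by simp
    finally show ?thesis .
  qed
qed

lemma extinction_prob_power: "extinction_prob r K m 1 ^ j \<le> extinction_prob r K (j * m) j"
proof (induction j)
  case (Suc j)
  have "extinction_prob r K m 1 ^ Suc j \<le> extinction_prob r K m 1 * extinction_prob r K (j * m) j"
    using Suc extinction_prob_nonneg by (simp add: mult_left_mono)
  also have "\<dots> \<le> extinction_prob r K (Suc j * m) (Suc j)"
    using extinction_prob_supermultiplicative[of K m 1 "j * m" j] by simp
  finally show ?case .
qed simp

text \<open>
The extinction probability of the walk started from \<open>1\<close>.
\<close>

definition xi :: real where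
  "xi = (SUP m. extinction_prob r m m 1)"

lemma extinction_prob_tendsto_xi: "(\<lambda>m. extinction_prob r m m 1) \<longlonglongrightarrow> xi"
  unfolding xi_def
  by (intro LIMSEQ_incseq_SUP) (auto intro!: extinction_prob_le_1 bdd_aboveI2 incseq_SucI extinction_prob_mono simp del: extinction_prob.simps)

lemma extinction_prob_le_xi: "extinction_prob r m m 1 \<le> xi"
  unfolding xi_def by (rule cSUP_upper) (auto intro!: extinction_prob_le_1 bdd_aboveI2 simp del: extinction_prob.simps)

lemma xi_nonneg: "0 \<le> xi" and xi_le_1: "xi \<le> 1"
  using extinction_prob_le_xi[of 0] LIMSEQ_le_const2[OF extinction_prob_tendsto_xi] extinction_prob_le_1 by auto

lemma xi_le: "0 \<le> x \<Longrightarrow> x \<le> 1 \<Longrightarrow> gen x \<le> x \<Longrightarrow> xi \<le> x"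
  using extinction_prob_le_power[of x _ _ 1] by (intro LIMSEQ_le_const2[OF extinction_prob_tendsto_xi]) auto

text \<open>
Extinction from \<open>j\<close> is at least \<open>j\<close> consecutive extinctions from \<open>1\<close>; this is the only half of
the formula \<open>xi ^ j\<close> that has to be derived from the recursion.
\<close>

lemma extinction_prob_near_xi_power:
  assumes "0 < e"
  shows "\<exists>m. xi ^ j - e < extinction_prob r m m j"
proof -
  have "(\<lambda>m. extinction_prob r m m 1 ^ j) \<longlonglongrightarrow> xi ^ j" by (intro tendsto_power extinction_prob_tendsto_xi)
  then have "\<forall>\<^sub>F m in sequentially. xi ^ j - e < extinction_prob r m m 1 ^ j"
    using assms by (intro order_tendstoD) auto
  then obtain m where "xi ^ j - e < extinction_prob r m m 1 ^ j" by (meson eventually_sequentially order_refl)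
  also have "\<dots> \<le> extinction_prob r m (j * m) j" by (rule extinction_prob_power)
  also have "\<dots> \<le> extinction_prob r (m + j * m) (m + j * m) j" by (rule extinction_prob_mono) auto
  finally show ?thesis by blast
qed

text \<open>
One step of the recursion followed by extinction from \<open>k - 1\<close>, in the limit.
\<close>

lemma gen_xi_le: "gen xi \<le> xi"
  unfolding gen_def
proof (rule suminf_le_const[OF gen_summable[OF xi_nonneg xi_le_1]])
  fix K
  have "(\<lambda>m. \<Sum>k<K. r k * extinction_prob r m m 1 ^ (k - 1)) \<longlonglongrightarrow> (\<Sum>k<K. r k * xi ^ (k - 1))"
    by (intro tendsto_intros extinction_prob_tendsto_xi)
  moreover have "(\<Sum>k<K. r k * extinction_prob r m m 1 ^ (k - 1)) \<le> xi" for m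
  proof -
    \<comment> \<open>A common bound for the cutoff and the number of steps in all \<open>K\<close> terms.\<close>
    define M where "M = K + K * m + m"
    have "(\<Sum>k<K. r k * extinction_prob r m m 1 ^ (k - 1)) \<le> (\<Sum>k<K. r k * extinction_prob r (Suc M) M (1 + k - 2))"
    proof (intro sum_mono mult_left_mono r_nonneg)
      fix k assume "k \<in> {..<K}"
      then have "(k - 1) * m \<le> M" unfolding M_def by (metis add.assoc lessThan_iff less_imp_le
            less_imp_diff_less mult_le_mono1 trans_le_add1 trans_le_add2)
      then have "extinction_prob r m ((k - 1) * m) (k - 1) \<le> extinction_prob r (Suc M) M (k - 1)"
        by (intro extinction_prob_mono) (auto simp: M_def)
      then show "extinction_prob r m m 1 ^ (k - 1) \<le> extinction_prob r (Suc M) M (1 + k - 2)"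
        using extinction_prob_power[of m m "k - 1"] by (simp del: extinction_prob.simps)
    qed
    also have "\<dots> \<le> (\<Sum>k<Suc M. r k * extinction_prob r (Suc M) M (1 + k - 2))"
      by (intro sum_mono2) (auto intro!: mult_nonneg_nonneg r_nonneg extinction_prob_nonneg simp: M_def)
    also have "\<dots> = extinction_prob r (Suc M) (Suc M) 1" by simp
    also have "\<dots> \<le> xi" by (rule extinction_prob_le_xi)
    finally show ?thesis .
  qed
  ultimately show "(\<Sum>k<K. r k * xi ^ (k - 1)) \<le> xi" by (intro LIMSEQ_le_const2) auto
qed

text \<open>
Since \<open>gen\<close> is monotone, \<open>gen xi\<close> again satisfies \<open>gen (gen xi) \<le> gen xi\<close>, and \<open>xi\<close> is a lower bound of all
such points.
\<close>

lemma gen_xi: "gen xi = xi"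
proof (rule antisym[OF gen_xi_le])
  show "xi \<le> gen xi"
    using gen_xi_le gen_mono[of "gen xi" xi] gen_nonneg gen_le_1 xi_nonneg xi_le_1
    by (intro xi_le) auto
qed

lemma power_convex_comb:
  fixes a b s :: real
  assumes "0 \<le> a" "0 \<le> b" "0 \<le> s" "s \<le> 1"
  shows "((1 - s) * a + s * b) ^ j \<le> (1 - s) * a ^ j + s * b ^ j"
proof (induction j)
  case (Suc j)
  have nonneg: "0 \<le> (a ^ j - b ^ j) * (a - b)"
    using assms power_mono[of a b j] power_mono[of b a j]
    by (cases "a \<le> b") (auto intro: mult_nonneg_nonneg mult_nonpos_nonpos)
  have "((1 - s) * a + s * b) ^ Suc j \<le> ((1 - s) * a + s * b) * ((1 - s) * a ^ j + s * b ^ j)"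
    using Suc assms by (simp add: mult_left_mono)
  also have "\<dots> = (1 - s) * a ^ Suc j + s * b ^ Suc j - (1 - s) * s * ((a ^ j - b ^ j) * (a - b))"
    by (simp add: algebra_simps)
  also have "\<dots> \<le> (1 - s) * a ^ Suc j + s * b ^ Suc j"
    using nonneg assms by simp
  finally show ?case .
qed simp

lemma gen_convex_comb:
  assumes "0 \<le> a" "a \<le> 1" "0 \<le> b" "b \<le> 1" "0 \<le> s" "s \<le> 1"
  shows "gen ((1 - s) * a + s * b) \<le> (1 - s) * gen a + s * gen b"
proof -
  have "(1 - s) * a + s * b \<le> (1 - s) * 1 + s * 1" using assms by (intro add_mono mult_left_mono) auto
  then have c: "0 \<le> (1 - s) * a + s * b" "(1 - s) * a + s * b \<le> 1" using assms by auto
  have "gen ((1 - s) * a + s * b) \<le> (\<Sum>k. (1 - s) * (r k * a ^ (k - 1)) + s * (r k * b ^ (k - 1)))"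
    unfolding gen_def
  proof (intro suminf_le gen_summable c summable_add summable_mult)
    fix k
    show "r k * ((1 - s) * a + s * b) ^ (k - 1)
        \<le> (1 - s) * (r k * a ^ (k - 1)) + s * (r k * b ^ (k - 1))"
      using mult_left_mono[OF power_convex_comb[of a b s "k - 1"] r_nonneg[of k]] assms
      by (simp add: algebra_simps)
  qed (use assms in auto)
  also have "\<dots> = (1 - s) * gen a + s * gen b"
    unfolding gen_def using assms
    by (simp add: suminf_add[symmetric] summable_mult suminf_mult gen_summable[unfolded One_nat_def])
  finally show ?thesis .
qed

text \<open>
The derivative of \<open>gen\<close> at \<open>1\<close> is the mean offspring number, possibly infinite. If it exceeds \<open>1\<close>,
the graph of \<open>gen\<close> passes below the diagonal to the left of \<open>1\<close>; a truncation of \<open>gen\<close>, with its missing mass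
added as a constant, is a polynomial majorant with the same property.
\<close>

lemma supercritical_point:
  assumes "1 < (\<Sum>k<K. r k * (real k - 1))"
  shows "\<exists>x. 0 < x \<and> x < 1 \<and> gen x < x"
proof -
  let ?R = "\<Sum>k<K. r k"
  \<comment> \<open>The constant \<open>1 - ?R\<close> stands for the tail of \<open>gen\<close> and makes \<open>h 1 = 0\<close>.\<close>
  define h where "h = (\<lambda>x. (\<Sum>k<K. r k * x ^ (k - 1)) + (1 - ?R) - x)"
  have der: "(h has_real_derivative (\<Sum>k<K. r k * (real k - 1)) - 1) (at 1)"
    unfolding h_def
  proof (rule derivative_eq_intros refl)+
    show "(\<Sum>k<K. 0 * 1 ^ (k - 1) + of_nat (k - 1) * (1 * 1 ^ (k - 1 - Suc 0)) * r k) + 0 - 1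
        = (\<Sum>k<K. r k * (real k - 1)) - 1"
      by (auto intro!: sum.cong simp: r_0 of_nat_diff) (metis One_nat_def Suc_leI bot_nat_0.not_eq_extremum mult.commute mult_zero_right of_nat_1 of_nat_diff r_0)
  qed
  have h1: "h 1 = 0" by (simp add: h_def)
  from DERIV_pos_inc_left[OF der] assms obtain e where
    e: "0 < e" "\<And>t. 0 < t \<Longrightarrow> t < e \<Longrightarrow> h (1 - t) < h 1" by auto
  define t where "t = min (e / 2) (1 / 2)"
  have t: "0 < t" "t < e" "t < 1" using e(1) by (auto simp: t_def)
  have "gen (1 - t) - (\<Sum>k<K. r k * (1 - t) ^ (k - 1)) = (\<Sum>k. r (k + K) * (1 - t) ^ (k + K - 1))"
    unfolding gen_def using t
    by (subst suminf_split_initial_segment[OF gen_summable, of _ K]) auto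
  also have "\<dots> \<le> (\<Sum>k. r (k + K))"
  proof (rule suminf_le)
    show "summable (\<lambda>k. r (k + K) * (1 - t) ^ (k + K - 1))"
      using gen_summable[of "1 - t"] t summable_iff_shift[of "\<lambda>k. r k * (1 - t) ^ (k - 1)" K] by simp
    show "summable (\<lambda>k. r (k + K))" using sums_summable[OF r_sums] summable_iff_shift[of r K] by simp
    show "r (k + K) * (1 - t) ^ (k + K - 1) \<le> r (k + K)" for k
      using r_nonneg[of "k + K"] t by (simp add: mult_left_le power_le_one)
  qed
  also have "\<dots> = 1 - ?R"
    using suminf_split_initial_segment[OF sums_summable[OF r_sums], of K] sums_unique[OF r_sums] by simp
  finally have "gen (1 - t) - (1 - t) \<le> h (1 - t)" by (simp add: h_def)
  then have "gen (1 - t) < 1 - t" using e(2)[OF t(1,2)] h1 by simp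
  then show ?thesis using t by (intro exI[of _ "1 - t"]) auto
qed

lemma xi_less_1:
  assumes "1 < (\<Sum>k<K. r k * (real k - 1))"
  shows "xi < 1"
proof -
  obtain y where y: "0 < y" "y < 1" "gen y < y" using supercritical_point[OF assms] by blast
  then have "xi \<le> y" by (intro xi_le) auto
  with y show ?thesis by simp
qed

text \<open>
Strict inequality at one point spreads by convexity to the whole open interval from \<open>xi\<close> to that point. Points
close to \<open>xi\<close> make the upper bounds \<open>x ^ k\<close> nearly sharp.
\<close>

lemma point_near_xi:
  assumes "1 < (\<Sum>k<K. r k * (real k - 1))" and "0 < e"
  shows "\<exists>x. xi < x \<and> x < xi + e \<and> x < 1 \<and> gen x < x"
proof -
  obtain y where y: "0 < y" "y < 1" "gen y < y" using supercritical_point[OF assms(1)] by blast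
  have "xi \<le> y" using y by (intro xi_le) auto
  moreover have "xi \<noteq> y" using y gen_xi by auto
  ultimately have "xi < y" by simp
  define s where "s = min (1 / 2) (e / 2)"
  have s: "0 < s" "s < 1" "s < e" using assms(2) by (auto simp: s_def)
  let ?x = "(1 - s) * xi + s * y"
  have "gen ?x \<le> (1 - s) * gen xi + s * gen y"
    using s y xi_nonneg xi_le_1 by (intro gen_convex_comb) auto
  also have "\<dots> < ?x" using gen_xi y s by simp
  finally have g: "gen ?x < ?x" .
  have x: "?x = xi + s * (y - xi)" by (simp add: algebra_simps)
  have "0 < s * (y - xi)" using s \<open>xi < y\<close> by simp
  moreover have "s * (y - xi) < e"
  proof -
    have "s * (y - xi) \<le> s * 1" using s y xi_nonneg by (intro mult_left_mono) auto
    then show ?thesis using s(3) by linarith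
  qed
  moreover have "s * (y - xi) \<le> 1 * (y - xi)" using s \<open>xi < y\<close> by (intro mult_right_mono) auto
  ultimately have "xi < ?x" "?x < xi + e" "?x < 1" unfolding x using s y by simp_all
  then show ?thesis using g by blast
qed

lemma bernoulli_strict:
  fixes x :: real
  assumes "0 \<le> x" "x < 1"
  shows "1 - x ^ (j + 2) < real (j + 2) * (1 - x)"
proof (induction j)
  case 0
  have "0 < (1 - x) ^ 2" using assms by simp
  then show ?case by (simp add: power2_eq_square algebra_simps)
next
  case (Suc j)
  have "1 - x ^ (Suc j + 2) = (1 - x ^ (j + 2)) + x ^ (j + 2) * (1 - x)" by (simp add: algebra_simps)
  also have "\<dots> < real (j + 2) * (1 - x) + 1 * (1 - x)"
    using Suc assms power_le_one[of x "j + 2"] by (intro add_less_le_mono mult_right_mono) auto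
  finally show ?case by (simp add: algebra_simps)
qed

text \<open>
By Bernoulli's inequality \<open>1 - gen x \<le> 1 - x\<close> when the mean offspring number is at most \<open>1\<close>. Equality at
\<open>x = xi < 1\<close> would exclude every degree above \<open>2\<close>; then \<open>gen\<close> is affine and its slope \<open>r 2\<close>
would have to be \<open>1\<close>.
\<close>

lemma xi_eq_1:
  assumes sub: "\<And>K. (\<Sum>k<K. r k * (real k - 1)) \<le> 1" and r2: "r 2 \<noteq> 1"
  shows "xi = 1"
proof (rule ccontr)
  assume "xi \<noteq> 1"
  then have lt: "xi < 1" using xi_le_1 by simp
  note sm = sums_summable[OF r_sums]
  have sg: "summable (\<lambda>k. r k * xi ^ (k - 1))" by (rule gen_summable[OF xi_nonneg xi_le_1])
  have sd: "summable (\<lambda>k. r k * (1 - xi ^ (k - 1)))"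
    using summable_diff[OF sm sg] by (simp add: algebra_simps)
  have eq: "(\<Sum>k. r k * (1 - xi ^ (k - 1))) = 1 - xi"
    using suminf_diff[OF sm sg] gen_xi sums_unique[OF r_sums]
    by (simp add: algebra_simps gen_def)
  have term_le: "r k * (1 - xi ^ (k - 1)) \<le> r k * (real k - 1) * (1 - xi)" for k
  proof -
    consider "k = 0" | "k = 1" | "k = 2" | j where "k = j + 3" by (metis One_nat_def Suc_1 add.commute
        add_Suc numeral_3_eq_3 not0_implies_Suc plus_1_eq_Suc add_0)
    then show ?thesis
    proof cases
      case 4
      have "1 - xi ^ (k - 1) \<le> (real k - 1) * (1 - xi)"
        using bernoulli_strict[OF xi_nonneg lt, of j] 4 by simp
      then show ?thesis using r_nonneg[of k] by (simp add: mult_left_mono mult.assoc)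
    qed (use r_0 in auto)
  qed
  show False
  proof (cases "\<exists>j. 0 < r (j + 3)")
    case True
    then obtain j where j: "0 < r (j + 3)" by blast
    let ?k = "j + 3"
    \<comment> \<open>The strict gain from one degree \<open>k \<ge> 3\<close> survives in the limit of the partial sums.\<close>
    define c where "c = r ?k * ((real ?k - 1) * (1 - xi) - (1 - xi ^ (?k - 1)))"
    have c: "0 < c" using j bernoulli_strict[OF xi_nonneg lt, of j] by (simp add: c_def)
    have "(\<Sum>k. r k * (1 - xi ^ (k - 1))) \<le> (1 - xi) - c"
    proof (rule LIMSEQ_le_const2[OF summable_LIMSEQ[OF sd]])
      show "\<exists>N. \<forall>K\<ge>N. (\<Sum>k<K. r k * (1 - xi ^ (k - 1))) \<le> (1 - xi) - c"
      proof (intro exI allI impI)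
        fix K assume K: "Suc ?k \<le> K"
        then have in': "?k \<in> {..<K}" by auto
        have "(\<Sum>k<K. r k * (1 - xi ^ (k - 1)))
            = r ?k * (1 - xi ^ (?k - 1)) + (\<Sum>k\<in>{..<K} - {?k}. r k * (1 - xi ^ (k - 1)))"
          using in' by (subst sum.remove[of _ ?k]) auto
        also have "\<dots> \<le> r ?k * (real ?k - 1) * (1 - xi) - c
            + (\<Sum>k\<in>{..<K} - {?k}. r k * (real k - 1) * (1 - xi))"
          by (intro add_mono sum_mono term_le) (simp add: c_def algebra_simps)
        also have "\<dots> = (\<Sum>k<K. r k * (real k - 1) * (1 - xi)) - c"
          using in' by (subst (2) sum.remove[of _ ?k]) auto
        also have "\<dots> = (\<Sum>k<K. r k * (real k - 1)) * (1 - xi) - c" by (simp add: sum_distrib_right)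
        also have "\<dots> \<le> 1 * (1 - xi) - c"
          using sub[of K] lt by (intro diff_right_mono mult_right_mono) auto
        finally show "(\<Sum>k<K. r k * (1 - xi ^ (k - 1))) \<le> (1 - xi) - c" by simp
      qed
    qed
    then show False using eq c by simp
  next
    case False
    then have r3: "r k = 0" if "3 \<le> k" for k
      using that r_nonneg[of k] by (metis add.commute le_Suc_ex linorder_not_less order_antisym_conv)
    have "(\<lambda>k. r k * (1 - xi ^ (k - 1))) sums (\<Sum>k<3. r k * (1 - xi ^ (k - 1)))"
      using r3 by (intro sums_finite) auto
    then have "1 - xi = r 2 * (1 - xi)"
      using eq by (simp add: sums_iff numeral_3_eq_3 r_0 numeral_2_eq_2)
    then show False using r2 lt by simp
  qed
qed

end

section \<open>Convergence of degree averages\<close>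

lemma eventually_le_nat_floor:
  assumes "0 < \<epsilon>"
  shows "\<forall>\<^sub>F n in sequentially. c \<le> nat \<lfloor>\<epsilon> * real n\<rfloor>"
  using eventually_ge_at_top[of "nat \<lceil>real c / \<epsilon>\<rceil>"]
proof eventually_elim
  case (elim n)
  then have "real c / \<epsilon> \<le> real n" by linarith
  then have "real c \<le> \<epsilon> * real n" using assms by (simp add: pos_divide_le_eq mult.commute)
  then show ?case by (rule le_nat_floor)
qed

lemma power_near:
  fixes a e :: real
  assumes "0 < e"
  obtains \<delta> where "0 < \<delta>" "\<And>x. a \<le> x \<Longrightarrow> x < a + \<delta> \<Longrightarrow> x ^ k - a ^ k < e"
proof -
  have "isCont (\<lambda>t. t ^ k) a" by (intro continuous_intros)
  then obtain \<delta> where "0 < \<delta>" "\<And>x. dist x a < \<delta> \<Longrightarrow> dist (x ^ k) (a ^ k) < e"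
    using assms unfolding continuous_at_eps_delta by blast
  then show ?thesis by (intro that[of \<delta>]) (auto simp: dist_real_def abs_less_iff)
qed

lemma card_active_half_edges:
  "card (active (half_edges n d') W) = (\<Sum>v | v \<in> {1..n} \<and> v \<in> W. d' v)"
proof -
  have "active (half_edges n d') W = (SIGMA j:{v. v \<in> {1..n} \<and> v \<in> W}. {..<d' j})"
    by (auto simp: active_def half_edges_def)
  then show ?thesis by simp
qed

text \<open>
The hypotheses on the degrees in terms of the limiting proportions \<open>p\<close>. Convergence of the mean
together with \<open>count_lim\<close> amounts to uniform integrability of the degrees.
\<close>

locale degree_limit =
  fixes d :: "nat \<Rightarrow> nat \<Rightarrow> nat" and p :: "nat \<Rightarrow> real" and \<mu> :: real
  assumes deg_pos: "\<And>n i. i \<in> {1..n} \<Longrightarrow> 1 \<le> d n i"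
    and deg_even: "\<And>n. even (\<Sum>i\<in>{1..n}. d n i)"
    and p_nonneg: "\<And>k. 0 \<le> p k" and p_sums: "p sums 1" and p_0: "p 0 = 0"
    and count_lim: "\<And>k. (\<lambda>n. real (card {v \<in> {1..n}. d n v = k}) / real n) \<longlonglongrightarrow> p k"
    and mean_sums: "(\<lambda>k. real k * p k) sums \<mu>"
    and mean_lim: "(\<lambda>n. real (\<Sum>v\<in>{1..n}. d n v) / real n) \<longlonglongrightarrow> \<mu>"
begin

lemma mu_ge_1: "1 \<le> \<mu>"
proof -
  have "(\<Sum>k. p k) \<le> (\<Sum>k. real k * p k)"
  proof (rule suminf_le)
    show "p k \<le> real k * p k" for k
      using p_nonneg[of k] p_0 by (cases k) (auto simp: algebra_simps)
  qed (use p_sums mean_sums in \<open>auto simp: sums_iff\<close>)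
  then show ?thesis using p_sums mean_sums by (simp add: sums_iff)
qed

lemma sum_over_degrees:
  fixes f :: "nat \<Rightarrow> real"
  shows "(\<Sum>v | v \<in> {1..n} \<and> d n v < N. f (d n v))
       = (\<Sum>k<N. f k * real (card {v \<in> {1..n}. d n v = k}))"
proof -
  have "(\<Sum>v | v \<in> {1..n} \<and> d n v < N. f (d n v))
     = (\<Sum>k<N. \<Sum>v | v \<in> {v \<in> {1..n}. d n v < N} \<and> d n v = k. f (d n v))"
    by (rule sum.group[symmetric]) auto
  also have "\<dots> = (\<Sum>k<N. f k * real (card {v \<in> {1..n}. d n v = k}))"
  proof (rule sum.cong[OF refl])
    fix k assume "k \<in> {..<N}"
    then have "{v. v \<in> {v \<in> {1..n}. d n v < N} \<and> d n v = k} = {v \<in> {1..n}. d n v = k}" by auto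
    then show "(\<Sum>v | v \<in> {v \<in> {1..n}. d n v < N} \<and> d n v = k. f (d n v))
        = f k * real (card {v \<in> {1..n}. d n v = k})"
      by simp
  qed
  finally show ?thesis .
qed

lemma truncated_average_lim:
  fixes f :: "nat \<Rightarrow> real"
  shows "(\<lambda>n. (\<Sum>v | v \<in> {1..n} \<and> d n v < N. f (d n v)) / real n) \<longlonglongrightarrow> (\<Sum>k<N. f k * p k)"
  unfolding sum_over_degrees sum_divide_distrib times_divide_eq_right[symmetric]
  by (intro tendsto_intros count_lim)

lemma sum_split_degree:
  fixes f :: "nat \<Rightarrow> real"
  shows "(\<Sum>v\<in>{1..n}. f v) = (\<Sum>v | v \<in> {1..n} \<and> d n v < N. f v) + (\<Sum>v | v \<in> {1..n} \<and> N \<le> d n v. f v)"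
  by (subst sum.union_disjoint[symmetric]) (auto intro!: sum.cong)

text \<open>
What the truncated means lose in the limit is the tail of the limiting mean; this is uniform
integrability.
\<close>

lemma tail_lim:
  "(\<lambda>n. (\<Sum>v | v \<in> {1..n} \<and> N \<le> d n v. real (d n v)) / real n) \<longlonglongrightarrow> \<mu> - (\<Sum>k<N. real k * p k)"
proof -
  have eq: "(\<Sum>v | v \<in> {1..n} \<and> N \<le> d n v. real (d n v))
      = real (\<Sum>v\<in>{1..n}. d n v) - (\<Sum>v | v \<in> {1..n} \<and> d n v < N. real (d n v))" for n
    using sum_split_degree[of "\<lambda>v. real (d n v)" n N] by simp
  show ?thesis unfolding eq diff_divide_distrib
    by (intro tendsto_diff mean_lim truncated_average_lim[of "\<lambda>k. real k"])
qed

lemma mean_tail_small: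
  assumes "0 < e"
  obtains N where "\<mu> - (\<Sum>k<N. real k * p k) < e"
proof -
  have "(\<lambda>N. \<Sum>k<N. real k * p k) \<longlonglongrightarrow> \<mu>" using mean_sums by (simp add: sums_def)
  then have "\<forall>\<^sub>F N in sequentially. \<mu> - e < (\<Sum>k<N. real k * p k)"
    using assms by (intro order_tendstoD) auto
  then obtain N where "\<mu> - e < (\<Sum>k<N. real k * p k)" by (meson eventually_sequentially order_refl)
  then show ?thesis by (intro that[of N]) simp
qed

lemma tail_small:
  assumes "0 < e"
  obtains N where "\<forall>\<^sub>F n in sequentially. (\<Sum>v | v \<in> {1..n} \<and> N \<le> d n v. real (d n v)) \<le> e * real n"
proof -
  obtain N where "\<mu> - (\<Sum>k<N. real k * p k) < e" using mean_tail_small[OF assms] .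
  then have "\<forall>\<^sub>F n in sequentially. (\<Sum>v | v \<in> {1..n} \<and> N \<le> d n v. real (d n v)) / real n < e"
    using order_tendstoD(2)[OF tail_lim] by blast
  then have "\<forall>\<^sub>F n in sequentially. (\<Sum>v | v \<in> {1..n} \<and> N \<le> d n v. real (d n v)) \<le> e * real n"
    using eventually_gt_at_top[of 0]
    by eventually_elim (simp add: divide_less_eq)
  then show ?thesis by (rule that)
qed

text \<open>
Averages of functions of at most linear growth converge, because uniform integrability
controls the vertices of large degree.
\<close>

lemma average_lim:
  fixes f :: "nat \<Rightarrow> real"
  assumes f: "\<And>k. 0 \<le> f k" "\<And>k. f k \<le> real k"
  shows "(\<lambda>n. (\<Sum>v\<in>{1..n}. f (d n v)) / real n) \<longlonglongrightarrow> (\<Sum>k. f k * p k)"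
proof (rule LIMSEQ_I)
  have sm: "summable (\<lambda>k. f k * p k)"
  proof (rule summable_comparison_test')
    show "summable (\<lambda>k. real k * p k)" using mean_sums by (rule sums_summable)
    show "norm (f k * p k) \<le> real k * p k" for k
      using f p_nonneg by (simp add: mult_right_mono)
  qed
  fix e :: real assume e: "0 < e"
  then obtain N where N: "\<mu> - (\<Sum>k<N. real k * p k) < e / 3" using mean_tail_small[of "e / 3"] by auto
  have S: "0 \<le> (\<Sum>k. f k * p k) - (\<Sum>k<N. f k * p k)"
    "(\<Sum>k. f k * p k) - (\<Sum>k<N. f k * p k) \<le> \<mu> - (\<Sum>k<N. real k * p k)"
  proof -
    show "0 \<le> (\<Sum>k. f k * p k) - (\<Sum>k<N. f k * p k)"
      using f p_nonneg sum_le_suminf[OF sm, of "{..<N}"] by simp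
    have "(\<Sum>k. f (k + N) * p (k + N)) \<le> (\<Sum>k. real (k + N) * p (k + N))"
    proof (rule suminf_le)
      show "summable (\<lambda>k. f (k + N) * p (k + N))" by (rule summable_ignore_initial_segment[OF sm])
      show "summable (\<lambda>k. real (k + N) * p (k + N))"
        by (rule summable_ignore_initial_segment[OF sums_summable[OF mean_sums]])
      show "f (k + N) * p (k + N) \<le> real (k + N) * p (k + N)" for k
        by (rule mult_right_mono[OF f(2) p_nonneg])
    qed
    then show "(\<Sum>k. f k * p k) - (\<Sum>k<N. f k * p k) \<le> \<mu> - (\<Sum>k<N. real k * p k)"
      using suminf_split_initial_segment[OF sm, of N]
        suminf_split_initial_segment[OF sums_summable[OF mean_sums], of N] mean_sums
      by (simp add: sums_iff)
  qed
  have "\<forall>\<^sub>F n in sequentially. (\<Sum>v | v \<in> {1..n} \<and> N \<le> d n v. real (d n v)) / real n < e / 3"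
    using order_tendstoD(2)[OF tail_lim N] .
  moreover have "\<forall>\<^sub>F n in sequentially.
      dist ((\<Sum>v | v \<in> {1..n} \<and> d n v < N. f (d n v)) / real n) (\<Sum>k<N. f k * p k) < e / 3"
    by (rule tendstoD[OF truncated_average_lim]) (use e in simp)
  ultimately have "\<forall>\<^sub>F n in sequentially. norm ((\<Sum>v\<in>{1..n}. f (d n v)) / real n - (\<Sum>k. f k * p k)) < e"
    using eventually_gt_at_top[of 0]
  proof eventually_elim
    case (elim n)
    have split: "(\<Sum>v\<in>{1..n}. f (d n v)) / real n
      = (\<Sum>v | v \<in> {1..n} \<and> d n v < N. f (d n v)) / real n + (\<Sum>v | v \<in> {1..n} \<and> N \<le> d n v. f (d n v)) / real n"
      using sum_split_degree[of "\<lambda>v. f (d n v)" n N] by (simp add: add_divide_distrib)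
    have "(\<Sum>v | v \<in> {1..n} \<and> N \<le> d n v. f (d n v)) / real n
        \<le> (\<Sum>v | v \<in> {1..n} \<and> N \<le> d n v. real (d n v)) / real n"
      using f by (intro divide_right_mono sum_mono) auto
    moreover have "0 \<le> (\<Sum>v | v \<in> {1..n} \<and> N \<le> d n v. f (d n v)) / real n"
      using f by (intro divide_nonneg_nonneg sum_nonneg) auto
    ultimately show ?case using elim(1,2) S N unfolding split real_norm_def dist_real_def by linarith
  qed
  then show "\<exists>no. \<forall>n\<ge>no. norm ((\<Sum>v\<in>{1..n}. f (d n v)) / real n - (\<Sum>k. f k * p k)) < e"
    by (simp add: eventually_sequentially)
qed

text \<open>
The size-biased distribution: in the limit, \<open>r k\<close> is the probability that a uniform half-edge is at a vertex of
degree \<open>k\<close>.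
\<close>

definition r :: "nat \<Rightarrow> real" where
  "r k = real k * p k / \<mu>"

sublocale offspring r
proof
  show "0 \<le> r k" for k using p_nonneg mu_ge_1 by (simp add: r_def)
  show "r sums 1" using sums_divide[OF mean_sums, of \<mu>] mu_ge_1
    by (simp add: r_def[abs_def])
  show "r 0 = 0" by (simp add: r_def)
qed

lemma sum_power_eq_gen: "0 \<le> x \<Longrightarrow> x \<le> 1 \<Longrightarrow> (\<Sum>k. real k * x ^ k * p k) = \<mu> * x * gen x"
proof -
  assume x: "0 \<le> x" "x \<le> 1"
  have "real k * x ^ k * p k = \<mu> * x * (r k * x ^ (k - 1))" for k
    using mu_ge_1 by (cases k) (auto simp: r_def)
  then show ?thesis using gen_summable[OF x] by (simp add: gen_def suminf_mult)
qed

lemma card_half_edges_lim: "(\<lambda>n. real (card (half_edges n (d n))) / real n) \<longlonglongrightarrow> \<mu>"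
  using mean_lim by (simp add: card_half_edges)

text \<open>
A vertex of degree below \<open>N\<close> carries at most \<open>N\<close> half-edges, and all vertices of larger degree together carry
a small proportion of the half-edges.
\<close>

lemma few_vertices_few_half_edges:
  assumes "0 < \<eta>"
  obtains \<epsilon> where "0 < \<epsilon>" "\<forall>\<^sub>F n in sequentially. \<forall>W :: nat set. finite W \<longrightarrow> real (card W) \<le> \<epsilon> * real n \<longrightarrow>
     real (card (active (half_edges n (d n)) W)) \<le> \<eta> * real n"
proof -
  obtain N where N: "\<forall>\<^sub>F n in sequentially.
      (\<Sum>v | v \<in> {1..n} \<and> N \<le> d n v. real (d n v)) \<le> \<eta> / 2 * real n"
    using tail_small[of "\<eta> / 2"] assms by auto
  define \<epsilon> where "\<epsilon> = \<eta> / 2 / (real N + 1)"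
  have "0 < \<epsilon>" using assms by (simp add: \<epsilon>_def)
  moreover from N have "\<forall>\<^sub>F n in sequentially. \<forall>W :: nat set. finite W \<longrightarrow> real (card W) \<le> \<epsilon> * real n \<longrightarrow>
     real (card (active (half_edges n (d n)) W)) \<le> \<eta> * real n"
  proof (rule eventually_mono, intro allI impI)
    fix n and W :: "nat set"
    assume n: "(\<Sum>v | v \<in> {1..n} \<and> N \<le> d n v. real (d n v)) \<le> \<eta> / 2 * real n"
      and W: "finite W" "real (card W) \<le> \<epsilon> * real n"
    have "real (card (active (half_edges n (d n)) W)) = (\<Sum>v | v \<in> {1..n} \<and> v \<in> W. real (d n v))"
      by (simp add: card_active_half_edges)
    also have "\<dots> \<le> (\<Sum>v | v \<in> {1..n} \<and> v \<in> W. real N + (if N \<le> d n v then real (d n v) else 0))"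
      by (intro sum_mono) auto
    also have "\<dots> = real N * real (card {v. v \<in> {1..n} \<and> v \<in> W})
        + (\<Sum>v | v \<in> {1..n} \<and> v \<in> W. if N \<le> d n v then real (d n v) else 0)"
      by (simp add: sum.distrib)
    also have "\<dots> \<le> real N * (\<epsilon> * real n) + \<eta> / 2 * real n"
    proof (intro add_mono mult_left_mono)
      have "card {v. v \<in> {1..n} \<and> v \<in> W} \<le> card W" using W(1) by (intro card_mono) auto
      then show "real (card {v. v \<in> {1..n} \<and> v \<in> W}) \<le> \<epsilon> * real n" using W(2) by linarith
      have "(\<Sum>v | v \<in> {1..n} \<and> v \<in> W. if N \<le> d n v then real (d n v) else 0)
          \<le> (\<Sum>v\<in>{1..n}. if N \<le> d n v then real (d n v) else 0)"
        by (intro sum_mono2) auto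
      also have "\<dots> = (\<Sum>v | v \<in> {1..n} \<and> N \<le> d n v. real (d n v))"
        by (rule sum.inter_filter[symmetric]) auto
      finally show "(\<Sum>v | v \<in> {1..n} \<and> v \<in> W. if N \<le> d n v then real (d n v) else 0)
          \<le> \<eta> / 2 * real n" using n by linarith
    qed auto
    also have "\<dots> \<le> \<eta> * real n"
    proof -
      have "real N * \<epsilon> \<le> \<eta> / 2" using assms by (simp add: \<epsilon>_def field_simps)
      then have "real N * \<epsilon> * real n \<le> \<eta> / 2 * real n" by (intro mult_right_mono) auto
      then show ?thesis by (simp add: mult.assoc)
    qed
    finally show "real (card (active (half_edges n (d n)) W)) \<le> \<eta> * real n" .
  qed
  ultimately show ?thesis by (rule that)
qed

abbreviation half_edges_n :: "nat \<Rightarrow> half_edge set" where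
  "half_edges_n n \<equiv> half_edges n (d n)"

lemma even_card_half_edges: "even (card (half_edges_n n))"
  using deg_even by (simp add: card_half_edges)

lemma card_half_edges_ge: "n \<le> card (half_edges_n n)"
proof -
  have "(\<Sum>i\<in>{1..n}. 1) \<le> (\<Sum>i\<in>{1..n}. d n i)" using deg_pos by (intro sum_mono) auto
  then show ?thesis by (simp add: card_half_edges)
qed

lemma size_bias_lim:
  "(\<lambda>n. real k * (real (card {v \<in> {1..n}. d n v = k}) - real c) / real (card (half_edges_n n))) \<longlonglongrightarrow> r k"
proof -
  have "(\<lambda>n. real k * (real (card {v \<in> {1..n}. d n v = k}) / real n - real c * (1 / real n))
     / (real (card (half_edges_n n)) / real n)) \<longlonglongrightarrow> real k * (p k - real c * 0) / \<mu>"
    using mu_ge_1 by (intro tendsto_intros count_lim card_half_edges_lim lim_1_over_n) auto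
  moreover have "\<forall>\<^sub>F n in sequentially. real k * (real (card {v \<in> {1..n}. d n v = k}) / real n - real c * (1 / real n))
     / (real (card (half_edges_n n)) / real n)
     = real k * (real (card {v \<in> {1..n}. d n v = k}) - real c) / real (card (half_edges_n n))"
    using eventually_gt_at_top[of 0]
  proof eventually_elim
    case (elim n)
    have "real (card {v \<in> {1..n}. d n v = k}) / real n - real c * (1 / real n)
        = (real (card {v \<in> {1..n}. d n v = k}) - real c) / real n"
      by (simp add: diff_divide_distrib)
    with elim show ?case by simp
  qed
  ultimately have "(\<lambda>n. real k * (real (card {v \<in> {1..n}. d n v = k}) - real c) / real (card (half_edges_n n)))
      \<longlonglongrightarrow> real k * (p k - real c * 0) / \<mu>"
    by (rule Lim_transform_eventually)
  then show ?thesis by (simp add: r_def)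
qed

section \<open>The probability of a small component\<close>

lemma card_new_half_edges:
  assumes st: "exploration_state n (d n) H W"
  shows "real k * (real (card {v \<in> {1..n}. d n v = k}) - real (card W))
    \<le> real (card {y \<in> H. fst y \<notin> W \<and> d n (fst y) = k})"
proof -
  have "{y \<in> H. fst y \<notin> W \<and> d n (fst y) = k}
      = (SIGMA v:{v \<in> {1..n}. d n v = k} - W. {..<d n v})"
    using st by (auto simp: exploration_state_def half_edges_def)
  then have "card {y \<in> H. fst y \<notin> W \<and> d n (fst y) = k} = (\<Sum>v\<in>{v \<in> {1..n}. d n v = k} - W. d n v)"
    by simp
  also have "\<dots> = (\<Sum>v\<in>{v \<in> {1..n}. d n v = k} - W. k)" by (intro sum.cong) auto
  also have "\<dots> = k * card ({v \<in> {1..n}. d n v = k} - W)" by simp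
  finally have "real (card {y \<in> H. fst y \<notin> W \<and> d n (fst y) = k})
     = real k * real (card ({v \<in> {1..n}. d n v = k} - W))" by simp
  moreover have "card {v \<in> {1..n}. d n v = k} - card W \<le> card ({v \<in> {1..n}. d n v = k} - W)"
    using st by (intro diff_card_le_card_Diff) (auto simp: exploration_state_def)
  then have "real (card {v \<in> {1..n}. d n v = k}) - real (card W) \<le> real (card ({v \<in> {1..n}. d n v = k} - W))"
    by linarith
  ultimately show ?thesis by (simp add: mult_left_mono)
qed

text \<open>
Induction on the number of steps, uniformly over all states with boundedly many vertices met: the
partner is at a fresh vertex of degree \<open>k\<close> with probability at least \<open>r k - e'\<close> for large \<open>n\<close>.
\<close>

lemma small_component_lower_bound:
  assumes "0 < e"
  shows "\<forall>\<^sub>F n in sequentially. \<forall>H W. exploration_state n (d n) H W \<longrightarrow> card W \<le> c \<longrightarrow>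
     card (active H W) = j \<longrightarrow> extinction_prob r K m j - e \<le> matching_prob H (\<lambda>G. edge_count G W \<le> m)"
  using assms
proof (induction m arbitrary: c j e)
  case 0
  show ?case
  proof (intro always_eventually allI impI)
    fix n H W assume st: "exploration_state n (d n) H W" and j: "card (active H W) = j"
    show "extinction_prob r K 0 j - e \<le> matching_prob H (\<lambda>G. edge_count G W \<le> 0)"
    proof (cases "j = 0")
      case True
      have fin: "finite H" "even (card H)"
        using st exploration_state_finite[OF st] by (auto simp: exploration_state_def)
      then have "active H W = {}" using j True by (auto simp: active_def)
      then have "matching_prob H (\<lambda>G. edge_count G W \<le> 0) = 1"
        using edge_count_no_active fin by (intro matching_prob_eq_1) auto
      then show ?thesis using 0 True by simp
    next
      case False
      then have "extinction_prob r K 0 j = 0" by simp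
      then show ?thesis
        using 0 matching_prob_nonneg[of H "\<lambda>G. edge_count G W \<le> 0"] by linarith
    qed
  qed
next
  case (Suc m)
  \<comment> \<open>Half of \<open>e\<close> goes to the induction hypothesis, the other half to \<open>K\<close> errors \<open>e'\<close> in the weights.\<close>
  define e' where "e' = e / (2 * (real K + 1))"
  have e': "0 < e'" "real K * e' \<le> e / 2" using Suc.prems by (auto simp: e'_def field_simps)
  have "\<forall>\<^sub>F n in sequentially. \<forall>k\<in>{..<K}. r k - e' <
      real k * (real (card {v \<in> {1..n}. d n v = k}) - real c) / real (card (half_edges_n n))"
    using e' by (intro eventually_ball_finite ballI order_tendstoD(1)[OF size_bias_lim]) auto
  moreover have "\<forall>\<^sub>F n in sequentially. \<forall>k\<in>{..<K}. \<forall>H W. exploration_state n (d n) H W \<longrightarrow>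
      card W \<le> Suc c \<longrightarrow> card (active H W) = j + k - 2 \<longrightarrow>
      extinction_prob r K m (j + k - 2) - e / 2 \<le> matching_prob H (\<lambda>G. edge_count G W \<le> m)"
    using Suc.prems by (intro eventually_ball_finite ballI Suc.IH) auto
  ultimately show ?case using eventually_gt_at_top[of 0]
  proof (eventually_elim, intro allI impI)
    fix n H W
    assume n: "\<forall>k\<in>{..<K}. r k - e' <
      real k * (real (card {v \<in> {1..n}. d n v = k}) - real c) / real (card (half_edges_n n))"
      and IH: "\<forall>k\<in>{..<K}. \<forall>H W. exploration_state n (d n) H W \<longrightarrow>
      card W \<le> Suc c \<longrightarrow> card (active H W) = j + k - 2 \<longrightarrow>
      extinction_prob r K m (j + k - 2) - e / 2 \<le> matching_prob H (\<lambda>G. edge_count G W \<le> m)"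
      and n0: "0 < n"
      and st: "exploration_state n (d n) H W" and c: "card W \<le> c" and j: "card (active H W) = j"
    have fin: "finite H" "even (card H)"
      using st exploration_state_finite[OF st] by (auto simp: exploration_state_def)
    let ?L = "real (card (half_edges_n n))"
    show "extinction_prob r K (Suc m) j - e \<le> matching_prob H (\<lambda>G. edge_count G W \<le> Suc m)"
    proof (cases "j = 0")
      case True
      then have "active H W = {}" using j fin by (auto simp: active_def)
      then have "matching_prob H (\<lambda>G. edge_count G W \<le> Suc m) = 1"
        using edge_count_no_active fin by (intro matching_prob_eq_1) auto
      then show ?thesis using Suc.prems True by simp
    next
      case False
      then obtain x where x: "x \<in> active H W" using j by (metis all_not_in_conv card.empty)
      then have x': "x \<in> H" "fst x \<in> W" by (auto simp: active_def)
      have H2: "2 \<le> card H" using card_even_ge_2[OF fin x'(1)] .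
      have HL: "real (card H) - 1 \<le> ?L"
        using st card_mono[of "half_edges_n n" H] by (auto simp: exploration_state_def)
      \<comment> \<open>The bound of the induction hypothesis, cut at \<open>0\<close> to make it monotone as a factor.\<close>
      define u where "u k = max 0 (extinction_prob r K m (j + k - 2) - e / 2)" for k
      have u: "0 \<le> u k" "extinction_prob r K m (j + k - 2) - e / 2 \<le> u k" "u k \<le> 1" for k
        using extinction_prob_le_1[of K m "j + k - 2"] Suc.prems by (auto simp: u_def)
      let ?N = "\<lambda>k. {y \<in> H. fst y \<notin> W \<and> d n (fst y) = k}"
      let ?P = "\<lambda>y. matching_prob (H - {x, y}) (\<lambda>G. edge_count (insert {x, y} G) W \<le> Suc m)"
      have Py: "u k \<le> ?P y" if k: "k < K" and y: "y \<in> ?N k" for k y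
      proof -
        have y': "y \<in> H - {x}" using y x' by auto
        have "card (active (H - {x, y}) (insert (fst y) W)) = j + k - 2"
          using card_active_step_new[OF st x, of y] y j by auto
        then have "extinction_prob r K m (j + k - 2) - e / 2
            \<le> matching_prob (H - {x, y}) (\<lambda>G. edge_count G (insert (fst y) W) \<le> m)"
          using IH k exploration_state_step[OF st x y'] c card_insert_le_Suc[of "fst y" W] by fastforce
        also have "\<dots> = ?P y"
          using edge_count_peel[OF fin(1) _ x'(2)] by (intro matching_prob_cong) auto
        finally show ?thesis by (simp add: u_def)
      qed
      have "extinction_prob r K (Suc m) j - e \<le> (\<Sum>k<K. u k * (r k - e'))"
      proof -
        have "(\<Sum>k<K. r k * extinction_prob r K m (j + k - 2)) - e / 2 \<le> (\<Sum>k<K. r k * (extinction_prob r K m (j + k - 2) - e / 2))"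
        proof -
          have "(\<Sum>k<K. r k) \<le> 1"
            using sum_le_suminf[OF sums_summable[OF r_sums], of "{..<K}"] r_nonneg r_sums by (simp add: sums_iff)
          then have "(\<Sum>k<K. r k) * (e / 2) \<le> 1 * (e / 2)" using Suc.prems by (intro mult_right_mono) auto
          moreover have "(\<Sum>k<K. r k * (extinction_prob r K m (j + k - 2) - e / 2))
              = (\<Sum>k<K. r k * extinction_prob r K m (j + k - 2)) - (\<Sum>k<K. r k) * (e / 2)"
            by (simp only: right_diff_distrib sum_subtractf sum_distrib_right)
          ultimately show ?thesis by linarith
        qed
        also have "\<dots> \<le> (\<Sum>k<K. r k * u k)" using u r_nonneg by (intro sum_mono mult_left_mono) auto
        also have "\<dots> \<le> (\<Sum>k<K. u k * (r k - e') + e')"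
        proof (rule sum_mono)
          fix k
          have "u k * e' \<le> 1 * e'" using u e' by (intro mult_right_mono) auto
          then show "r k * u k \<le> u k * (r k - e') + e'" by (simp add: algebra_simps)
        qed
        also have "\<dots> = (\<Sum>k<K. u k * (r k - e')) + real K * e'" by (simp add: sum.distrib)
        finally show ?thesis using e' False by simp
      qed
      also have "\<dots> \<le> (\<Sum>k<K. u k * (real (card (?N k)) / ?L))"
      proof (intro sum_mono mult_left_mono u)
        fix k assume k: "k \<in> {..<K}"
        then have "r k - e' \<le> real k * (real (card {v \<in> {1..n}. d n v = k}) - real c) / ?L"
          using n by (simp add: less_imp_le)
        also have "\<dots> \<le> real (card (?N k)) / ?L"
        proof (rule divide_right_mono)
          have "real k * (real (card {v \<in> {1..n}. d n v = k}) - real c)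
            \<le> real k * (real (card {v \<in> {1..n}. d n v = k}) - real (card W))"
            using c by (intro mult_left_mono) auto
          also have "\<dots> \<le> real (card (?N k))" by (rule card_new_half_edges[OF st])
          finally show "real k * (real (card {v \<in> {1..n}. d n v = k}) - real c) \<le> real (card (?N k))" .
        qed simp
        finally show "r k - e' \<le> real (card (?N k)) / ?L" .
      qed
      also have "\<dots> \<le> (\<Sum>k<K. u k * (real (card (?N k)) / (real (card H) - 1)))"
        using HL H2 u by (intro sum_mono mult_left_mono divide_left_mono mult_pos_pos) auto
      also have "\<dots> = (\<Sum>k<K. \<Sum>y\<in>?N k. u k) / (real (card H) - 1)"
        by (simp add: sum_divide_distrib mult.commute)
      also have "\<dots> \<le> (\<Sum>k<K. \<Sum>y\<in>?N k. ?P y) / (real (card H) - 1)"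
        using H2 Py by (intro divide_right_mono sum_mono) auto
      also have "(\<Sum>k<K. \<Sum>y\<in>?N k. ?P y) = sum ?P (\<Union>k<K. ?N k)"
        using fin by (intro sum.UNION_disjoint[symmetric]) auto
      also have "sum ?P (\<Union>k<K. ?N k) / (real (card H) - 1) \<le> (\<Sum>y\<in>H - {x}. ?P y) / (real (card H) - 1)"
        using fin H2 x' by (intro divide_right_mono sum_mono2) auto
      also have "\<dots> = matching_prob H (\<lambda>G. edge_count G W \<le> Suc m)"
        by (rule matching_prob_peel[OF fin x'(1), symmetric])
      finally show ?thesis .
    qed
  qed
qed

lemma small_component_lower_xi:
  assumes "0 < e"
  obtains M where "\<And>m. M \<le> m \<Longrightarrow> \<forall>\<^sub>F n in sequentially. \<forall>v\<in>{1..n}. d n v = k \<longrightarrow>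
     xi ^ k - e \<le> matching_prob (half_edges_n n) (\<lambda>G. edge_count G {v} \<le> m)"
proof -
  obtain M where M: "xi ^ k - e / 2 < extinction_prob r M M k" using extinction_prob_near_xi_power[of "e / 2" k] assms by auto
  have "\<forall>\<^sub>F n in sequentially. \<forall>v\<in>{1..n}. d n v = k \<longrightarrow>
     xi ^ k - e \<le> matching_prob (half_edges_n n) (\<lambda>G. edge_count G {v} \<le> m)" if "M \<le> m" for m
  proof -
    have "\<forall>\<^sub>F n in sequentially. \<forall>H W. exploration_state n (d n) H W \<longrightarrow> card W \<le> 1 \<longrightarrow>
       card (active H W) = k \<longrightarrow> extinction_prob r M m k - e / 2 \<le> matching_prob H (\<lambda>G. edge_count G W \<le> m)"
      using assms by (intro small_component_lower_bound) auto
    then show ?thesis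
    proof (eventually_elim, intro ballI impI)
      fix n v assume *: "\<forall>H W. exploration_state n (d n) H W \<longrightarrow> card W \<le> 1 \<longrightarrow>
       card (active H W) = k \<longrightarrow> extinction_prob r M m k - e / 2 \<le> matching_prob H (\<lambda>G. edge_count G W \<le> m)"
        and v: "v \<in> {1..n}" "d n v = k"
      have "extinction_prob r M m k - e / 2 \<le> matching_prob (half_edges_n n) (\<lambda>G. edge_count G {v} \<le> m)"
        using * exploration_state_init[OF deg_even, of n v] card_active_init[OF v(1), of "d n"] v(2) by simp
      moreover have "extinction_prob r M M k \<le> extinction_prob r M m k" using that by (intro extinction_prob_mono) auto
      ultimately show "xi ^ k - e \<le> matching_prob (half_edges_n n) (\<lambda>G. edge_count G {v} \<le> m)"
        using M by linarith
    qed
  qed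
  then show ?thesis by (rule that)
qed

text \<open>
After division by \<open>n\<close> and in the limit, with \<open>a\<close> negligible, the drift condition reads
\<open>\<mu> * x * gen x < \<rho> * x\<^sup>2 * \<mu>\<close>. The strict inequality \<open>gen x < x\<close> leaves room for some \<open>\<rho> < 1\<close> and for \<open>a\<close> of
order \<open>n\<close>.
\<close>

lemma eventually_drift:
  assumes x: "0 < x" "x < 1" and g: "gen x < x"
  obtains \<epsilon> \<rho> \<eta> where "0 < \<epsilon>" "0 < \<rho>" "\<rho> < 1"
    "\<forall>\<^sub>F n in sequentially. exploration_drift n (d n) (nat \<lfloor>\<epsilon> * real n\<rfloor>) (nat \<lfloor>\<eta> * real n\<rfloor>) x \<rho>"
proof -
  define q where "q = gen x / x"
  define \<rho> where "\<rho> = (q + 1) / 2"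
  have "q < 1" using g x by (simp add: q_def)
  moreover have "0 \<le> q" using gen_nonneg[of x] x by (simp add: q_def)
  ultimately have \<rho>: "0 < \<rho>" "\<rho> < 1" "q < \<rho>" by (simp_all add: \<rho>_def)
  define S where "S = \<mu> * x * gen x"
  have "gen x < \<rho> * x" using \<rho>(3) x by (simp add: divide_less_eq q_def)
  then have "S < \<mu> * x * (\<rho> * x)" unfolding S_def using mu_ge_1 x by (intro mult_strict_left_mono) auto
  then have S: "S < \<rho> * x\<^sup>2 * \<mu>" by (simp add: power2_eq_square mult_ac)
  define \<delta> where "\<delta> = \<rho> * x\<^sup>2 * \<mu> - S"
  define \<eta> where "\<eta> = min (\<delta> / 4) (1 / 2)"
  have "0 < \<delta>" using S by (simp add: \<delta>_def)
  then have "0 < \<eta>" "2 * \<eta> < \<delta>" "\<eta> < 1" by (auto simp: \<eta>_def min_def)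
  then have \<eta>: "0 < \<eta>" "2 * \<eta> < \<rho> * x\<^sup>2 * \<mu> - S" "\<eta> < 1" by (simp_all only: \<delta>_def)
  obtain \<epsilon> where \<epsilon>: "0 < \<epsilon>" "\<forall>\<^sub>F n in sequentially. \<forall>W :: nat set. finite W \<longrightarrow> real (card W) \<le> \<epsilon> * real n \<longrightarrow>
     real (card (active (half_edges n (d n)) W)) \<le> \<eta> * real n"
    using few_vertices_few_half_edges[OF \<eta>(1)] .
  have inv: "(\<lambda>n. 1 / real n) \<longlonglongrightarrow> 0" by (rule lim_1_over_n)
  have lim1: "(\<lambda>n. (\<Sum>v\<in>{1..n}. real (d n v) * x ^ d n v) / real n) \<longlonglongrightarrow> S"
    using average_lim[of "\<lambda>k. real k * x ^ k"] x sum_power_eq_gen[of x]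
    by (simp add: S_def mult_left_le power_le_one)
  have "(\<lambda>n. \<rho> * x\<^sup>2 * (real (card (half_edges n (d n))) / real n - \<eta> - 1 / real n)
      - \<eta> - (\<Sum>v\<in>{1..n}. real (d n v) * x ^ d n v) / real n)
    \<longlonglongrightarrow> \<rho> * x\<^sup>2 * (\<mu> - \<eta> - 0) - \<eta> - S"
    by (intro tendsto_intros card_half_edges_lim inv lim1)
  moreover have "0 < \<rho> * x\<^sup>2 * (\<mu> - \<eta> - 0) - \<eta> - S"
  proof -
    have "x\<^sup>2 \<le> 1" using x by (simp add: power_le_one)
    then have "\<rho> * x\<^sup>2 \<le> 1" using \<rho> by (intro mult_le_one) auto
    then have "\<rho> * x\<^sup>2 * \<eta> \<le> \<eta>" using \<eta> by simp
    moreover have "\<rho> * x\<^sup>2 * (\<mu> - \<eta> - 0) = \<rho> * x\<^sup>2 * \<mu> - \<rho> * x\<^sup>2 * \<eta>"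
      by (simp add: right_diff_distrib)
    ultimately show ?thesis using \<eta> by linarith
  qed
  ultimately have ev1: "\<forall>\<^sub>F n in sequentially. 0 < \<rho> * x\<^sup>2 * (real (card (half_edges n (d n))) / real n - \<eta> - 1 / real n)
      - \<eta> - (\<Sum>v\<in>{1..n}. real (d n v) * x ^ d n v) / real n"
    by (intro order_tendstoD) auto
  have "(\<lambda>n. real (card (half_edges n (d n))) / real n - \<eta> - 1 / real n) \<longlonglongrightarrow> \<mu> - \<eta> - 0"
    by (intro tendsto_intros card_half_edges_lim inv)
  then have ev2: "\<forall>\<^sub>F n in sequentially. 0 < real (card (half_edges n (d n))) / real n - \<eta> - 1 / real n"
    by (rule order_tendstoD(1)) (use \<eta> mu_ge_1 in simp)
  have "\<forall>\<^sub>F n in sequentially. exploration_drift n (d n) (nat \<lfloor>\<epsilon> * real n\<rfloor>) (nat \<lfloor>\<eta> * real n\<rfloor>) x \<rho>"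
    using ev1 ev2 \<epsilon>(2) eventually_gt_at_top[of 0]
  proof eventually_elim
    case (elim n)
    let ?a = "nat \<lfloor>\<eta> * real n\<rfloor>" and ?H = "half_edges n (d n)"
    have a: "real ?a \<le> \<eta> * real n" using \<eta> by (simp add: of_nat_floor)
    have eq: "real (card ?H) / real n - \<eta> - 1 / real n = (real (card ?H) - \<eta> * real n - 1) / real n"
      using elim(4) by (simp add: diff_divide_distrib)
    have "0 < (real (card ?H) - \<eta> * real n - 1) / real n"
      using elim(2) unfolding eq .
    then have pos: "0 < real (card ?H) - \<eta> * real n - 1" using elim(4) by (simp add: zero_less_divide_iff)
    have "0 < (\<rho> * x\<^sup>2 * (real (card ?H) - \<eta> * real n - 1) - \<eta> * real n
        - (\<Sum>v\<in>{1..n}. real (d n v) * x ^ d n v)) / real n"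
    proof -
      have "(c * A - \<eta> * real n - s) / real n = c * (A / real n) - \<eta> - s / real n" for A c s :: real
        using elim(4) by (simp add: diff_divide_distrib)
      then show ?thesis using elim(1) unfolding eq by simp
    qed
    then have dr: "\<eta> * real n + (\<Sum>v\<in>{1..n}. real (d n v) * x ^ d n v)
        < \<rho> * x\<^sup>2 * (real (card ?H) - \<eta> * real n - 1)"
      using elim(4) by (simp add: zero_less_divide_iff)
    have sum: "(\<Sum>h\<in>?H. x ^ d n (fst h)) = (\<Sum>v\<in>{1..n}. real (d n v) * x ^ d n v)"
      using sum.Sigma[of "{1..n}" "\<lambda>j. {..<d n j}" "\<lambda>j _. x ^ d n j"]
      by (simp add: half_edges_def case_prod_beta)
    show ?case
    proof
      show "0 < x" "x \<le> 1" "0 \<le> \<rho>" "\<rho> \<le> 1" using x \<rho> by auto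
      show "?a + 1 < card ?H" using a pos by linarith
      show "card (active ?H W) \<le> ?a" if "finite W" "card W \<le> nat \<lfloor>\<epsilon> * real n\<rfloor>" for W
      proof -
        have "real (card W) \<le> \<epsilon> * real n" using that(2) \<epsilon>(1) by (simp add: le_nat_floor le_nat_iff le_floor_iff)
        then have "real (card (active ?H W)) \<le> \<eta> * real n" using elim(3) that(1) by blast
        then show ?thesis by (simp add: le_nat_floor)
      qed
      have "\<rho> * x\<^sup>2 * (real (card ?H) - \<eta> * real n - 1) \<le> \<rho> * x\<^sup>2 * (real (card ?H) - real ?a - 1)"
        using a \<rho> by (intro mult_left_mono) auto
      then show "real ?a + (\<Sum>h\<in>?H. x ^ d n (fst h)) \<le> \<rho> * x\<^sup>2 * (real (card ?H) - real ?a - 1)"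
        unfolding sum using dr a by linarith
    qed
  qed
  then show ?thesis using that \<epsilon>(1) \<rho>(1,2) by blast
qed

text \<open>
The two cases in which \<open>xi\<close> can be approximated from above by admissible \<open>x\<close>: for \<open>xi = 1\<close> the bound
with \<open>x = 1\<close> is trivial.
\<close>

lemma two_small_components_bound:
  assumes crit: "xi = 1 \<or> (\<exists>K. 1 < (\<Sum>k<K. r k * (real k - 1)))" and "0 < \<delta>"
  obtains x where "xi \<le> x" "x \<le> 1" "x < xi + \<delta>"
    "\<And>m. \<forall>\<^sub>F n in sequentially. \<forall>v\<in>{1..n}. \<forall>v'\<in>{1..n}. matching_prob (half_edges_n n)
       (\<lambda>G. edge_count G {v} \<le> m \<and> v' \<notin> reach G {v} \<and> edge_count G {v'} \<le> m) \<le> x ^ d n v * x ^ d n v'"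
proof (cases "xi = 1")
  case True
  show ?thesis
  proof (rule that[of 1])
    show "\<forall>\<^sub>F n in sequentially. \<forall>v\<in>{1..n}. \<forall>v'\<in>{1..n}. matching_prob (half_edges_n n)
       (\<lambda>G. edge_count G {v} \<le> m \<and> v' \<notin> reach G {v} \<and> edge_count G {v'} \<le> m) \<le> 1 ^ d n v * 1 ^ d n v'" for m
      by (intro always_eventually) (auto intro: matching_prob_le_1)
  qed (use True assms in auto)
next
  case False
  then obtain K where "1 < (\<Sum>k<K. r k * (real k - 1))" using crit by blast
  from point_near_xi[OF this assms(2)]
  obtain x where x: "xi < x" "x < xi + \<delta>" "x < 1" "gen x < x" by blast
  have "0 < x" using x xi_nonneg by linarith
  obtain \<epsilon> \<rho> \<eta> where \<epsilon>: "0 < \<epsilon>" and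
    dr: "\<forall>\<^sub>F n in sequentially. exploration_drift n (d n) (nat \<lfloor>\<epsilon> * real n\<rfloor>) (nat \<lfloor>\<eta> * real n\<rfloor>) x \<rho>"
    by (rule eventually_drift[OF \<open>0 < x\<close> x(3,4)])
  show ?thesis
  proof (rule that[of x])
    show "\<forall>\<^sub>F n in sequentially. \<forall>v\<in>{1..n}. \<forall>v'\<in>{1..n}. matching_prob (half_edges_n n)
       (\<lambda>G. edge_count G {v} \<le> m \<and> v' \<notin> reach G {v} \<and> edge_count G {v'} \<le> m) \<le> x ^ d n v * x ^ d n v'" for m
      using dr eventually_le_nat_floor[OF \<epsilon>, of "2 * m + 2"]
    proof eventually_elim
      case (elim n)
      show ?case
      proof (intro ballI)
        fix v v' assume v: "v \<in> {1..n}" "v' \<in> {1..n}"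
        show "matching_prob (half_edges_n n)
            (\<lambda>G. edge_count G {v} \<le> m \<and> v' \<notin> reach G {v} \<and> edge_count G {v'} \<le> m)
          \<le> x ^ d n v * x ^ d n v'"
          by (rule exploration_drift.two_small_components_prob[OF elim(1) deg_even v elim(2)])
      qed
    qed
  qed (use x in auto)
qed

section \<open>Concentration of the number of vertices in small components\<close>

text \<open>
The property \<open>E\<close> has probability close to \<open>1\<close> if first \<open>m\<close> is chosen large, then \<open>n\<close>. Here \<open>m\<close> is the
number of edges up to which a component counts as small.
\<close>

definition mostly :: "(nat \<Rightarrow> nat \<Rightarrow> half_edge set set \<Rightarrow> bool) \<Rightarrow> bool" where
  "mostly E \<longleftrightarrow> (\<forall>\<eta>>0. \<forall>\<^sub>F m in sequentially. \<forall>\<^sub>F n in sequentially.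
      matching_prob (half_edges_n n) (\<lambda>G. \<not> E m n G) < \<eta>)"

lemma mostlyD:
  "mostly E \<Longrightarrow> 0 < \<eta> \<Longrightarrow> \<forall>\<^sub>F m in sequentially. \<forall>\<^sub>F n in sequentially.
      matching_prob (half_edges_n n) (\<lambda>G. \<not> E m n G) < \<eta>"
  by (simp add: mostly_def)

lemma mostly_mono:
  assumes "mostly E" "\<And>m n G. 1 \<le> n \<Longrightarrow> G \<in> perfect_matchings (half_edges_n n) \<Longrightarrow> E m n G \<Longrightarrow> E' m n G"
  shows "mostly E'"
  unfolding mostly_def
proof (intro allI impI)
  fix \<eta> :: real assume "0 < \<eta>"
  then have "\<forall>\<^sub>F m in sequentially. \<forall>\<^sub>F n in sequentially.
      matching_prob (half_edges_n n) (\<lambda>G. \<not> E m n G) < \<eta>" using assms(1) by (simp add: mostly_def)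
  then show "\<forall>\<^sub>F m in sequentially. \<forall>\<^sub>F n in sequentially.
      matching_prob (half_edges_n n) (\<lambda>G. \<not> E' m n G) < \<eta>"
  proof eventually_elim
    case (elim m)
    then show ?case using eventually_ge_at_top[of 1]
    proof eventually_elim
      case (elim n)
      have "matching_prob (half_edges_n n) (\<lambda>G. \<not> E' m n G) \<le> matching_prob (half_edges_n n) (\<lambda>G. \<not> E m n G)"
        using assms(2) elim(2) by (intro matching_prob_mono) auto
      then show ?case using elim by simp
    qed
  qed
qed

lemma mostly_eventually:
  assumes "\<And>m. \<forall>\<^sub>F n in sequentially. \<forall>G\<in>perfect_matchings (half_edges_n n). E m n G"
  shows "mostly E"
  unfolding mostly_def
proof (intro allI impI, rule always_eventually, rule allI)
  fix \<eta> :: real and m assume "0 < \<eta>"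
  show "\<forall>\<^sub>F n in sequentially. matching_prob (half_edges_n n) (\<lambda>G. \<not> E m n G) < \<eta>"
    using assms[of m]
  proof eventually_elim
    case (elim n)
    then have "matching_prob (half_edges_n n) (\<lambda>G. \<not> E m n G) = 0" by (intro matching_prob_eq_0) auto
    then show ?case using \<open>0 < \<eta>\<close> by simp
  qed
qed

lemma mostly_conj:
  assumes "mostly E" "mostly E'"
  shows "mostly (\<lambda>m n G. E m n G \<and> E' m n G)"
  unfolding mostly_def
proof (intro allI impI)
  fix \<eta> :: real assume "0 < \<eta>"
  then have "0 < \<eta> / 2" by simp
  from mostlyD[OF assms(1) this] mostlyD[OF assms(2) this]
  show "\<forall>\<^sub>F m in sequentially. \<forall>\<^sub>F n in sequentially.
      matching_prob (half_edges_n n) (\<lambda>G. \<not> (E m n G \<and> E' m n G)) < \<eta>"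
  proof eventually_elim
    case (elim m)
    then show ?case
    proof eventually_elim
      case (elim n)
      have "matching_prob (half_edges_n n) (\<lambda>G. \<not> (E m n G \<and> E' m n G))
          = matching_prob (half_edges_n n) (\<lambda>G. \<not> E m n G \<or> \<not> E' m n G)"
        by (intro matching_prob_cong) auto
      also have "\<dots> \<le> matching_prob (half_edges_n n) (\<lambda>G. \<not> E m n G)
          + matching_prob (half_edges_n n) (\<lambda>G. \<not> E' m n G)"
        by (rule matching_prob_or) simp
      finally show ?case using elim by linarith
    qed
  qed
qed

lemma mostly_ball:
  assumes "finite I" "\<And>i. i \<in> I \<Longrightarrow> mostly (E i)"
  shows "mostly (\<lambda>m n G. \<forall>i\<in>I. E i m n G)"
  using assms
proof (induction I)
  case empty
  show ?case by (rule mostly_eventually) auto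
next
  case (insert i I)
  have "mostly (\<lambda>m n G. E i m n G \<and> (\<forall>i\<in>I. E i m n G))"
    using insert by (intro mostly_conj) auto
  then show ?case by (rule mostly_mono) auto
qed

lemma mostly_many: "0 < \<eta> \<Longrightarrow> mostly (\<lambda>m n G. real c * real m \<le> \<eta> * real n)"
proof (rule mostly_eventually)
  fix m assume \<eta>: "0 < \<eta>"
  show "\<forall>\<^sub>F n in sequentially. \<forall>G\<in>perfect_matchings (half_edges_n n). real c * real m \<le> \<eta> * real n"
    using eventually_le_nat_floor[OF \<eta>, of "c * m"]
  proof eventually_elim
    case (elim n)
    have "0 \<le> \<eta> * real n" using \<eta> by simp
    then have "real (nat \<lfloor>\<eta> * real n\<rfloor>) \<le> \<eta> * real n" by (simp add: of_nat_floor)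
    moreover have "real (c * m) \<le> real (nat \<lfloor>\<eta> * real n\<rfloor>)" using elim by (simp only: of_nat_le_iff)
    ultimately have "real (c * m) \<le> \<eta> * real n" by linarith
    then show ?case by simp
  qed
qed

lemma tendsto_in_prob_if_mostly:
  assumes "\<And>\<eta>. 0 < \<eta> \<Longrightarrow> mostly (\<lambda>m n G. \<bar>X n G - c\<bar> \<le> \<eta>)"
  shows "tendsto_in_prob (\<lambda>n. configuration_model n (d n)) X c"
  unfolding tendsto_in_prob_def
proof (intro allI impI)
  fix \<epsilon> :: real assume \<epsilon>: "0 < \<epsilon>"
  have eq: "\<P>(\<omega> in configuration_model n (d n). \<epsilon> < \<bar>X n \<omega> - c\<bar>)
      = matching_prob (half_edges_n n) (\<lambda>G. \<not> \<bar>X n G - c\<bar> \<le> \<epsilon>)" for n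
  proof -
    have "measure_pmf.prob (configuration_model n (d n)) {G. \<epsilon> < \<bar>X n G - c\<bar>}
        = real (card (perfect_matchings (half_edges_n n) \<inter> {G. \<epsilon> < \<bar>X n G - c\<bar>}))
          / real (card (perfect_matchings (half_edges_n n)))"
      unfolding configuration_model_def using even_card_half_edges
      by (intro measure_pmf_of_set perfect_matchings_nonempty finite_perfect_matchings) auto
    then show ?thesis by (simp add: matching_prob_def Int_def not_le)
  qed
  show "(\<lambda>n. \<P>(\<omega> in configuration_model n (d n). \<epsilon> < \<bar>X n \<omega> - c\<bar>)) \<longlonglongrightarrow> 0"
    unfolding eq
  proof (rule LIMSEQ_I)
    fix e :: real assume "0 < e"
    from mostlyD[OF assms[OF \<epsilon>] this]
    have "\<forall>\<^sub>F n in sequentially. matching_prob (half_edges_n n) (\<lambda>G. \<not> \<bar>X n G - c\<bar> \<le> \<epsilon>) < e"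
      by (auto simp: eventually_sequentially)
    then show "\<exists>no. \<forall>n\<ge>no. norm (matching_prob (half_edges_n n) (\<lambda>G. \<not> \<bar>X n G - c\<bar> \<le> \<epsilon>) - 0) < e"
      by (simp add: eventually_sequentially)
  qed
qed

definition small_vertices :: "nat \<Rightarrow> nat \<Rightarrow> nat \<Rightarrow> half_edge set set \<Rightarrow> nat set" where
  "small_vertices k m n G = {v \<in> {v \<in> {1..n}. d n v = k}. edge_count G {v} \<le> m}"

text \<open>
Pairs of vertices within one small component are few, since such a component has at most \<open>2 * m\<close>
vertices; all other pairs are covered by the bound for two different components.
\<close>

lemma small_vertices_second_moment:
  assumes x: "0 \<le> x" and "\<forall>v\<in>{1..n}. \<forall>v'\<in>{1..n}. matching_prob (half_edges_n n)
       (\<lambda>G. edge_count G {v} \<le> m \<and> v' \<notin> reach G {v} \<and> edge_count G {v'} \<le> m) \<le> x ^ d n v * x ^ d n v'"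
  shows "matching_mean (half_edges_n n) (\<lambda>G. (real (card (small_vertices k m n G)))\<^sup>2)
    \<le> (real (card {v \<in> {1..n}. d n v = k}))\<^sup>2 * x ^ (2 * k) + 2 * real m * real n"
proof -
  let ?S = "{v \<in> {1..n}. d n v = k}" and ?H = "half_edges_n n"
  let ?far = "\<lambda>z G. edge_count G {fst z} \<le> m \<and> snd z \<notin> reach G {fst z} \<and> edge_count G {snd z} \<le> m"
  have "matching_mean ?H (\<lambda>G. (real (card (small_vertices k m n G)))\<^sup>2)
     \<le> matching_mean ?H (\<lambda>G. real (card {z \<in> ?S \<times> ?S. ?far z G}) + 2 * real m * real n)"
  proof (rule matching_mean_mono)
    fix G assume G: "G \<in> perfect_matchings ?H"
    let ?A = "small_vertices k m n G"
    let ?near = "SIGMA v:?A. reach G {v}"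
    have fin: "finite ?A" by (simp add: small_vertices_def)
    have finr: "finite (reach G {v})" if "v \<in> ?A" for v
    proof (rule finite_subset)
      show "reach G {v} \<subseteq> {1..n}"
        using that by (intro reach_subset_vertices[OF G]) (simp add: small_vertices_def)
    qed simp
    have "?A \<times> ?A \<subseteq> {z \<in> ?S \<times> ?S. ?far z G} \<union> ?near"
    proof
      fix z assume "z \<in> ?A \<times> ?A"
      then show "z \<in> {z \<in> ?S \<times> ?S. ?far z G} \<union> ?near"
        by (cases z; cases "snd z \<in> reach G {fst z}") (simp_all add: small_vertices_def)
    qed
    moreover have "finite ({z \<in> ?S \<times> ?S. ?far z G} \<union> ?near)"
      using fin finr by (intro finite_UnI finite_SigmaI) simp_all
    ultimately have "card (?A \<times> ?A) \<le> card ({z \<in> ?S \<times> ?S. ?far z G} \<union> ?near)"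
      by (intro card_mono)
    also have "\<dots> \<le> card {z \<in> ?S \<times> ?S. ?far z G} + card ?near" by (rule card_Un_le)
    also have "card ?near = (\<Sum>v\<in>?A. card (reach G {v}))" using fin finr by simp
    also have "\<dots> \<le> (\<Sum>v\<in>?A. 2 * m)"
    proof (rule sum_mono)
      fix v assume v: "v \<in> ?A"
      then have "card (reach G {v}) \<le> 2 * edge_count G {v}"
        using deg_pos by (intro card_reach_le[OF G]) (auto simp: small_vertices_def)
      then show "card (reach G {v}) \<le> 2 * m" using v by (auto simp: small_vertices_def)
    qed
    also have "\<dots> \<le> 2 * m * n"
    proof -
      have "card ?A \<le> card {1..n}" by (intro card_mono) (auto simp: small_vertices_def)
      then show ?thesis by simp
    qed
    finally have "card ?A * card ?A \<le> card {z \<in> ?S \<times> ?S. ?far z G} + 2 * m * n"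
      by (simp add: card_cartesian_product)
    then have "real (card ?A * card ?A) \<le> real (card {z \<in> ?S \<times> ?S. ?far z G} + 2 * m * n)"
      by (simp only: of_nat_le_iff)
    then show "(real (card ?A))\<^sup>2 \<le> real (card {z \<in> ?S \<times> ?S. ?far z G}) + 2 * real m * real n"
      by (simp add: power2_eq_square)
  qed
  also have "\<dots> = (\<Sum>z\<in>?S \<times> ?S. matching_prob ?H (?far z)) + 2 * real m * real n"
  proof -
    have "matching_mean ?H (\<lambda>G. real (card {z \<in> ?S \<times> ?S. ?far z G}))
        = (\<Sum>z\<in>?S \<times> ?S. matching_prob ?H (?far z))"
      by (rule matching_mean_card) simp_all
    then show ?thesis
      by (simp only: matching_mean_add matching_mean_const even_card_half_edges finite_half_edges)
  qed
  also have "(\<Sum>z\<in>?S \<times> ?S. matching_prob ?H (?far z)) \<le> (\<Sum>z\<in>?S \<times> ?S. x ^ (2 * k))"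
  proof (rule sum_mono)
    fix z assume "z \<in> ?S \<times> ?S"
    then have z: "fst z \<in> {1..n}" "snd z \<in> {1..n}" "d n (fst z) = k" "d n (snd z) = k" by auto
    have "matching_prob ?H (?far z) \<le> x ^ d n (fst z) * x ^ d n (snd z)"
      using bspec[OF bspec[OF assms(2) z(1)] z(2)] .
    then have "matching_prob ?H (?far z) \<le> x ^ k * x ^ k" by (simp only: z(3,4))
    then show "matching_prob ?H (?far z) \<le> x ^ (2 * k)" by (simp add: power_add[symmetric] mult_2)
  qed
  also have "\<dots> = (real (card ?S))\<^sup>2 * x ^ (2 * k)"
    by (simp add: card_cartesian_product power2_eq_square)
  finally show ?thesis by linarith
qed

text \<open>
The mean is at least about \<open>n * p k * xi ^ k\<close> and the second moment at most about the square of
\<open>n * p k * x ^ k\<close>. As \<open>x\<close> is close to \<open>xi\<close>, the mean squared deviation from \<open>n * p k * xi ^ k\<close> is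
small compared with \<open>n\<^sup>2\<close>.
\<close>

lemma small_vertices_concentrated:
  assumes crit: "xi = 1 \<or> (\<exists>K. 1 < (\<Sum>k<K. r k * (real k - 1)))" and \<eta>: "0 < \<eta>"
  shows "mostly (\<lambda>m n G. \<bar>real (card (small_vertices k m n G)) / real n - p k * xi ^ k\<bar> \<le> \<eta>)"
  unfolding mostly_def
proof (intro allI impI)
  fix \<eta>' :: real assume \<eta>': "0 < \<eta>'"
  \<comment> \<open>The limit of the mean squared deviation will be at most \<open>3 * e\<close>.\<close>
  define e where "e = \<eta>\<^sup>2 * \<eta>' / 4"
  have e: "0 < e" using \<eta> \<eta>' by (simp add: e_def)
  have pk: "p k \<le> 1"
    using sum_le_suminf[OF sums_summable[OF p_sums], of "{k}"] p_nonneg p_sums by (simp add: sums_iff)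
  obtain \<delta> where \<delta>: "0 < \<delta>" "\<And>x. xi \<le> x \<Longrightarrow> x < xi + \<delta> \<Longrightarrow> x ^ (2 * k) - xi ^ (2 * k) < e"
    using power_near[OF e, of xi "2 * k"] by blast
  obtain x where x: "xi \<le> x" "x \<le> 1" "x < xi + \<delta>" and
    two: "\<And>m. \<forall>\<^sub>F n in sequentially. \<forall>v\<in>{1..n}. \<forall>v'\<in>{1..n}. matching_prob (half_edges_n n)
       (\<lambda>G. edge_count G {v} \<le> m \<and> v' \<notin> reach G {v} \<and> edge_count G {v'} \<le> m) \<le> x ^ d n v * x ^ d n v'"
    using two_small_components_bound[OF crit \<delta>(1)] by blast
  obtain M where M: "\<And>m. M \<le> m \<Longrightarrow> \<forall>\<^sub>F n in sequentially. \<forall>v\<in>{1..n}. d n v = k \<longrightarrow>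
     xi ^ k - e \<le> matching_prob (half_edges_n n) (\<lambda>G. edge_count G {v} \<le> m)"
    using small_component_lower_xi[OF e, of k] by blast
  define a where "a = p k * xi ^ k"
  have a: "0 \<le> a" using p_nonneg xi_nonneg by (simp add: a_def)
  have x0: "0 \<le> x" using x xi_nonneg by linarith
  show "\<forall>\<^sub>F m in sequentially. \<forall>\<^sub>F n in sequentially. matching_prob (half_edges_n n)
      (\<lambda>G. \<not> \<bar>real (card (small_vertices k m n G)) / real n - p k * xi ^ k\<bar> \<le> \<eta>) < \<eta>'"
    using eventually_ge_at_top[of M]
  proof eventually_elim
    case (elim m)
    let ?N = "\<lambda>n. real (card {v \<in> {1..n}. d n v = k}) / real n"
    let ?f = "\<lambda>n. (?N n)\<^sup>2 * x ^ (2 * k) + 2 * real m * (1 / real n) - 2 * a * (?N n * (xi ^ k - e)) + a\<^sup>2"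
    let ?l = "(p k)\<^sup>2 * x ^ (2 * k) + 2 * real m * 0 - 2 * a * (p k * (xi ^ k - e)) + a\<^sup>2"
    have "?f \<longlonglongrightarrow> ?l" by (intro tendsto_intros count_lim lim_1_over_n)
    moreover have "?l < \<eta>\<^sup>2 * \<eta>'"
    proof -
      have "?l = (p k)\<^sup>2 * (x ^ (2 * k) - xi ^ (2 * k)) + 2 * a * p k * e"
        by (simp add: a_def power_mult_distrib algebra_simps power2_eq_square flip: power_add mult_2)
      also have "\<dots> \<le> 1 * e + 2 * e"
      proof (rule add_mono)
        have "(p k)\<^sup>2 \<le> 1" using pk p_nonneg by (simp add: power_le_one)
        then show "(p k)\<^sup>2 * (x ^ (2 * k) - xi ^ (2 * k)) \<le> 1 * e"
          using \<delta>(2)[OF x(1,3)] e power_mono[OF x(1) xi_nonneg, of "2 * k"] by (intro mult_mono) auto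
        have "a \<le> 1" using pk p_nonneg xi_nonneg xi_le_1 by (auto simp: a_def intro!: mult_le_one power_le_one)
        then have "a * p k \<le> 1" using pk p_nonneg a by (intro mult_le_one) auto
        then have "a * p k * e \<le> 1 * e" using e by (intro mult_right_mono) auto
        then show "2 * a * p k * e \<le> 2 * e" by simp
      qed
      also have "\<dots> < 4 * e" using e by simp
      also have "4 * e = \<eta>\<^sup>2 * \<eta>'" by (simp add: e_def)
      finally show ?thesis .
    qed
    ultimately have "\<forall>\<^sub>F n in sequentially. ?f n < \<eta>\<^sup>2 * \<eta>'" by (rule order_tendstoD(2))
    then show ?case using two[of m] M[OF elim] eventually_gt_at_top[of 0]
    proof eventually_elim
      case (elim n)
      let ?H = "half_edges_n n" and ?Y = "\<lambda>G. real (card (small_vertices k m n G))"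
      have n: "0 < real n" using elim(4) by simp
      have mean1: "real (card {v \<in> {1..n}. d n v = k}) * (xi ^ k - e) \<le> matching_mean ?H ?Y"
      proof -
        have "matching_mean ?H ?Y
            = (\<Sum>v\<in>{v \<in> {1..n}. d n v = k}. matching_prob ?H (\<lambda>G. edge_count G {v} \<le> m))"
          unfolding small_vertices_def by (rule matching_mean_card) auto
        also have "\<dots> \<ge> (\<Sum>v\<in>{v \<in> {1..n}. d n v = k}. xi ^ k - e)"
          using elim(3) by (intro sum_mono) auto
        finally show ?thesis by simp
      qed
      have "matching_mean ?H (\<lambda>G. (?Y G / real n - a)\<^sup>2)
        = matching_mean ?H (\<lambda>G. 1 / (real n)\<^sup>2 * (?Y G)\<^sup>2 + (- (2 * a / real n) * ?Y G + a\<^sup>2))"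
        by (simp add: power2_diff power_divide algebra_simps)
      also have "\<dots> = 1 / (real n)\<^sup>2 * matching_mean ?H (\<lambda>G. (?Y G)\<^sup>2)
          - 2 * a / real n * matching_mean ?H ?Y + a\<^sup>2"
        using even_card_half_edges
        by (simp only: matching_mean_add matching_mean_cmult matching_mean_const finite_half_edges)
      also have "\<dots> \<le> 1 / (real n)\<^sup>2 * ((real (card {v \<in> {1..n}. d n v = k}))\<^sup>2 * x ^ (2 * k) + 2 * real m * real n)
          - 2 * a / real n * (real (card {v \<in> {1..n}. d n v = k}) * (xi ^ k - e)) + a\<^sup>2"
        using mean1 small_vertices_second_moment[OF x0 elim(2)] a
        by (intro add_mono diff_mono mult_left_mono) auto
      also have "\<dots> = ?f n"
        using n by (simp add: power_divide power2_eq_square add_divide_distrib distrib_left)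
      finally have mean: "matching_mean ?H (\<lambda>G. (?Y G / real n - a)\<^sup>2) < \<eta>\<^sup>2 * \<eta>'"
        using elim(1) by linarith
      have "matching_prob ?H (\<lambda>G. \<not> \<bar>?Y G / real n - a\<bar> \<le> \<eta>)
          \<le> matching_mean ?H (\<lambda>G. (?Y G / real n - a)\<^sup>2) / \<eta>\<^sup>2"
      proof (rule matching_markov)
        fix G assume "\<not> \<bar>?Y G / real n - a\<bar> \<le> \<eta>"
        then have "\<bar>\<eta>\<bar> \<le> \<bar>?Y G / real n - a\<bar>" using \<eta> by simp
        then show "\<eta>\<^sup>2 \<le> (?Y G / real n - a)\<^sup>2" by (simp only: abs_le_square_iff)
      qed (use \<eta> in auto)
      also have "\<dots> < \<eta>'" using mean \<eta> by (simp add: pos_divide_less_eq mult.commute)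
      finally show ?case by (simp add: a_def)
    qed
  qed
qed

section \<open>Most pairs of large components coincide\<close>

end

text \<open>
After \<open>\<epsilon> * n\<close> steps the supermartingale has lost the factor \<open>\<rho> powr (\<epsilon> * n)\<close>, which is exponentially smaller
than \<open>x powr (\<kappa> * n)\<close> for small \<open>\<kappa>\<close>: fewer than \<open>\<kappa> * n\<close> active half-edges are exponentially unlikely.
\<close>

lemma growth_vs_drift_lim:
  fixes x \<rho> \<epsilon> :: real
  assumes "0 < x" "x < 1" "0 < \<rho>" "\<rho> < 1" "0 < \<epsilon>"
  obtains \<kappa> where "0 < \<kappa>" "\<kappa> \<le> 1"
    "(\<lambda>n. \<rho> ^ (nat \<lfloor>\<epsilon> * real n\<rfloor> - 1) / x ^ nat \<lfloor>\<kappa> * real n\<rfloor>) \<longlonglongrightarrow> 0"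
proof -
  have ln: "ln x < 0" "ln \<rho> < 0" using assms by auto
  define c where "c = \<epsilon> * ln \<rho> / 2"
  have c: "c < 0" using assms ln by (simp add: c_def mult_pos_neg)
  \<comment> \<open>Half of the decay \<open>\<rho> powr (\<epsilon> * n)\<close> is spent on compensating \<open>x powr (\<kappa> * n)\<close>.\<close>
  define \<kappa> where "\<kappa> = min 1 (c / ln x)"
  have "0 < c / ln x" using ln c by (intro divide_neg_neg) auto
  then have \<kappa>: "0 < \<kappa>" "\<kappa> \<le> 1" "\<kappa> \<le> c / ln x" by (auto simp: \<kappa>_def)
  have \<kappa>x: "c \<le> \<kappa> * ln x"
  proof -
    have "c / ln x * ln x \<le> \<kappa> * ln x" using \<kappa> ln by (intro mult_right_mono_neg) auto
    then show ?thesis using ln by simp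
  qed
  have bound: "\<rho> ^ (nat \<lfloor>\<epsilon> * real n\<rfloor> - 1) / x ^ nat \<lfloor>\<kappa> * real n\<rfloor>
      \<le> exp (- 2 * ln \<rho>) * exp c ^ n" for n
  proof -
    let ?t = "nat \<lfloor>\<epsilon> * real n\<rfloor> - 1" and ?m = "nat \<lfloor>\<kappa> * real n\<rfloor>"
    have t: "\<epsilon> * real n - 2 \<le> real ?t" by linarith
    have "0 \<le> \<kappa> * real n" using \<kappa> by simp
    then have m: "real ?m \<le> \<kappa> * real n" by (simp add: of_nat_floor)
    have "real ?t * ln \<rho> \<le> (\<epsilon> * real n - 2) * ln \<rho>" using t ln by (intro mult_right_mono_neg) auto
    moreover have "(\<epsilon> * real n - 2) * ln \<rho> = 2 * (real n * c) - 2 * ln \<rho>"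
      by (simp add: c_def algebra_simps)
    moreover have "\<kappa> * real n * ln x \<le> real ?m * ln x" using m ln by (intro mult_right_mono_neg) auto
    moreover have "real n * c \<le> \<kappa> * real n * ln x"
      using mult_left_mono[OF \<kappa>x, of "real n"] by (simp add: mult_ac)
    ultimately have "real ?t * ln \<rho> - real ?m * ln x \<le> - 2 * ln \<rho> + real n * c" by linarith
    then have "exp (real ?t * ln \<rho> - real ?m * ln x) \<le> exp (- 2 * ln \<rho> + real n * c)" by simp
    then show ?thesis using assms by (simp only: exp_add exp_diff exp_of_nat_mult exp_ln)
  qed
  have "(\<lambda>n. \<rho> ^ (nat \<lfloor>\<epsilon> * real n\<rfloor> - 1) / x ^ nat \<lfloor>\<kappa> * real n\<rfloor>) \<longlonglongrightarrow> 0"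
  proof (rule tendsto_sandwich[where f = "\<lambda>_. 0" and h = "\<lambda>n. exp (- 2 * ln \<rho>) * exp c ^ n"])
    show "(\<lambda>n. exp (- 2 * ln \<rho>) * exp c ^ n) \<longlonglongrightarrow> 0"
      using c by (intro tendsto_mult_right_zero LIMSEQ_power_zero) simp
  qed (use bound assms in auto)
  then show ?thesis using that \<kappa> by blast
qed

context degree_limit
begin

text \<open>
There are two possibilities. The component of \<open>v\<close> has more than \<open>m\<close> but at most \<open>\<epsilon> * n\<close> edges: the
probability is about \<open>x ^ k - xi ^ k\<close> at most. Or it is larger, and the exploration from \<open>v'\<close> avoids
a positive proportion \<open>\<kappa> / \<mu>\<close> of the half-edges in \<open>m\<close> steps.
\<close>

lemma disconnected_pair_bound:
  assumes super: "1 < (\<Sum>k<K. r k * (real k - 1))" and \<eta>: "0 < \<eta>"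
  shows "\<forall>\<^sub>F m in sequentially. \<forall>\<^sub>F n in sequentially. \<forall>v\<in>{1..n}. d n v = k \<longrightarrow> (\<forall>v'\<in>{1..n}.
      matching_prob (half_edges_n n)
        (\<lambda>G. m < edge_count G {v} \<and> v' \<notin> reach G {v} \<and> m < edge_count G {v'}) \<le> \<eta>)"
proof -
  have \<eta>4: "0 < \<eta> / 4" using \<eta> by simp
  obtain \<delta> where \<delta>: "0 < \<delta>" "\<And>x. xi \<le> x \<Longrightarrow> x < xi + \<delta> \<Longrightarrow> x ^ k - xi ^ k < \<eta> / 4"
    using power_near[OF \<eta>4, of xi k] by blast
  obtain x where x: "xi < x" "x < xi + \<delta>" "x < 1" "gen x < x"
    using point_near_xi[OF super \<delta>(1)] by blast
  have x0: "0 < x" using x xi_nonneg by linarith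
  have xk: "x ^ k - xi ^ k < \<eta> / 4" using \<delta>(2)[OF less_imp_le[OF x(1)] x(2)] .
  obtain \<epsilon> \<rho> \<eta>' where \<epsilon>: "0 < \<epsilon>" and \<rho>: "0 < \<rho>" "\<rho> < 1" and
    dr: "\<forall>\<^sub>F n in sequentially. exploration_drift n (d n) (nat \<lfloor>\<epsilon> * real n\<rfloor>) (nat \<lfloor>\<eta>' * real n\<rfloor>) x \<rho>"
    by (rule eventually_drift[OF x0 x(3,4)])
  obtain \<kappa> where \<kappa>: "0 < \<kappa>" "\<kappa> \<le> 1" and
    lim2: "(\<lambda>n. \<rho> ^ (nat \<lfloor>\<epsilon> * real n\<rfloor> - 1) / x ^ nat \<lfloor>\<kappa> * real n\<rfloor>) \<longlonglongrightarrow> 0"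
    by (rule growth_vs_drift_lim[OF x0 x(3) \<rho> \<epsilon>])
  have q: "0 \<le> 1 - \<kappa> / \<mu>" "1 - \<kappa> / \<mu> < 1" using \<kappa> mu_ge_1 by (auto simp: divide_le_eq_1)
  have lim1: "(\<lambda>n. real (nat \<lfloor>\<kappa> * real n\<rfloor>) / real (card (half_edges_n n))) \<longlonglongrightarrow> \<kappa> / \<mu>"
  proof -
    have fl: "(\<lambda>n. real (nat \<lfloor>\<kappa> * real n\<rfloor>) / real n) \<longlonglongrightarrow> \<kappa>"
    proof (rule tendsto_sandwich)
      show "(\<lambda>n. \<kappa> - 1 / real n) \<longlonglongrightarrow> \<kappa>"
        using tendsto_diff[OF tendsto_const[of \<kappa>] lim_1_over_n] by simp
      show "\<forall>\<^sub>F n in sequentially. \<kappa> - 1 / real n \<le> real (nat \<lfloor>\<kappa> * real n\<rfloor>) / real n"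
        using eventually_gt_at_top[of 0]
      proof eventually_elim
        case (elim n)
        have "\<kappa> * real n - 1 \<le> real (nat \<lfloor>\<kappa> * real n\<rfloor>)" by linarith
        then have "(\<kappa> * real n - 1) / real n \<le> real (nat \<lfloor>\<kappa> * real n\<rfloor>) / real n"
          by (rule divide_right_mono) simp
        then show ?case using elim by (simp add: diff_divide_distrib)
      qed
      show "\<forall>\<^sub>F n in sequentially. real (nat \<lfloor>\<kappa> * real n\<rfloor>) / real n \<le> \<kappa>"
        using eventually_gt_at_top[of 0]
      proof eventually_elim
        case (elim n)
        have "0 \<le> \<kappa> * real n" using \<kappa> by simp
        then have "real (nat \<lfloor>\<kappa> * real n\<rfloor>) \<le> \<kappa> * real n" by (simp add: of_nat_floor)
        then show ?case using elim by (simp add: divide_le_eq)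
      qed
    qed simp
    have "(\<lambda>n. (real (nat \<lfloor>\<kappa> * real n\<rfloor>) / real n) / (real (card (half_edges_n n)) / real n)) \<longlonglongrightarrow> \<kappa> / \<mu>"
      using mu_ge_1 by (intro tendsto_divide fl card_half_edges_lim) auto
    moreover have "\<forall>\<^sub>F n in sequentially. (real (nat \<lfloor>\<kappa> * real n\<rfloor>) / real n) / (real (card (half_edges_n n)) / real n)
        = real (nat \<lfloor>\<kappa> * real n\<rfloor>) / real (card (half_edges_n n))"
      using eventually_gt_at_top[of 0] by eventually_elim simp
    ultimately show ?thesis by (rule Lim_transform_eventually)
  qed
  have "(\<lambda>m. (1 - \<kappa> / \<mu>) ^ m) \<longlonglongrightarrow> 0" using q by (intro LIMSEQ_power_zero) auto
  then have ev: "\<forall>\<^sub>F m in sequentially. (1 - \<kappa> / \<mu>) ^ m < \<eta> / 4" by (rule order_tendstoD(2)[OF _ \<eta>4])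
  obtain M where M: "\<And>m. M \<le> m \<Longrightarrow> \<forall>\<^sub>F n in sequentially. \<forall>v\<in>{1..n}. d n v = k \<longrightarrow>
     xi ^ k - \<eta> / 4 \<le> matching_prob (half_edges_n n) (\<lambda>G. edge_count G {v} \<le> m)"
    using small_component_lower_xi[OF \<eta>4, of k] by blast
  show ?thesis using ev eventually_ge_at_top[of M]
  proof eventually_elim
    case (elim m)
    have "(\<lambda>n. (1 - real (nat \<lfloor>\<kappa> * real n\<rfloor>) / real (card (half_edges_n n))) ^ m) \<longlonglongrightarrow> (1 - \<kappa> / \<mu>) ^ m"
      by (intro tendsto_intros lim1)
    then have e1: "\<forall>\<^sub>F n in sequentially.
        (1 - real (nat \<lfloor>\<kappa> * real n\<rfloor>) / real (card (half_edges_n n))) ^ m < \<eta> / 4"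
      using elim(1) by (rule order_tendstoD(2))
    have e2: "\<forall>\<^sub>F n in sequentially.
        \<rho> ^ (nat \<lfloor>\<epsilon> * real n\<rfloor> - 1) / x ^ nat \<lfloor>\<kappa> * real n\<rfloor> < \<eta> / 4"
      by (rule order_tendstoD(2)[OF lim2 \<eta>4])
    show ?case
      using e1 e2 M[OF elim(2)] dr eventually_le_nat_floor[OF \<epsilon>, of "m + 2"]
    proof (eventually_elim, intro ballI impI)
      fix n v v'
      let ?H = "half_edges_n n" and ?t = "nat \<lfloor>\<epsilon> * real n\<rfloor> - 1" and ?a = "nat \<lfloor>\<kappa> * real n\<rfloor>"
      assume e1: "(1 - real ?a / real (card ?H)) ^ m < \<eta> / 4"
        and e2: "\<rho> ^ ?t / x ^ ?a < \<eta> / 4"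
        and low: "\<forall>v\<in>{1..n}. d n v = k \<longrightarrow> xi ^ k - \<eta> / 4 \<le> matching_prob ?H (\<lambda>G. edge_count G {v} \<le> m)"
        and dr: "exploration_drift n (d n) (nat \<lfloor>\<epsilon> * real n\<rfloor>) (nat \<lfloor>\<eta>' * real n\<rfloor>) x \<rho>"
        and m: "m + 2 \<le> nat \<lfloor>\<epsilon> * real n\<rfloor>"
        and v: "v \<in> {1..n}" "d n v = k" "v' \<in> {1..n}"
      interpret exploration_drift n "d n" "nat \<lfloor>\<epsilon> * real n\<rfloor>" "nat \<lfloor>\<eta>' * real n\<rfloor>" x \<rho> by (rule dr)
      have tT: "?t < nat \<lfloor>\<epsilon> * real n\<rfloor>" "m \<le> ?t" using m by linarith+
      have "\<kappa> * real n \<le> 1 * real n" using \<kappa> by (intro mult_right_mono) auto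
      then have aH: "?a \<le> card ?H" using card_half_edges_ge[of n] by linarith
      have "matching_prob ?H (\<lambda>G. edge_count G {v} \<le> ?t)
          = matching_prob ?H (\<lambda>G. edge_count G {v} \<le> m \<or> (m < edge_count G {v} \<and> edge_count G {v} \<le> ?t))"
        using tT(2) by (intro matching_prob_cong) auto
      also have "\<dots> = matching_prob ?H (\<lambda>G. edge_count G {v} \<le> m)
          + matching_prob ?H (\<lambda>G. m < edge_count G {v} \<and> edge_count G {v} \<le> ?t)"
        by (rule matching_prob_disjoint_or) auto
      finally have "matching_prob ?H (\<lambda>G. m < edge_count G {v} \<and> edge_count G {v} \<le> ?t)
          \<le> x ^ k - (xi ^ k - \<eta> / 4)"
        using small_component_prob[OF deg_even v(1) tT(1)] low v by fastforce
      also have "\<dots> < \<eta> / 4 + \<eta> / 4"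
        using xk by linarith
      finally have mid: "matching_prob ?H (\<lambda>G. m < edge_count G {v} \<and> edge_count G {v} \<le> ?t) < \<eta> / 2"
        by simp
      have "matching_prob ?H (\<lambda>G. m < edge_count G {v} \<and> v' \<notin> reach G {v} \<and> m < edge_count G {v'})
        \<le> matching_prob ?H (\<lambda>G. (m < edge_count G {v} \<and> edge_count G {v} \<le> ?t)
            \<or> (?t \<le> edge_count G {v} \<and> v' \<notin> reach G {v} \<and> m \<le> edge_count G {v'}))"
        by (intro matching_prob_mono) auto
      also have "\<dots> \<le> matching_prob ?H (\<lambda>G. m < edge_count G {v} \<and> edge_count G {v} \<le> ?t)
          + matching_prob ?H (\<lambda>G. ?t \<le> edge_count G {v} \<and> v' \<notin> reach G {v} \<and> m \<le> edge_count G {v'})"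
        by (rule matching_prob_or) simp
      also have "matching_prob ?H (\<lambda>G. ?t \<le> edge_count G {v} \<and> v' \<notin> reach G {v} \<and> m \<le> edge_count G {v'})
          \<le> (1 - real ?a / real (card ?H)) ^ m + \<rho> ^ ?t * (x ^ d n v / x ^ ?a)"
        by (rule disconnected_large_components_prob[OF deg_even v(1,3) tT(1) aH])
      also have "\<rho> ^ ?t * (x ^ d n v / x ^ ?a) \<le> \<rho> ^ ?t * (1 / x ^ ?a)"
        using x \<rho> by (intro mult_left_mono divide_right_mono) (auto simp: power_le_one)
      also have "\<rho> ^ ?t * (1 / x ^ ?a) = \<rho> ^ ?t / x ^ ?a" by simp
      finally show "matching_prob ?H
          (\<lambda>G. m < edge_count G {v} \<and> v' \<notin> reach G {v} \<and> m < edge_count G {v'}) \<le> \<eta>"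
        using e1 e2 mid by linarith
    qed
  qed
qed

definition large_vertices :: "nat \<Rightarrow> nat \<Rightarrow> half_edge set set \<Rightarrow> nat set" where
  "large_vertices m n G = {v \<in> {1..n}. m < edge_count G {v}}"

definition far_pairs :: "nat \<Rightarrow> nat \<Rightarrow> half_edge set set \<Rightarrow> (nat \<times> nat) set" where
  "far_pairs m n G = {z \<in> {1..n} \<times> {1..n}.
     m < edge_count G {fst z} \<and> snd z \<notin> reach G {fst z} \<and> m < edge_count G {snd z}}"

lemma few_far_pairs:
  assumes super: "1 < (\<Sum>k<K. r k * (real k - 1))" and \<eta>: "0 < \<eta>"
  shows "mostly (\<lambda>m n G. real (card (far_pairs m n G)) \<le> \<eta> * (real n)\<^sup>2)"
  unfolding mostly_def
proof (intro allI impI)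
  fix \<eta>' :: real assume \<eta>': "0 < \<eta>'"
  define e where "e = \<eta> * \<eta>' / 4"
  have e: "0 < e" using \<eta> \<eta>' by (simp add: e_def)
  obtain N where N: "\<forall>\<^sub>F n in sequentially. (\<Sum>v | v \<in> {1..n} \<and> N \<le> d n v. real (d n v)) \<le> e * real n"
    by (rule tail_small[OF e])
  have "\<forall>\<^sub>F m in sequentially. \<forall>k\<in>{..<N}. \<forall>\<^sub>F n in sequentially. \<forall>v\<in>{1..n}. d n v = k \<longrightarrow> (\<forall>v'\<in>{1..n}.
      matching_prob (half_edges_n n)
        (\<lambda>G. m < edge_count G {v} \<and> v' \<notin> reach G {v} \<and> m < edge_count G {v'}) \<le> e)"
    by (intro eventually_ball_finite ballI disconnected_pair_bound[OF super e]) simp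
  then show "\<forall>\<^sub>F m in sequentially. \<forall>\<^sub>F n in sequentially.
      matching_prob (half_edges_n n) (\<lambda>G. \<not> real (card (far_pairs m n G)) \<le> \<eta> * (real n)\<^sup>2) < \<eta>'"
  proof eventually_elim
    case (elim m)
    then have "\<forall>\<^sub>F n in sequentially. \<forall>k\<in>{..<N}. \<forall>v\<in>{1..n}. d n v = k \<longrightarrow> (\<forall>v'\<in>{1..n}.
      matching_prob (half_edges_n n)
        (\<lambda>G. m < edge_count G {v} \<and> v' \<notin> reach G {v} \<and> m < edge_count G {v'}) \<le> e)"
      by (intro eventually_ball_finite) auto
    then show ?case using N eventually_gt_at_top[of 0]
    proof eventually_elim
      case (elim n)
      let ?H = "half_edges_n n"
      let ?P = "\<lambda>v v'. matching_prob ?H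
        (\<lambda>G. m < edge_count G {v} \<and> v' \<notin> reach G {v} \<and> m < edge_count G {v'})"
      \<comment> \<open>Degrees from \<open>N\<close> on are handled by their small total, using that each is at least \<open>1\<close>.\<close>
      have le: "?P v v' \<le> e + (if N \<le> d n v then real (d n v) else 0)"
        if v: "v \<in> {1..n}" "v' \<in> {1..n}" for v v'
      proof (cases "N \<le> d n v")
        case True
        have "?P v v' \<le> 1" by (rule matching_prob_le_1) simp
        then show ?thesis using True deg_pos[OF v(1)] e by simp
      next
        case False
        then have "d n v \<in> {..<N}" by simp
        then have "?P v v' \<le> e" using elim(1) v by blast
        then show ?thesis using False by simp
      qed
      have "matching_mean ?H (\<lambda>G. real (card (far_pairs m n G)))
          = (\<Sum>z\<in>{1..n} \<times> {1..n}. ?P (fst z) (snd z))"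
        unfolding far_pairs_def by (rule matching_mean_card) auto
      also have "\<dots> \<le> (\<Sum>z\<in>{1..n} \<times> {1..n}. e + (if N \<le> d n (fst z) then real (d n (fst z)) else 0))"
        by (intro sum_mono le) auto
      also have "\<dots> = (\<Sum>v\<in>{1..n}. \<Sum>v'\<in>{1..n}. e + (if N \<le> d n v then real (d n v) else 0))"
        by (subst sum.cartesian_product) (simp add: case_prod_beta)
      also have "\<dots> = real n * (real n * e) + real n * (\<Sum>v\<in>{1..n}. if N \<le> d n v then real (d n v) else 0)"
        by (simp add: sum.distrib distrib_left sum_distrib_left)
      also have "(\<Sum>v\<in>{1..n}. if N \<le> d n v then real (d n v) else 0)
          = (\<Sum>v | v \<in> {1..n} \<and> N \<le> d n v. real (d n v))"
        by (rule sum.inter_filter[symmetric]) auto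
      also have "real n * (real n * e) + real n * (\<Sum>v | v \<in> {1..n} \<and> N \<le> d n v. real (d n v))
          \<le> real n * (real n * e) + real n * (e * real n)"
        using elim(2) by (intro add_left_mono mult_left_mono) auto
      also have "\<dots> = 2 * e * (real n)\<^sup>2" by (simp add: power2_eq_square)
      finally have mean: "matching_mean ?H (\<lambda>G. real (card (far_pairs m n G))) \<le> 2 * e * (real n)\<^sup>2" .
      have pos: "0 < \<eta> * (real n)\<^sup>2" using \<eta> elim(3) by simp
      have "matching_prob ?H (\<lambda>G. \<not> real (card (far_pairs m n G)) \<le> \<eta> * (real n)\<^sup>2)
          \<le> matching_mean ?H (\<lambda>G. real (card (far_pairs m n G))) / (\<eta> * (real n)\<^sup>2)"
        by (rule matching_markov) (use pos in auto)
      also have "\<dots> \<le> 2 * e * (real n)\<^sup>2 / (\<eta> * (real n)\<^sup>2)"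
        using mean pos by (intro divide_right_mono) auto
      also have "\<dots> = \<eta>' / 2" using \<eta> elim(3) by (simp add: e_def)
      finally show ?case using \<eta>' by simp
    qed
  qed
qed

section \<open>Vertices in large components\<close>

text \<open>
Convergence of the counts for each single degree implies convergence of weighted sums over all degrees, by
uniform integrability. It serves for numbers of vertices, with \<open>f = 1\<close>, and for numbers of half-edges,
with \<open>f k = k\<close>.
\<close>

lemma weighted_count_concentrated:
  fixes f q :: "nat \<Rightarrow> real" and C :: "nat \<Rightarrow> nat \<Rightarrow> half_edge set set \<Rightarrow> nat set"
  assumes C: "\<And>m n G. 1 \<le> n \<Longrightarrow> G \<in> perfect_matchings (half_edges_n n) \<Longrightarrow> C m n G \<subseteq> {1..n}"
    and q: "\<And>k. 0 \<le> q k" "\<And>k. q k \<le> p k"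
    and f: "\<And>k. 1 \<le> k \<Longrightarrow> 0 \<le> f k" "\<And>k. 1 \<le> k \<Longrightarrow> f k \<le> real k"
    and lim: "\<And>k \<eta>. 0 < \<eta> \<Longrightarrow>
      mostly (\<lambda>m n G. \<bar>real (card {v \<in> C m n G. d n v = k}) / real n - q k\<bar> \<le> \<eta>)"
    and \<eta>: "0 < \<eta>"
  shows "mostly (\<lambda>m n G. \<bar>(\<Sum>v\<in>C m n G. f (d n v)) / real n - (\<Sum>k. f k * q k)\<bar> \<le> \<eta>)"
proof -
  have q0: "q 0 = 0" using q[of 0] p_0 by simp
  have fq: "0 \<le> f k * q k" "f k * q k \<le> real k * p k" for k
  proof -
    show "0 \<le> f k * q k" using f(1)[of k] q(1)[of k] q0 by (cases k) auto
    show "f k * q k \<le> real k * p k"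
      using f[of k] q[of k] q0 by (cases k) (auto intro!: mult_mono)
  qed
  have sm: "summable (\<lambda>k. f k * q k)"
    using fq by (intro summable_comparison_test'[OF sums_summable[OF mean_sums]]) auto
  have e: "0 < \<eta> / 3" using \<eta> by simp
  obtain N1 where N1: "\<forall>\<^sub>F n in sequentially.
      (\<Sum>v | v \<in> {1..n} \<and> N1 \<le> d n v. real (d n v)) \<le> \<eta> / 3 * real n"
    by (rule tail_small[OF e])
  have "\<forall>\<^sub>F N in sequentially. (\<Sum>k. f k * q k) - \<eta> / 3 < (\<Sum>k<N. f k * q k)"
    using e by (intro order_tendstoD(1)[OF summable_LIMSEQ[OF sm]]) simp
  then obtain N2 where N2: "\<And>N. N2 \<le> N \<Longrightarrow> (\<Sum>k. f k * q k) - \<eta> / 3 < (\<Sum>k<N. f k * q k)"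
    by (auto simp: eventually_sequentially)
  define N where "N = max N1 N2"
  \<comment> \<open>A positive bound for the total weight of the degrees below \<open>N\<close>.\<close>
  define b where "b = 1 + (\<Sum>k<N. \<bar>f k\<bar>)"
  have b: "0 < b" by (simp add: b_def add_pos_nonneg sum_nonneg)
  have tail_N: "\<forall>\<^sub>F n in sequentially. \<forall>G\<in>perfect_matchings (half_edges_n n).
      (\<Sum>v | v \<in> {1..n} \<and> N \<le> d n v. real (d n v)) \<le> \<eta> / 3 * real n \<and> 0 < n"
    using N1 eventually_gt_at_top[of 0]
  proof eventually_elim
    case (elim n)
    have "(\<Sum>v | v \<in> {1..n} \<and> N \<le> d n v. real (d n v)) \<le> (\<Sum>v | v \<in> {1..n} \<and> N1 \<le> d n v. real (d n v))"
      by (intro sum_mono2) (auto simp: N_def)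
    then show ?case using elim by simp
  qed
  have "mostly (\<lambda>m n G. (\<forall>k\<in>{..<N}. \<bar>real (card {v \<in> C m n G. d n v = k}) / real n - q k\<bar> \<le> \<eta> / 3 / b)
      \<and> ((\<Sum>v | v \<in> {1..n} \<and> N \<le> d n v. real (d n v)) \<le> \<eta> / 3 * real n \<and> 0 < n))"
    using e b by (intro mostly_conj mostly_ball lim mostly_eventually tail_N) auto
  then show ?thesis
  proof (rule mostly_mono)
    fix m n G assume n: "1 \<le> n" and G: "G \<in> perfect_matchings (half_edges_n n)"
      and E: "(\<forall>k\<in>{..<N}. \<bar>real (card {v \<in> C m n G. d n v = k}) / real n - q k\<bar> \<le> \<eta> / 3 / b)
      \<and> ((\<Sum>v | v \<in> {1..n} \<and> N \<le> d n v. real (d n v)) \<le> \<eta> / 3 * real n \<and> 0 < n)"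
    let ?C = "C m n G"
    have sub: "?C \<subseteq> {1..n}" by (rule C[OF n G])
    then have fin: "finite ?C" by (rule finite_subset) simp
    have pos: "1 \<le> d n v" if "v \<in> ?C" for v using that sub deg_pos by blast
    have "(\<Sum>v\<in>?C. f (d n v)) = (\<Sum>v | v \<in> ?C \<and> d n v < N. f (d n v)) + (\<Sum>v | v \<in> ?C \<and> N \<le> d n v. f (d n v))"
      using fin by (subst sum.union_disjoint[symmetric]) (auto intro!: sum.cong)
    also have "(\<Sum>v | v \<in> ?C \<and> d n v < N. f (d n v)) = (\<Sum>k<N. \<Sum>v | v \<in> {v. v \<in> ?C \<and> d n v < N} \<and> d n v = k. f (d n v))"
      using fin by (intro sum.group[symmetric]) auto
    also have "\<dots> = (\<Sum>k<N. f k * real (card {v \<in> ?C. d n v = k}))"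
    proof (rule sum.cong[OF refl])
      fix k assume "k \<in> {..<N}"
      then have "{v. v \<in> {v. v \<in> ?C \<and> d n v < N} \<and> d n v = k} = {v \<in> ?C. d n v = k}" by auto
      then show "(\<Sum>v | v \<in> {v. v \<in> ?C \<and> d n v < N} \<and> d n v = k. f (d n v))
          = f k * real (card {v \<in> ?C. d n v = k})" by simp
    qed
    finally have split: "(\<Sum>v\<in>?C. f (d n v)) / real n
      = (\<Sum>k<N. f k * (real (card {v \<in> ?C. d n v = k}) / real n))
        + (\<Sum>v | v \<in> ?C \<and> N \<le> d n v. f (d n v)) / real n"
      by (simp add: add_divide_distrib sum_divide_distrib)
    have "\<bar>(\<Sum>k<N. f k * (real (card {v \<in> ?C. d n v = k}) / real n)) - (\<Sum>k<N. f k * q k)\<bar>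
        = \<bar>\<Sum>k<N. f k * (real (card {v \<in> ?C. d n v = k}) / real n - q k)\<bar>"
      by (simp only: right_diff_distrib sum_subtractf)
    also have "\<dots> \<le> (\<Sum>k<N. \<bar>f k\<bar> * \<bar>real (card {v \<in> ?C. d n v = k}) / real n - q k\<bar>)"
      by (rule order_trans[OF sum_abs]) (simp add: abs_mult)
    also have "\<dots> \<le> (\<Sum>k<N. \<bar>f k\<bar> * (\<eta> / 3 / b))"
      using E by (intro sum_mono mult_left_mono) auto
    also have "\<dots> = (\<Sum>k<N. \<bar>f k\<bar>) * (\<eta> / 3 / b)" by (simp only: sum_distrib_right)
    also have "\<dots> \<le> b * (\<eta> / 3 / b)" using e b by (intro mult_right_mono) (auto simp: b_def)
    also have "\<dots> = \<eta> / 3" using b by simp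
    finally have A: "\<bar>(\<Sum>k<N. f k * (real (card {v \<in> ?C. d n v = k}) / real n)) - (\<Sum>k<N. f k * q k)\<bar> \<le> \<eta> / 3" .
    have B: "0 \<le> (\<Sum>v | v \<in> ?C \<and> N \<le> d n v. f (d n v)) / real n"
      using f(1) pos by (intro divide_nonneg_nonneg sum_nonneg) auto
    have "(\<Sum>v | v \<in> ?C \<and> N \<le> d n v. f (d n v)) \<le> (\<Sum>v | v \<in> ?C \<and> N \<le> d n v. real (d n v))"
      using f(2) pos by (intro sum_mono) auto
    also have "\<dots> \<le> (\<Sum>v | v \<in> {1..n} \<and> N \<le> d n v. real (d n v))"
      using sub by (intro sum_mono2) auto
    also have "\<dots> \<le> \<eta> / 3 * real n" using E by simp
    finally have B': "(\<Sum>v | v \<in> ?C \<and> N \<le> d n v. f (d n v)) / real n \<le> \<eta> / 3"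
      using n by (simp add: pos_divide_le_eq)
    have S: "(\<Sum>k<N. f k * q k) \<le> (\<Sum>k. f k * q k)"
      using fq sm by (intro sum_le_suminf) auto
    have S': "(\<Sum>k. f k * q k) - \<eta> / 3 < (\<Sum>k<N. f k * q k)" by (rule N2) (simp add: N_def)
    show "\<bar>(\<Sum>v\<in>?C. f (d n v)) / real n - (\<Sum>k. f k * q k)\<bar> \<le> \<eta>"
      using A B B' S S' unfolding split by linarith
  qed
qed

lemma p_xi: "0 \<le> p k * (1 - xi ^ k)" "p k * (1 - xi ^ k) \<le> p k"
  using p_nonneg[of k] xi_nonneg xi_le_1
  by (auto intro!: mult_nonneg_nonneg mult_left_le simp: power_le_one)

text \<open>
The survival probability when the initial number of active half-edges has the distribution \<open>p\<close>.
\<close>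

definition zeta :: real where
  "zeta = (\<Sum>k. p k * (1 - xi ^ k))"

lemma large_component_subset:
  assumes G: "G \<in> perfect_matchings (half_edges_n n)" and C: "C \<in> components n G"
    and large: "2 * m < card C"
  shows "C \<subseteq> large_vertices m n G"
proof
  fix u assume u: "u \<in> C"
  have "u \<in> {1..n}" using component_subset[OF G C] u by blast
  moreover have "card C \<le> 2 * edge_count G {u}"
    using card_reach_le[OF G \<open>u \<in> {1..n}\<close> deg_pos] component_reach[OF C u] by simp
  ultimately show "u \<in> large_vertices m n G" using large by (simp add: large_vertices_def)
qed

lemma degree_counts:
  assumes crit: "xi = 1 \<or> (\<exists>K. 1 < (\<Sum>k<K. r k * (real k - 1)))" and \<eta>: "0 < \<eta>"
  shows "mostly (\<lambda>m n G.
    \<bar>real (card {v \<in> large_vertices m n G. d n v = k}) / real n - p k * (1 - xi ^ k)\<bar> \<le> \<eta>)"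
proof -
  have "\<forall>\<^sub>F n in sequentially. dist (real (card {v \<in> {1..n}. d n v = k}) / real n) (p k) < \<eta> / 2"
    using \<eta> by (intro tendstoD[OF count_lim]) simp
  then have "mostly (\<lambda>m n G. \<bar>real (card {v \<in> {1..n}. d n v = k}) / real n - p k\<bar> \<le> \<eta> / 2)"
    by (intro mostly_eventually) (auto elim!: eventually_mono simp: dist_real_def)
  moreover have "mostly (\<lambda>m n G. \<bar>real (card (small_vertices k m n G)) / real n - p k * xi ^ k\<bar> \<le> \<eta> / 2)"
    using \<eta> by (intro small_vertices_concentrated[OF crit]) simp
  ultimately show ?thesis
  proof (rule mostly_mono[OF mostly_conj])
    fix m n G
    assume "\<bar>real (card {v \<in> {1..n}. d n v = k}) / real n - p k\<bar> \<le> \<eta> / 2 \<and>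
      \<bar>real (card (small_vertices k m n G)) / real n - p k * xi ^ k\<bar> \<le> \<eta> / 2"
    moreover have "card {v \<in> {1..n}. d n v = k}
        = card (small_vertices k m n G) + card {v \<in> large_vertices m n G. d n v = k}"
    proof -
      have "{v \<in> {1..n}. d n v = k} = small_vertices k m n G \<union> {v \<in> large_vertices m n G. d n v = k}"
        by (auto simp: small_vertices_def large_vertices_def)
      moreover have "card (small_vertices k m n G \<union> {v \<in> large_vertices m n G. d n v = k})
          = card (small_vertices k m n G) + card {v \<in> large_vertices m n G. d n v = k}"
        by (intro card_Un_disjoint) (auto simp: small_vertices_def large_vertices_def)
      ultimately show ?thesis by simp
    qed
    then have "real (card {v \<in> large_vertices m n G. d n v = k}) / real n
        = real (card {v \<in> {1..n}. d n v = k}) / real n - real (card (small_vertices k m n G)) / real n"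
      by (simp add: add_divide_distrib)
    moreover have "p k * (1 - xi ^ k) = p k - p k * xi ^ k" by (simp add: right_diff_distrib)
    ultimately show "\<bar>real (card {v \<in> large_vertices m n G. d n v = k}) / real n - p k * (1 - xi ^ k)\<bar> \<le> \<eta>"
      unfolding abs_le_iff by linarith
  qed
qed

lemma large_vertices_concentrated:
  assumes crit: "xi = 1 \<or> (\<exists>K. 1 < (\<Sum>k<K. r k * (real k - 1)))" and \<eta>: "0 < \<eta>"
  shows "mostly (\<lambda>m n G. \<bar>real (card (large_vertices m n G)) / real n - zeta\<bar> \<le> \<eta>)"
proof -
  have "mostly (\<lambda>m n G. \<bar>(\<Sum>v\<in>large_vertices m n G. 1) / real n - (\<Sum>k. 1 * (p k * (1 - xi ^ k)))\<bar> \<le> \<eta>)"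
  proof (rule weighted_count_concentrated[where f = "\<lambda>_. 1"])
    show "large_vertices m n G \<subseteq> {1..n}" for m n G by (auto simp: large_vertices_def)
  qed (use degree_counts[OF crit] p_xi \<eta> in simp_all)
  then show ?thesis by (simp add: zeta_def)
qed

text \<open>
A component with few vertices has few half-edges, because the degrees are uniformly integrable.
\<close>

lemma edges_negligible:
  assumes C: "\<And>n G. 1 \<le> n \<Longrightarrow> G \<in> perfect_matchings (half_edges_n n) \<Longrightarrow> C n G = {} \<or> C n G \<in> components n G"
    and small: "\<And>\<eta>. 0 < \<eta> \<Longrightarrow> mostly (\<lambda>m n G. \<bar>real (card (C n G)) / real n - 0\<bar> \<le> \<eta>)"
    and \<eta>: "0 < \<eta>"
  shows "mostly (\<lambda>m n G. \<bar>real (card (edges_in G (C n G))) / real n - 0\<bar> \<le> \<eta>)"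
proof -
  obtain \<epsilon> where \<epsilon>: "0 < \<epsilon>" and
    ev: "\<forall>\<^sub>F n in sequentially. \<forall>W :: nat set. finite W \<longrightarrow> real (card W) \<le> \<epsilon> * real n \<longrightarrow>
     real (card (active (half_edges_n n) W)) \<le> \<eta> * real n"
    by (rule few_vertices_few_half_edges[OF \<eta>])
  have "mostly (\<lambda>m n G. \<forall>W :: nat set. finite W \<longrightarrow> real (card W) \<le> \<epsilon> * real n \<longrightarrow>
     real (card (active (half_edges_n n) W)) \<le> \<eta> * real n)"
    using ev by (intro mostly_eventually) (auto elim: eventually_mono)
  then show ?thesis
  proof (rule mostly_mono[OF mostly_conj[OF _ small[OF \<epsilon>]]])
    fix m n G assume n: "1 \<le> n" and G: "G \<in> perfect_matchings (half_edges_n n)"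
      and E: "(\<forall>W :: nat set. finite W \<longrightarrow> real (card W) \<le> \<epsilon> * real n \<longrightarrow>
        real (card (active (half_edges_n n) W)) \<le> \<eta> * real n) \<and>
        \<bar>real (card (C n G)) / real n - 0\<bar> \<le> \<epsilon>"
    have "2 * real (card (edges_in G (C n G))) \<le> \<eta> * real n"
    proof (cases "C n G = {}")
      case True
      have "e \<in> G \<Longrightarrow> endpoints e \<noteq> {}" for e
        using G by (auto simp: endpoints_def perfect_matchings_def partition_on_def)
      then have "edges_in G {} = {}" by (auto simp: edges_in_def)
      then show ?thesis using True \<eta> by simp
    next
      case False
      then have comp: "C n G \<in> components n G" using C[OF n G] by blast
      have sub: "C n G \<subseteq> {1..n}" by (rule component_subset[OF G comp])
      then have fin: "finite (C n G)" by (rule finite_subset) simp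
      have "real (card (C n G)) \<le> \<epsilon> * real n" using E n by (simp add: pos_divide_le_eq)
      then have act: "real (card (active (half_edges_n n) (C n G))) \<le> \<eta> * real n" using E fin by blast
      have "{v. v \<in> {1..n} \<and> v \<in> C n G} = C n G" using sub by blast
      then have "2 * card (edges_in G (C n G)) = card (active (half_edges_n n) (C n G))"
        using component_edges[OF G comp] by (simp add: card_active_half_edges)
      then have "2 * real (card (edges_in G (C n G))) = real (card (active (half_edges_n n) (C n G)))"
        by linarith
      then show ?thesis using act by simp
    qed
    then have "real (card (edges_in G (C n G))) / real n \<le> \<eta>"
      using n by (simp add: pos_divide_le_eq)
    then show "\<bar>real (card (edges_in G (C n G))) / real n - 0\<bar> \<le> \<eta>" by simp
  qed
qed

section \<open>The largest and the second largest component\<close>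

context
  fixes Cmax Csec :: "nat \<Rightarrow> half_edge set set \<Rightarrow> nat set"
  assumes Cmax: "\<And>n G. 1 \<le> n \<Longrightarrow> G \<in> perfect_matchings (half_edges_n n) \<Longrightarrow> largest_component n G (Cmax n G)"
    and Csec: "\<And>n G. 1 \<le> n \<Longrightarrow> G \<in> perfect_matchings (half_edges_n n) \<Longrightarrow>
      second_largest_component n G (Cmax n G) (Csec n G)"
begin

lemma Cmax_component: "1 \<le> n \<Longrightarrow> G \<in> perfect_matchings (half_edges_n n) \<Longrightarrow> Cmax n G \<in> components n G"
  using Cmax by (simp add: largest_component_def)

lemma no_giant:
  assumes "xi = 1" "0 < \<eta>"
  shows "mostly (\<lambda>m n G. \<bar>real (card (Cmax n G)) / real n - 0\<bar> \<le> \<eta>)"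
proof -
  have "zeta = 0" using assms(1) by (simp add: zeta_def)
  then have "mostly (\<lambda>m n G. \<bar>real (card (large_vertices m n G)) / real n\<bar> \<le> \<eta>)"
    using large_vertices_concentrated[of \<eta>] assms by simp
  then show ?thesis
  proof (rule mostly_mono[OF mostly_conj[OF _ mostly_many[OF assms(2), of 2]]])
    fix m n G assume n: "1 \<le> n" and G: "G \<in> perfect_matchings (half_edges_n n)"
      and E: "\<bar>real (card (large_vertices m n G)) / real n\<bar> \<le> \<eta> \<and> real 2 * real m \<le> \<eta> * real n"
    have "real (card (Cmax n G)) \<le> \<eta> * real n"
    proof (cases "2 * m < card (Cmax n G)")
      case True
      then have "Cmax n G \<subseteq> large_vertices m n G"
        by (rule large_component_subset[OF G Cmax_component[OF n G]])
      then have "card (Cmax n G) \<le> card (large_vertices m n G)"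
        by (intro card_mono) (auto simp: large_vertices_def)
      moreover have "real (card (large_vertices m n G)) \<le> \<eta> * real n"
        using E n by (simp add: pos_divide_le_eq)
      ultimately show ?thesis by linarith
    next
      case False
      then show ?thesis using E by simp
    qed
    then show "\<bar>real (card (Cmax n G)) / real n - 0\<bar> \<le> \<eta>" using n by (simp add: pos_divide_le_eq)
  qed
qed

text \<open>
Ordered pairs of large vertices are far apart or lie in a common component, and no component is larger than
\<open>Cmax n G\<close>.
\<close>

lemma large_squared_le:
  assumes n: "1 \<le> n" and G: "G \<in> perfect_matchings (half_edges_n n)"
  shows "card (large_vertices m n G) * card (large_vertices m n G)
    \<le> card (far_pairs m n G) + card (large_vertices m n G) * card (Cmax n G)"
proof -
  let ?Z = "large_vertices m n G"
  let ?near = "SIGMA v:?Z. reach G {v}"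
  have fin: "finite ?Z" "finite (far_pairs m n G)" by (simp_all add: large_vertices_def far_pairs_def)
  have comp: "reach G {v} \<in> components n G" if "v \<in> ?Z" for v
    using that by (intro reach_component) (simp add: large_vertices_def)
  have finr: "finite (reach G {v})" if "v \<in> ?Z" for v
    by (rule finite_subset[OF component_subset[OF G comp[OF that]]]) simp
  have "?Z \<times> ?Z \<subseteq> far_pairs m n G \<union> ?near"
  proof
    fix z assume "z \<in> ?Z \<times> ?Z"
    then show "z \<in> far_pairs m n G \<union> ?near"
      by (cases z; cases "snd z \<in> reach G {fst z}") (simp_all add: large_vertices_def far_pairs_def)
  qed
  moreover have "finite (far_pairs m n G \<union> ?near)"
    using fin finr by (intro finite_UnI finite_SigmaI) simp_all
  ultimately have "card (?Z \<times> ?Z) \<le> card (far_pairs m n G \<union> ?near)" by (intro card_mono)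
  also have "\<dots> \<le> card (far_pairs m n G) + card ?near" by (rule card_Un_le)
  also have "card ?near = (\<Sum>v\<in>?Z. card (reach G {v}))" using fin finr by simp
  also have "\<dots> \<le> (\<Sum>v\<in>?Z. card (Cmax n G))"
    using comp Cmax[OF n G] by (intro sum_mono) (simp add: largest_component_def)
  finally show ?thesis by (simp add: card_cartesian_product)
qed

context
  fixes K assumes super: "1 < (\<Sum>k<K. r k * (real k - 1))"
begin

lemma zeta_bounds: "0 < zeta" "zeta \<le> 1"
proof -
  note xi1 = xi_less_1[OF super]
  have sm: "summable (\<lambda>k. p k * (1 - xi ^ k))"
    using p_xi by (intro summable_comparison_test'[OF sums_summable[OF p_sums]]) auto
  have "zeta \<le> (\<Sum>k. p k)"
    unfolding zeta_def using p_xi by (intro suminf_le sm sums_summable[OF p_sums]) auto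
  then show "zeta \<le> 1" using p_sums by (simp add: sums_iff)
  have "(\<Sum>k. (1 - xi) * p k) \<le> zeta"
    unfolding zeta_def
  proof (intro suminf_le sm summable_mult sums_summable[OF p_sums])
    fix k
    show "(1 - xi) * p k \<le> p k * (1 - xi ^ k)"
    proof (cases k)
      case (Suc j)
      have "xi ^ k \<le> xi" using Suc xi_nonneg xi_le_1 by (simp add: mult_left_le power_le_one)
      then show ?thesis using p_nonneg[of k] by (simp add: mult.commute mult_left_mono)
    qed (simp add: p_0)
  qed
  moreover have "(\<Sum>k. (1 - xi) * p k) = 1 - xi"
    using p_sums by (simp add: sums_iff suminf_mult)
  ultimately show "0 < zeta" using xi1 by simp
qed

text \<open>
If \<open>Z\<close> vertices are large and \<open>Q\<close> pairs of them are disconnected, then the largest component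
has at least \<open>Z - Q / Z\<close> vertices. Here \<open>Q\<close> is small compared with \<open>n\<^sup>2\<close>, and \<open>Z\<close> is about \<open>zeta * n\<close>. In
particular this component has more than \<open>2 * m\<close> vertices, hence more than \<open>m\<close> edges.
\<close>

lemma giant:
  assumes \<eta>: "0 < \<eta>"
  shows "mostly (\<lambda>m n G. Cmax n G \<subseteq> large_vertices m n G \<and>
    real (card (large_vertices m n G)) - real (card (Cmax n G)) \<le> \<eta> * real n \<and>
    real 2 * real m \<le> \<eta> * real n)"
proof -
  note z = zeta_bounds
  define e where "e = min \<eta> (zeta / 8)"
  have e: "0 < e" "e \<le> \<eta>" "e \<le> zeta / 8" using \<eta> z by (auto simp: e_def)
  \<comment> \<open>Since \<open>Z\<close> is at least \<open>zeta * n / 2\<close>, a bound \<open>h * n\<^sup>2\<close> on the far pairs gives \<open>Z - C \<le> e * n\<close>.\<close>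
  define h where "h = e * zeta / 2"
  have h: "0 < h" using e z by (simp add: h_def)
  have crit: "xi = 1 \<or> (\<exists>K. 1 < (\<Sum>k<K. r k * (real k - 1)))" using super by blast
  have "mostly (\<lambda>m n G. (\<bar>real (card (large_vertices m n G)) / real n - zeta\<bar> \<le> zeta / 4 \<and>
      real 2 * real m \<le> e * real n) \<and> real (card (far_pairs m n G)) \<le> h * (real n)\<^sup>2)"
    using z e by (intro mostly_conj large_vertices_concentrated[OF crit] mostly_many few_far_pairs[OF super h]) auto
  then show ?thesis
  proof (rule mostly_mono)
    fix m n G assume n: "1 \<le> n" and G: "G \<in> perfect_matchings (half_edges_n n)"
      and E: "(\<bar>real (card (large_vertices m n G)) / real n - zeta\<bar> \<le> zeta / 4 \<and>
        real 2 * real m \<le> e * real n) \<and> real (card (far_pairs m n G)) \<le> h * (real n)\<^sup>2"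
    define Z where "Z = real (card (large_vertices m n G))"
    define C where "C = real (card (Cmax n G))"
    have n0: "0 < real n" using n by simp
    have "zeta - zeta / 4 \<le> Z / real n" using E unfolding Z_def by linarith
    then have "(zeta - zeta / 4) * real n \<le> Z" using n0 by (simp add: pos_le_divide_eq)
    then have Z: "3 / 4 * (zeta * real n) \<le> Z" by (simp add: algebra_simps)
    have zn: "0 < zeta * real n" using z n0 by simp
    then have Z0: "0 < Z" using Z by linarith
    have "real (card (large_vertices m n G) * card (large_vertices m n G))
        \<le> real (card (far_pairs m n G) + card (large_vertices m n G) * card (Cmax n G))"
      using large_squared_le[OF n G, of m] by (simp only: of_nat_le_iff)
    then have "Z * Z \<le> h * (real n)\<^sup>2 + Z * C" using E by (simp add: Z_def C_def)
    then have "Z * (Z - C) \<le> h * (real n)\<^sup>2" by (simp add: algebra_simps)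
    also have "h * (real n)\<^sup>2 = (1 / 2 * (zeta * real n)) * (e * real n)"
      by (simp add: h_def power2_eq_square)
    also have "\<dots> \<le> Z * (e * real n)"
    proof (rule mult_right_mono)
      show "1 / 2 * (zeta * real n) \<le> Z" using Z zn by linarith
    qed (use e n0 in simp)
    finally have ZC: "Z - C \<le> e * real n" using Z0 by (simp only: mult_le_cancel_left_pos)
    have en: "e * real n \<le> zeta / 8 * real n" "e * real n \<le> \<eta> * real n"
      using e n0 by (intro mult_right_mono; simp)+
    have "real 2 * real m < C"
      using E ZC Z en(1) zn by (simp add: algebra_simps)
    then have "2 * m < card (Cmax n G)" unfolding C_def by linarith
    then have "Cmax n G \<subseteq> large_vertices m n G"
      by (rule large_component_subset[OF G Cmax_component[OF n G]])
    moreover have "Z - C \<le> \<eta> * real n" "real 2 * real m \<le> \<eta> * real n" using ZC en(2) E by linarith+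
    ultimately show "Cmax n G \<subseteq> large_vertices m n G \<and>
      real (card (large_vertices m n G)) - real (card (Cmax n G)) \<le> \<eta> * real n \<and>
      real 2 * real m \<le> \<eta> * real n" by (simp add: Z_def C_def)
  qed
qed

text \<open>
The giant misses at most \<open>\<eta> / 2 * n\<close> of the large vertices, whatever their degree.
\<close>

lemma giant_degree_counts:
  assumes \<eta>: "0 < \<eta>"
  shows "mostly (\<lambda>m n G. \<bar>real (card {v \<in> Cmax n G. d n v = k}) / real n - p k * (1 - xi ^ k)\<bar> \<le> \<eta>)"
proof -
  have crit: "xi = 1 \<or> (\<exists>K. 1 < (\<Sum>k<K. r k * (real k - 1)))" using super by blast
  have e: "0 < \<eta> / 2" using \<eta> by simp
  show ?thesis
  proof (rule mostly_mono[OF mostly_conj[OF giant[OF e] degree_counts[OF crit e, of k]]])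
    fix m n G assume n: "1 \<le> n" and G: "G \<in> perfect_matchings (half_edges_n n)"
      and E: "(Cmax n G \<subseteq> large_vertices m n G \<and>
        real (card (large_vertices m n G)) - real (card (Cmax n G)) \<le> \<eta> / 2 * real n \<and>
        real 2 * real m \<le> \<eta> / 2 * real n) \<and>
        \<bar>real (card {v \<in> large_vertices m n G. d n v = k}) / real n - p k * (1 - xi ^ k)\<bar> \<le> \<eta> / 2"
    let ?Z = "large_vertices m n G" and ?C = "Cmax n G"
    have fin: "finite ?Z" by (simp add: large_vertices_def)
    have sub: "?C \<subseteq> ?Z" using E by blast
    have finC: "finite ?C" using fin sub by (rule rev_finite_subset)
    have le: "card {v \<in> ?C. d n v = k} \<le> card {v \<in> ?Z. d n v = k}"
      using fin sub by (intro card_mono) auto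
    have "card {v \<in> ?Z. d n v = k} \<le> card ({v \<in> ?C. d n v = k} \<union> (?Z - ?C))"
      using fin finC by (intro card_mono) auto
    also have "\<dots> \<le> card {v \<in> ?C. d n v = k} + card (?Z - ?C)" by (rule card_Un_le)
    also have "card (?Z - ?C) = card ?Z - card ?C" by (rule card_Diff_subset[OF finC sub])
    finally have "real (card {v \<in> ?Z. d n v = k}) \<le> real (card {v \<in> ?C. d n v = k}) + \<eta> / 2 * real n"
      using E card_mono[OF fin sub] by linarith
    then have "real (card {v \<in> ?Z. d n v = k}) / real n
        \<le> (real (card {v \<in> ?C. d n v = k}) + \<eta> / 2 * real n) / real n"
      by (rule divide_right_mono) simp
    then have ge: "real (card {v \<in> ?Z. d n v = k}) / real n \<le> real (card {v \<in> ?C. d n v = k}) / real n + \<eta> / 2"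
      using n by (simp add: add_divide_distrib)
    have "real (card {v \<in> ?C. d n v = k}) / real n \<le> real (card {v \<in> ?Z. d n v = k}) / real n"
      using le by (intro divide_right_mono) auto
    then show "\<bar>real (card {v \<in> ?C. d n v = k}) / real n - p k * (1 - xi ^ k)\<bar> \<le> \<eta>"
      using ge E unfolding abs_le_iff by linarith
  qed
qed

lemma Cmax_subset: "1 \<le> n \<Longrightarrow> G \<in> perfect_matchings (half_edges_n n) \<Longrightarrow> Cmax n G \<subseteq> {1..n}"
  using component_subset Cmax_component by blast

lemma giant_size:
  assumes \<eta>: "0 < \<eta>"
  shows "mostly (\<lambda>m n G. \<bar>real (card (Cmax n G)) / real n - zeta\<bar> \<le> \<eta>)"
  using weighted_count_concentrated[of "\<lambda>_. Cmax" "\<lambda>k. p k * (1 - xi ^ k)" "\<lambda>_. 1" \<eta>]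
    giant_degree_counts p_xi \<eta> Cmax_subset by (simp add: zeta_def)

text \<open>
The fixed point equation \<open>gen xi = xi\<close> turns \<open>\<mu> * xi * gen xi\<close> into \<open>\<mu> * xi\<^sup>2\<close>.
\<close>

lemma sum_degree_giant: "(\<Sum>k. real k * (p k * (1 - xi ^ k))) = \<mu> * (1 - xi\<^sup>2)"
proof -
  have "summable (\<lambda>k. real k * xi ^ k * p k)"
  proof (rule summable_comparison_test'[OF sums_summable[OF mean_sums]])
    show "norm (real k * xi ^ k * p k) \<le> real k * p k" for k
      using p_nonneg xi_nonneg xi_le_1
      by (simp add: abs_mult mult_right_mono mult_left_le power_le_one)
  qed
  then have "(\<Sum>k. real k * p k - real k * xi ^ k * p k) = \<mu> - (\<Sum>k. real k * xi ^ k * p k)"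
    using suminf_diff[OF sums_summable[OF mean_sums]] mean_sums by (simp add: sums_iff)
  also have "\<dots> = \<mu> * (1 - xi\<^sup>2)"
    using sum_power_eq_gen[OF xi_nonneg xi_le_1] gen_xi by (simp add: algebra_simps power2_eq_square)
  finally show ?thesis by (simp add: algebra_simps)
qed

lemma giant_edges:
  assumes \<eta>: "0 < \<eta>"
  shows "mostly (\<lambda>m n G. \<bar>real (card (edges_in G (Cmax n G))) / real n - 1 / 2 * \<mu> * (1 - xi\<^sup>2)\<bar> \<le> \<eta>)"
proof -
  have "mostly (\<lambda>m n G. \<bar>(\<Sum>v\<in>Cmax n G. real (d n v)) / real n - (\<Sum>k. real k * (p k * (1 - xi ^ k)))\<bar> \<le> \<eta>)"
    by (rule weighted_count_concentrated[where f = real])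
      (use giant_degree_counts p_xi \<eta> Cmax_subset in auto)
  then show ?thesis
  proof (rule mostly_mono)
    fix m n G assume n: "1 \<le> n" and G: "G \<in> perfect_matchings (half_edges_n n)"
      and E: "\<bar>(\<Sum>v\<in>Cmax n G. real (d n v)) / real n - (\<Sum>k. real k * (p k * (1 - xi ^ k)))\<bar> \<le> \<eta>"
    have "(\<Sum>v\<in>Cmax n G. real (d n v)) = real (2 * card (edges_in G (Cmax n G)))"
      unfolding component_edges[OF G Cmax_component[OF n G]] by simp
    then have eq: "(\<Sum>v\<in>Cmax n G. real (d n v)) / real n = 2 * (real (card (edges_in G (Cmax n G))) / real n)"
      by simp
    show "\<bar>real (card (edges_in G (Cmax n G))) / real n - 1 / 2 * \<mu> * (1 - xi\<^sup>2)\<bar> \<le> \<eta>"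
      using E \<eta> unfolding eq sum_degree_giant by (simp add: abs_le_iff)
  qed
qed

text \<open>
A large second component consists of large vertices that the giant misses.
\<close>

lemma second_small:
  assumes \<eta>: "0 < \<eta>"
  shows "mostly (\<lambda>m n G. \<bar>real (card (Csec n G)) / real n - 0\<bar> \<le> \<eta>)"
  using giant[OF \<eta>]
proof (rule mostly_mono)
  fix m n G assume n: "1 \<le> n" and G: "G \<in> perfect_matchings (half_edges_n n)"
    and E: "Cmax n G \<subseteq> large_vertices m n G \<and>
      real (card (large_vertices m n G)) - real (card (Cmax n G)) \<le> \<eta> * real n \<and>
      real 2 * real m \<le> \<eta> * real n"
  let ?Z = "large_vertices m n G" and ?C = "Cmax n G" and ?S = "Csec n G"
  have fin: "finite ?Z" by (simp add: large_vertices_def)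
  have "real (card ?S) \<le> \<eta> * real n"
  proof (cases "2 * m < card ?S")
    case True
    then have "?S \<noteq> {}" by auto
    then have S: "?S \<in> components n G" "?S \<noteq> ?C"
      using Csec[OF n G] by (auto simp: second_largest_component_def split: if_splits)
    have "?S \<inter> ?C = {}" by (rule components_disjoint[OF S(1) Cmax_component[OF n G] S(2)])
    moreover have "?S \<subseteq> ?Z" by (rule large_component_subset[OF G S(1) True])
    ultimately have "card ?S \<le> card (?Z - ?C)" using fin by (intro card_mono) auto
    also have "\<dots> = card ?Z - card ?C"
      using E fin by (intro card_Diff_subset) (auto intro: finite_subset)
    finally show ?thesis using E card_mono[OF fin, of ?C] by linarith
  next
    case False
    then show ?thesis using E by simp
  qed
  then show "\<bar>real (card ?S) / real n - 0\<bar> \<le> \<eta>" using n by (simp add: pos_divide_le_eq)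
qed

lemma Csec_component:
  "1 \<le> n \<Longrightarrow> G \<in> perfect_matchings (half_edges_n n) \<Longrightarrow> Csec n G = {} \<or> Csec n G \<in> components n G"
  using Csec[of n G] by (auto simp: second_largest_component_def split: if_splits)

end

end

end

section \<open>The limiting degree distribution\<close>

lemma ennreal_suminf_eq_sums:
  fixes a :: "nat \<Rightarrow> real"
  assumes "\<And>k. 0 \<le> a k" "0 \<le> c" "(\<Sum>k. ennreal (a k)) = ennreal c"
  shows "a sums c"
proof -
  have "summable a" using assms by (intro summable_suminf_not_top) auto
  then have "(\<Sum>k. ennreal (a k)) = ennreal (suminf a)"
    using assms by (intro suminf_ennreal_eq summable_sums)
  then have "ennreal (suminf a) = ennreal c" using assms(3) by (rule trans[OF sym])
  moreover have "0 \<le> suminf a" using \<open>summable a\<close> assms(1) by (intro suminf_nonneg)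
  ultimately have "suminf a = c" using ennreal_inj[OF _ assms(2)] by blast
  then show ?thesis using \<open>summable a\<close> by (simp add: sums_iff)
qed

text \<open>
The limit \<open>D\<close> is merely a real random variable; that it is integer-valued has to be deduced from the weak
convergence.
\<close>

locale integer_limit = prob_space M for M :: "'a measure" +
  fixes d :: "nat \<Rightarrow> nat \<Rightarrow> nat" and D :: "'a \<Rightarrow> real"
  assumes D_measurable: "D \<in> borel_measurable M"
    and D_ge_1: "\<P>(\<omega> in M. D \<omega> \<ge> 1) = 1"
    and D_conv: "weak_conv_m
                   (\<lambda>n. distr (measure_pmf (pmf_of_set {1..n})) borel (\<lambda>i. real (d n i)))
                   (distr M borel D)"
begin

lemma average_continuous_lim:
  fixes f :: "real \<Rightarrow> real"
  assumes "\<And>x. isCont f x" "\<And>x. \<bar>f x\<bar> \<le> 1"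
  shows "(\<lambda>n. (\<Sum>v\<in>{1..n}. f (real (d n v))) / real n) \<longlonglongrightarrow> (\<integral>\<omega>. f (D \<omega>) \<partial>M)"
proof -
  let ?N = "\<lambda>n. distr (measure_pmf (pmf_of_set {1..n})) borel (\<lambda>i. real (d n i))"
  have f: "f \<in> borel_measurable borel"
    using assms(1) by (intro borel_measurable_continuous_onI continuous_at_imp_continuous_on) auto
  have "real_distribution (?N n)" for n
    by (rule prob_space.real_distribution_distr[OF prob_space_measure_pmf]) simp
  moreover have "real_distribution (distr M borel D)"
    by (rule real_distribution_distr) (rule D_measurable)
  ultimately have "(\<lambda>n. integral\<^sup>L (?N n) f) \<longlonglongrightarrow> integral\<^sup>L (distr M borel D) f"
    using assms by (intro weak_conv_imp_integral_bdd_continuous_conv[where B = 1] D_conv) auto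
  moreover have "integral\<^sup>L (distr M borel D) f = (\<integral>\<omega>. f (D \<omega>) \<partial>M)"
    by (rule integral_distr[OF D_measurable f])
  moreover have "\<forall>\<^sub>F n in sequentially. integral\<^sup>L (?N n) f = (\<Sum>v\<in>{1..n}. f (real (d n v))) / real n"
    using eventually_ge_at_top[of 1]
  proof eventually_elim
    case (elim n)
    have "integral\<^sup>L (?N n) f = measure_pmf.expectation (pmf_of_set {1..n}) (\<lambda>i. f (real (d n i)))"
      by (rule integral_distr[OF _ f]) simp
    also have "\<dots> = (\<Sum>v\<in>{1..n}. f (real (d n v))) / real n"
      using elim by (subst integral_pmf_of_set) auto
    finally show ?case .
  qed
  ultimately show ?thesis by (simp only: tendsto_cong)
qed

lemma AE_ge_1: "AE \<omega> in M. 1 \<le> D \<omega>"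
  using D_ge_1 D_measurable by (subst prob_Collect_eq_1[symmetric]) auto

text \<open>
The bounded continuous function \<open>\<lambda>x. \<bar>sin (x * pi)\<bar>\<close> vanishes exactly at the integers, so its mean is \<open>0\<close> along
the sequence and therefore in the limit.
\<close>

lemma AE_integer: "AE \<omega> in M. D \<omega> \<in> \<int>"
proof -
  have "(\<lambda>n. (\<Sum>v\<in>{1..n}. \<bar>sin (real (d n v) * pi)\<bar>) / real n) \<longlonglongrightarrow> (\<integral>\<omega>. \<bar>sin (D \<omega> * pi)\<bar> \<partial>M)"
    by (rule average_continuous_lim) (auto intro!: continuous_intros)
  then have "(\<lambda>n :: nat. 0 :: real) \<longlonglongrightarrow> (\<integral>\<omega>. \<bar>sin (D \<omega> * pi)\<bar> \<partial>M)"
    by simp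
  then have "(\<integral>\<omega>. \<bar>sin (D \<omega> * pi)\<bar> \<partial>M) = 0" by (metis LIMSEQ_unique tendsto_const)
  moreover have "integrable M (\<lambda>\<omega>. \<bar>sin (D \<omega> * pi)\<bar>)"
    using D_measurable by (intro integrable_const_bound[where B = 1]) auto
  ultimately have "AE \<omega> in M. \<bar>sin (D \<omega> * pi)\<bar> = 0"
    by (subst (asm) integral_nonneg_eq_0_iff_AE) auto
  then show ?thesis
  proof eventually_elim
    case (elim \<omega>)
    then have "sin (D \<omega> * pi) = 0" by (simp only: abs_eq_0)
    then obtain i :: int where "D \<omega> * pi = of_int i * pi" unfolding sin_zero_iff_int2 by blast
    then have "D \<omega> = of_int i" by simp
    then show ?case by simp
  qed
qed

definition degree_prob :: "nat \<Rightarrow> real" where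
  "degree_prob k = \<P>(\<omega> in M. D \<omega> = real k)"

definition D_nat :: "'a \<Rightarrow> nat" where
  "D_nat \<omega> = nat \<lfloor>D \<omega>\<rfloor>"

lemma D_nat_measurable: "D_nat \<in> measurable M (count_space UNIV)"
  unfolding D_nat_def using D_measurable by measurable

lemma AE_D_nat: "AE \<omega> in M. D \<omega> = real (D_nat \<omega>)"
  using AE_ge_1 AE_integer
  by eventually_elim (auto simp: D_nat_def elim!: Ints_cases)

lemma prob_D_nat: "emeasure M {\<omega> \<in> space M. D_nat \<omega> = k} = ennreal (degree_prob k)"
proof -
  have "\<P>(\<omega> in M. D \<omega> = real k) = \<P>(\<omega> in M. D_nat \<omega> = k)"
  proof (rule measure_eq_AE)
    show "AE \<omega> in M. \<omega> \<in> {\<omega> \<in> space M. D \<omega> = real k} \<longleftrightarrow> \<omega> \<in> {\<omega> \<in> space M. D_nat \<omega> = k}"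
      using AE_D_nat by eventually_elim auto
    show "{\<omega> \<in> space M. D \<omega> = real k} \<in> sets M" using D_measurable by measurable
    show "{\<omega> \<in> space M. D_nat \<omega> = k} \<in> sets M"
      using measurable_sets[OF D_nat_measurable, of "{k}"] by (simp add: vimage_def Int_def conj_commute)
  qed
  then show ?thesis by (simp add: degree_prob_def emeasure_eq_measure)
qed

lemma nn_integral_degree:
  fixes f :: "real \<Rightarrow> real"
  assumes f: "\<And>k. 0 \<le> f (real k)"
  shows "(\<integral>\<^sup>+ \<omega>. ennreal (f (D \<omega>)) \<partial>M) = (\<Sum>k. ennreal (f (real k) * degree_prob k))"
proof -
  let ?A = "\<lambda>k. {\<omega> \<in> space M. D_nat \<omega> = k}"
  have A: "?A k \<in> sets M" for k
    using measurable_sets[OF D_nat_measurable, of "{k}"] by (simp add: vimage_def Int_def conj_commute)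
  have "(\<integral>\<^sup>+ \<omega>. ennreal (f (D \<omega>)) \<partial>M) = (\<integral>\<^sup>+ \<omega>. (\<Sum>k. ennreal (f (real k)) * indicator (?A k) \<omega>) \<partial>M)"
  proof (rule nn_integral_cong_AE)
    show "AE \<omega> in M. ennreal (f (D \<omega>)) = (\<Sum>k. ennreal (f (real k)) * indicator (?A k) \<omega>)"
      using AE_D_nat AE_space
    proof eventually_elim
      case (elim \<omega>)
      have "(\<Sum>k. ennreal (f (real k)) * indicator (?A k) \<omega>)
          = (\<Sum>k\<in>{D_nat \<omega>}. ennreal (f (real k)) * indicator (?A k) \<omega>)"
        by (rule suminf_finite) (auto simp: indicator_def)
      also have "\<dots> = ennreal (f (D \<omega>))" using elim by simp
      finally show ?case by simp
    qed
  qed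
  also have "\<dots> = (\<Sum>k. \<integral>\<^sup>+ \<omega>. ennreal (f (real k)) * indicator (?A k) \<omega> \<partial>M)"
    using A by (intro nn_integral_suminf) auto
  also have "\<dots> = (\<Sum>k. ennreal (f (real k) * degree_prob k))"
    using A f by (simp add: nn_integral_cmult_indicator prob_D_nat ennreal_mult' degree_prob_def)
  finally show ?thesis .
qed

lemma degree_prob_nonneg: "0 \<le> degree_prob k"
  by (simp add: degree_prob_def)

lemma degree_prob_0: "degree_prob 0 = 0"
proof -
  have "AE \<omega> in M. \<not> D \<omega> = 0" using AE_ge_1 by eventually_elim auto
  then have "\<P>(\<omega> in M. D \<omega> = 0) = 0" using D_measurable by (subst prob_Collect_eq_0) auto
  then show ?thesis by (simp add: degree_prob_def)
qed

lemma degree_prob_sums: "degree_prob sums 1"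
proof (rule ennreal_suminf_eq_sums)
  have "(\<Sum>k. ennreal (degree_prob k)) = (\<integral>\<^sup>+ \<omega>. ennreal 1 \<partial>M)"
    using nn_integral_degree[of "\<lambda>_. 1"] by simp
  then show "(\<Sum>k. ennreal (degree_prob k)) = ennreal 1" by (simp add: emeasure_space_1)
qed (simp_all add: degree_prob_nonneg)

lemma mean_degree_sums:
  assumes "integrable M D"
  shows "(\<lambda>k. real k * degree_prob k) sums (\<integral>\<omega>. D \<omega> \<partial>M)"
proof (rule ennreal_suminf_eq_sums)
  have nonneg: "AE \<omega> in M. 0 \<le> D \<omega>" using AE_ge_1 by eventually_elim auto
  show "0 \<le> (\<integral>\<omega>. D \<omega> \<partial>M)" using nonneg by (rule integral_nonneg_AE)
  show "(\<Sum>k. ennreal (real k * degree_prob k)) = ennreal (\<integral>\<omega>. D \<omega> \<partial>M)"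
    using nn_integral_degree[of "\<lambda>x. x"] nn_integral_eq_integral[OF assms nonneg] by simp
qed (simp add: degree_prob_nonneg)

text \<open>
On integers the indicator of \<open>k\<close> agrees with a continuous tent function.
\<close>

lemma degree_count_lim:
  "(\<lambda>n. real (card {v \<in> {1..n}. d n v = k}) / real n) \<longlonglongrightarrow> degree_prob k"
proof -
  define f :: "real \<Rightarrow> real" where "f x = max 0 (1 - \<bar>x - real k\<bar>)" for x
  have f: "f (real j) = of_bool (j = k)" for j
  proof (cases "j = k")
    case False
    then have "1 \<le> \<bar>real j - real k\<bar>" by linarith
    then show ?thesis using False by (simp add: f_def)
  qed (simp add: f_def)
  have "(\<lambda>n. (\<Sum>v\<in>{1..n}. f (real (d n v))) / real n) \<longlonglongrightarrow> (\<integral>\<omega>. f (D \<omega>) \<partial>M)"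
    by (rule average_continuous_lim) (auto simp: f_def[abs_def] intro!: continuous_intros)
  moreover have "(\<Sum>v\<in>{1..n}. f (real (d n v))) = real (card {v \<in> {1..n}. d n v = k})" for n
    by (simp add: f of_bool_def sum.If_cases Int_def)
  moreover have "(\<integral>\<omega>. f (D \<omega>) \<partial>M) = (\<integral>\<omega>. indicator {\<omega> \<in> space M. D \<omega> = real k} \<omega> \<partial>M)"
  proof (rule integral_cong_AE)
    show "AE \<omega> in M. f (D \<omega>) = indicator {\<omega> \<in> space M. D \<omega> = real k} \<omega>"
      using AE_D_nat AE_space
    proof eventually_elim
      case (elim \<omega>)
      have "f (D \<omega>) = of_bool (D_nat \<omega> = k)" using f[of "D_nat \<omega>"] elim(1) by simp
      moreover have "D \<omega> = real k \<longleftrightarrow> D_nat \<omega> = k" using elim(1) by simp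
      ultimately show ?case using elim(2) by (simp add: indicator_def)
    qed
  qed (use D_measurable in \<open>auto simp: f_def[abs_def]\<close>)
  moreover have "{\<omega> \<in> space M. D \<omega> = real k} \<inter> space M = {\<omega> \<in> space M. D \<omega> = real k}" by auto
  ultimately show ?thesis by (simp add: degree_prob_def)
qed

end

section \<open>The phase transition\<close>

theorem theorem3p2:
  fixes d :: "nat \<Rightarrow> nat \<Rightarrow> nat"
    and M :: "'a measure" and D :: "'a \<Rightarrow> real"
    and Cmax Csec :: "nat \<Rightarrow> half_edge set set \<Rightarrow> nat set"
  assumes deg_pos: "\<And>n i. i \<in> {1..n} \<Longrightarrow> d n i \<ge> 1"
    and deg_even: "\<And>n. even (\<Sum>i\<in>{1..n}. d n i)"
    and Cmax: "\<And>n G. n \<ge> 1 \<Longrightarrow> G \<in> perfect_matchings (half_edges n (d n)) \<Longrightarrow>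
                 largest_component n G (Cmax n G)"
    and Csec: "\<And>n G. n \<ge> 1 \<Longrightarrow> G \<in> perfect_matchings (half_edges n (d n)) \<Longrightarrow>
                 second_largest_component n G (Cmax n G) (Csec n G)"
    and "prob_space M"
    and "D \<in> borel_measurable M"
    and D_ge_1: "\<P>(\<omega> in M. D \<omega> \<ge> 1) = 1"
    and D_conv: "weak_conv_m
                   (\<lambda>n. distr (measure_pmf (pmf_of_set {1..n})) borel (\<lambda>i. real (d n i)))
                   (distr M borel D)"
    and D_integrable: "integrable M D"
    and mean_conv: "(\<lambda>n. measure_pmf.expectation (pmf_of_set {1..n}) (\<lambda>i. real (d n i)))
                      \<longlonglongrightarrow> (\<integral>\<omega>. D \<omega> \<partial>M)"
    and D_not_2: "\<P>(\<omega> in M. D \<omega> = 2) < 1"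
  shows "(nu M D > 1 \<longrightarrow>
           (\<exists>\<xi> \<zeta> :: real. 0 \<le> \<xi> \<and> \<xi> < 1 \<and> 0 < \<zeta> \<and> \<zeta> \<le> 1 \<and>
             tendsto_in_prob (\<lambda>n. configuration_model n (d n))
               (\<lambda>n G. real (card (Cmax n G)) / real n) \<zeta> \<and>
             (\<forall>k::nat. tendsto_in_prob (\<lambda>n. configuration_model n (d n))
               (\<lambda>n G. real (card (vertices_of_degree (d n) k (Cmax n G))) / real n)
               (\<P>(\<omega> in M. D \<omega> = real k) * (1 - \<xi> ^ k))) \<and>
             tendsto_in_prob (\<lambda>n. configuration_model n (d n))
               (\<lambda>n G. real (card (edges_in G (Cmax n G))) / real n)
               (1 / 2 * (\<integral>\<omega>. D \<omega> \<partial>M) * (1 - \<xi>\<^sup>2)) \<and>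
             tendsto_in_prob (\<lambda>n. configuration_model n (d n))
               (\<lambda>n G. real (card (Csec n G)) / real n) 0 \<and>
             tendsto_in_prob (\<lambda>n. configuration_model n (d n))
               (\<lambda>n G. real (card (edges_in G (Csec n G))) / real n) 0)) \<and>
         (nu M D \<le> 1 \<longrightarrow>
             tendsto_in_prob (\<lambda>n. configuration_model n (d n))
               (\<lambda>n G. real (card (Cmax n G)) / real n) 0 \<and>
             tendsto_in_prob (\<lambda>n. configuration_model n (d n))
               (\<lambda>n G. real (card (edges_in G (Cmax n G))) / real n) 0)"
proof -
  interpret prob_space M by fact
  interpret integer_limit M d D
    by unfold_locales (fact \<open>D \<in> borel_measurable M\<close> D_ge_1 D_conv)+
  define \<mu> where "\<mu> = (\<integral>\<omega>. D \<omega> \<partial>M)"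
  have mean: "(\<lambda>n. real (\<Sum>v\<in>{1..n}. d n v) / real n) \<longlonglongrightarrow> \<mu>"
  proof (rule Lim_transform_eventually[OF mean_conv[folded \<mu>_def]])
    show "\<forall>\<^sub>F n in sequentially. measure_pmf.expectation (pmf_of_set {1..n}) (\<lambda>i. real (d n i))
        = real (\<Sum>v\<in>{1..n}. d n v) / real n"
      using eventually_ge_at_top[of 1] by eventually_elim (subst integral_pmf_of_set; auto)
  qed
  interpret degree_limit d degree_prob \<mu>
    by unfold_locales (fact deg_pos deg_even degree_prob_nonneg degree_prob_sums degree_prob_0
        degree_count_lim mean_degree_sums[OF D_integrable, folded \<mu>_def] mean)+
  have \<mu>: "0 < \<mu>" using mu_ge_1 by simp
  have nu: "nu M D = (\<Sum>k. ennreal (r k * (real k - 1)))"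
  proof -
    have "0 \<le> real k * (real k - 1)" for k by (cases k) auto
    then have "(\<integral>\<^sup>+ \<omega>. ennreal (D \<omega> * (D \<omega> - 1)) \<partial>M)
        = (\<Sum>k. ennreal (real k * (real k - 1) * degree_prob k))"
      by (rule nn_integral_degree[of "\<lambda>x. x * (x - 1)"])
    moreover have "(\<integral>\<^sup>+ \<omega>. ennreal (D \<omega>) \<partial>M) = ennreal \<mu>"
      unfolding \<mu>_def using AE_ge_1
      by (intro nn_integral_eq_integral D_integrable) (auto elim: eventually_mono)
    ultimately have "nu M D = (\<Sum>k. ennreal (real k * (real k - 1) * degree_prob k) / ennreal \<mu>)"
      by (simp add: nu_def)
    also have "\<dots> = (\<Sum>k. ennreal (r k * (real k - 1)))"
    proof (rule suminf_cong)
      fix k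
      have "0 \<le> real k * (real k - 1) * degree_prob k"
        using degree_prob_nonneg[of k] by (cases k) auto
      then show "ennreal (real k * (real k - 1) * degree_prob k) / ennreal \<mu> = ennreal (r k * (real k - 1))"
        using \<mu> by (simp add: divide_ennreal r_def mult_ac)
    qed
    finally show ?thesis .
  qed
  have r_nonneg': "0 \<le> r k * (real k - 1)" for k using r_nonneg[of k] r_0 by (cases k) auto
  have partial: "(\<Sum>k<K. ennreal (r k * (real k - 1))) = ennreal (\<Sum>k<K. r k * (real k - 1))" for K
    using r_nonneg' by (intro sum_ennreal) auto
  have r2: "r 2 \<noteq> 1"
  proof
    assume "r 2 = 1"
    \<comment> \<open>The mean of \<open>D - 1\<close> is then \<open>2 * P(D = 2) - 1\<close>, but it is at least \<open>P(D = 2)\<close>.\<close>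
    then have eq: "\<mu> = 2 * degree_prob 2" using \<mu> by (simp add: r_def)
    have sums: "(\<lambda>k. real k * degree_prob k - degree_prob k) sums (\<mu> - 1)"
      by (rule sums_diff[OF mean_sums p_sums])
    have "0 \<le> real k * degree_prob k - degree_prob k" for k
      using p_nonneg[of k] p_0 by (cases k) (auto simp: algebra_simps)
    then have "(\<Sum>k\<in>{2}. real k * degree_prob k - degree_prob k) \<le> \<mu> - 1"
      using sum_le_suminf[OF sums_summable[OF sums], of "{2}"] sums by (simp add: sums_iff)
    then have "1 \<le> degree_prob 2" using eq by simp
    then show False using D_not_2 by (simp add: degree_prob_def)
  qed
  note Cs = Cmax Csec
  show ?thesis
  proof (intro conjI impI)
    assume "1 < nu M D"
    have "\<exists>K. 1 < (\<Sum>k<K. r k * (real k - 1))"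
    proof (rule ccontr)
      assume "\<not> ?thesis"
      then have "(\<Sum>k<K. r k * (real k - 1)) \<le> 1" for K by (simp add: not_less)
      then have "nu M D \<le> 1"
        unfolding nu by (intro suminf_le_const summableI) (simp add: partial)
      with \<open>1 < nu M D\<close> show False by simp
    qed
    then obtain K where super: "1 < (\<Sum>k<K. r k * (real k - 1))" by blast
    show "\<exists>\<xi> \<zeta> :: real. 0 \<le> \<xi> \<and> \<xi> < 1 \<and> 0 < \<zeta> \<and> \<zeta> \<le> 1 \<and>
             tendsto_in_prob (\<lambda>n. configuration_model n (d n))
               (\<lambda>n G. real (card (Cmax n G)) / real n) \<zeta> \<and>
             (\<forall>k::nat. tendsto_in_prob (\<lambda>n. configuration_model n (d n))
               (\<lambda>n G. real (card (vertices_of_degree (d n) k (Cmax n G))) / real n)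
               (\<P>(\<omega> in M. D \<omega> = real k) * (1 - \<xi> ^ k))) \<and>
             tendsto_in_prob (\<lambda>n. configuration_model n (d n))
               (\<lambda>n G. real (card (edges_in G (Cmax n G))) / real n)
               (1 / 2 * (\<integral>\<omega>. D \<omega> \<partial>M) * (1 - \<xi>\<^sup>2)) \<and>
             tendsto_in_prob (\<lambda>n. configuration_model n (d n))
               (\<lambda>n G. real (card (Csec n G)) / real n) 0 \<and>
             tendsto_in_prob (\<lambda>n. configuration_model n (d n))
               (\<lambda>n G. real (card (edges_in G (Csec n G))) / real n) 0"
    proof (rule exI[of _ xi], rule exI[of _ zeta], intro conjI allI)
      show "0 \<le> xi" "xi < 1" using xi_nonneg xi_less_1[OF super] by auto
      show "0 < zeta" "zeta \<le> 1" using zeta_bounds[OF Cs super] by auto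
      show "tendsto_in_prob (\<lambda>n. configuration_model n (d n))
          (\<lambda>n G. real (card (Cmax n G)) / real n) zeta"
        by (intro tendsto_in_prob_if_mostly giant_size[OF Cs super])
      show "tendsto_in_prob (\<lambda>n. configuration_model n (d n))
          (\<lambda>n G. real (card (vertices_of_degree (d n) k (Cmax n G))) / real n)
          (\<P>(\<omega> in M. D \<omega> = real k) * (1 - xi ^ k))" for k
        unfolding vertices_of_degree_def degree_prob_def[symmetric]
        by (intro tendsto_in_prob_if_mostly giant_degree_counts[OF Cs super])
      show "tendsto_in_prob (\<lambda>n. configuration_model n (d n))
          (\<lambda>n G. real (card (edges_in G (Cmax n G))) / real n)
          (1 / 2 * (\<integral>\<omega>. D \<omega> \<partial>M) * (1 - xi\<^sup>2))"
        unfolding \<mu>_def[symmetric]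
        by (intro tendsto_in_prob_if_mostly giant_edges[OF Cs super])
      show "tendsto_in_prob (\<lambda>n. configuration_model n (d n))
          (\<lambda>n G. real (card (Csec n G)) / real n) 0"
        by (intro tendsto_in_prob_if_mostly second_small[OF Cs super])
      show "tendsto_in_prob (\<lambda>n. configuration_model n (d n))
          (\<lambda>n G. real (card (edges_in G (Csec n G))) / real n) 0"
        by (intro tendsto_in_prob_if_mostly edges_negligible second_small[OF Cs super]
            Csec_component[OF Cs super])
    qed
  next
    assume "nu M D \<le> 1"
    have "(\<Sum>k<K. r k * (real k - 1)) \<le> 1" for K
    proof -
      have "ennreal (\<Sum>k<K. r k * (real k - 1)) \<le> nu M D"
        unfolding nu partial[symmetric] by (intro sum_le_suminf summableI) auto
      also have "\<dots> \<le> ennreal 1" using \<open>nu M D \<le> 1\<close> by simp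
      finally show ?thesis by (simp only: ennreal_le_iff zero_le_one)
    qed
    then have xi: "xi = 1" using r2 by (rule xi_eq_1)
    show "tendsto_in_prob (\<lambda>n. configuration_model n (d n))
        (\<lambda>n G. real (card (Cmax n G)) / real n) 0"
      by (intro tendsto_in_prob_if_mostly no_giant[OF Cs xi])
    show "tendsto_in_prob (\<lambda>n. configuration_model n (d n))
        (\<lambda>n G. real (card (edges_in G (Cmax n G))) / real n) 0"
      by (intro tendsto_in_prob_if_mostly edges_negligible no_giant[OF Cs xi] disjI2
          Cmax_component[OF Cs])
  qed
qed

end
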